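(* For every dimension $n$ there exists a constant $C$, depending only on $n$, such that the following holds. Let $0<\delta<1$, $1\leq r\leq p<\frac n\delta$, $f\in L^1_{\mathrm{loc}}(\mathbb R^n)$ and $w\in A_r$. Let $q$ be defined by \[ \frac1p-\frac1q=\frac\delta n\,\frac1{r+\log[w]_{A_r}}. \] Then \[ \inf_{c\in\mathbb R}\biggl(\frac1{w(Q)}\int_Q|f-c|^q\,w\,dx\biggr)^{\frac1q} \leq C\,\frac{npr}{nr-\delta p}\,[w]_{A_p}^{\frac1p}[w]_{A_\infty}\,\frac{(1-\delta)^{\frac1p}}{\delta^{1-\frac1p}}\,\mathrm l(Q)^\delta\biggl(\frac1{w(Q)}\int_Q\int_Q\frac{|f(x)-f(y)|^p}{|x-y|^{n+\delta p}}\,dy\,w(x)\,dx\biggr)^{\frac1p} \] for every cube $Q\subset\mathbb R^n$.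
   Context: A cube is a closed axis-parallel cube in $\mathbb R^n$, with side length $\mathrm l(Q)$; $\mathcal L$ is Lebesgue measure. A weight is a function $w\in L^1_{\mathrm{loc}}(\mathbb R^n)$ with $w>0$ almost everywhere, and $w(Q)=\int_Q w\,dx$. The Hardy--Littlewood maximal function is $\mathrm M g(x)=\sup_{Q\ni x}\frac1{\mathcal L(Q)}\int_Q|g|\,dy$, the supremum over all cubes containing $x$. A weight $w$ is in $A_1$ if there is a constant $C$ with $\mathrm M w(x)\leq Cw(x)$ for almost every $x$; $[w]_{A_1}$ is the smallest such $C$. For $1<p<\infty$, $w\in A_p$ if \[ [w]_{A_p}=\sup_Q\biggl(\frac1{\mathcal L(Q)}\int_Q w\,dx\biggr)\biggl(\frac1{\mathcal L(Q)}\int_Q w^{1-p'}\,dx\biggr)^{p-1}<\infty,\qquad p'=\frac p{p-1}. \] $A_\infty=\bigcup_{1\leq p<\infty}A_p$ and $[w]_{A_\infty}=\sup_Q\frac1{w(Q)}\int_Q\mathrm M(1_Qw)\,dx$. $\log$ is the natural logarithm. *)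

theory Defs
  imports "HOL-Analysis.Analysis"
begin

definition cube :: "real ^ 'n \<Rightarrow> real \<Rightarrow> (real ^ 'n) set" where
  "cube a l = cbox a (\<chi> i. a $ i + l)"

definition cubes :: "(real ^ 'n) set set" where
  "cubes = {cube a l |a l. 0 < l}"

definition locally_integrable :: "(real ^ 'n \<Rightarrow> real) \<Rightarrow> bool" where
  "locally_integrable f \<longleftrightarrow> (\<forall>K. compact K \<longrightarrow> f absolutely_integrable_on K)"

definition weight :: "(real ^ 'n \<Rightarrow> real) \<Rightarrow> bool" where
  "weight w \<longleftrightarrow> locally_integrable w \<and> (AE x in lebesgue. 0 < w x)"

text \<open>
  All integrals of nonnegative functions, suprema and infima below are taken in \<^typ>\<open>ennreal\<close>, so
  that infinite values are kept. Powers in \<^typ>\<open>ennreal\<close> are only ever taken with a positive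
  exponent, for which \<open>\<infinity>\<close> is mapped to \<open>\<infinity>\<close>.
\<close>

definition ennreal_powr :: "ennreal \<Rightarrow> real \<Rightarrow> ennreal" where
  "ennreal_powr x s = (if x = \<infinity> then \<infinity> else ennreal (enn2real x powr s))"

definition wmeas :: "(real ^ 'n \<Rightarrow> real) \<Rightarrow> (real ^ 'n) set \<Rightarrow> ennreal" where
  "wmeas w Q = (\<integral>\<^sup>+x\<in>Q. ennreal (w x) \<partial>lebesgue)"

definition HL_maximal :: "(real ^ 'n \<Rightarrow> real) \<Rightarrow> real ^ 'n \<Rightarrow> ennreal" where
  "HL_maximal g x =
     (SUP Q \<in> {Q \<in> cubes. x \<in> Q}. (\<integral>\<^sup>+y\<in>Q. ennreal \<bar>g y\<bar> \<partial>lebesgue) / emeasure lebesgue Q)"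

definition A1_const :: "(real ^ 'n \<Rightarrow> real) \<Rightarrow> ennreal" where
  "A1_const w = Inf {ennreal C |C. AE x in lebesgue. HL_maximal w x \<le> ennreal (C * w x)}"

text \<open>
  The exponent \<open>1 - p/(p - 1)\<close> is negative; the value of \<open>w x powr (1 - p/(p - 1))\<close> where
  \<open>w x \<le> 0\<close> is irrelevant, since this only happens on a null set.
\<close>

definition Ap_const :: "real \<Rightarrow> (real ^ 'n \<Rightarrow> real) \<Rightarrow> ennreal" where
  "Ap_const p w =
     (if p = 1 then A1_const w
      else SUP Q \<in> cubes.
        ((\<integral>\<^sup>+x\<in>Q. ennreal (w x) \<partial>lebesgue) / emeasure lebesgue Q) *
        ennreal_powr
          ((\<integral>\<^sup>+x\<in>Q. ennreal (w x powr (1 - p / (p - 1))) \<partial>lebesgue) / emeasure lebesgue Q) (p - 1))"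

definition Ap_weight :: "real \<Rightarrow> (real ^ 'n \<Rightarrow> real) \<Rightarrow> bool" where
  "Ap_weight p w \<longleftrightarrow> weight w \<and>
     (if p = 1 then \<exists>C. AE x in lebesgue. HL_maximal w x \<le> ennreal (C * w x)
      else Ap_const p w < \<infinity>)"

definition Ainf_const :: "(real ^ 'n \<Rightarrow> real) \<Rightarrow> ennreal" where
  "Ainf_const w =
     (SUP Q \<in> cubes. (\<integral>\<^sup>+x\<in>Q. HL_maximal (\<lambda>y. indicator Q y * w y) x \<partial>lebesgue) / wmeas w Q)"

end

theory Submission
  imports Defs
begin

text \<open>
  Let \<open>\<mu> = w dx\<close>. The dyadic cubes \<open>Q = P\<^sub>0 \<supseteq> P\<^sub>1 \<supseteq> \<dots>\<close> shrinking to \<open>x\<close> bound \<open>|f(x) - f\<^bsub>Q\<^esub>|\<close> by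
  the sum of the oscillations of \<open>f\<close> on the \<open>P\<^sub>k\<close>. By the averaging property of \<open>A\<^sub>p\<close> weights each
  oscillation is at most \<open>K l(P\<^sub>k)\<^sup>\<delta> y\<^sub>k\<^bsup>1/p\<^esup>\<close>, where \<open>y\<^sub>k\<close> is a \<open>\<mu>\<close>-mean of the fractional energy
  over \<open>P\<^sub>k\<close>; the factor \<open>(1 - \<delta>)\<^bsup>1/p\<^esup>\<close> comes from comparing the oscillation at one scale with
  all smaller ones through midpoints. The \<open>A\<^sub>r\<close> condition gives
  \<open>(l(P\<^sub>k)/l(Q))\<^sup>\<delta> \<le> e (\<mu>(P\<^sub>k)/\<mu>(Q))\<^bsup>1/p-1/q\<^esup>\<close>; the logarithm in the definition of \<open>q\<close> absorbs the
  constant of \<open>w\<close>. Splitting the sum over \<open>k\<close> as in Hedberg's argument bounds it by \<open>q G(x)\<^bsup>1/q\<^esup>\<close> up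
  to normalisation. For \<open>\<delta> \<ge> 1/2\<close>, \<open>G = sup y\<^sub>k\<close> is a dyadic maximal function of weak type \<open>(1,1)\<close>.
  For \<open>\<delta> \<le> 1/2\<close> only the top scale of the energy is used in \<open>y\<^sub>k\<close>; then \<open>G = \<Sum> y\<^sub>k\<close> is
  integrable, and Hoelder's inequality over the scales costs \<open>\<delta>\<^bsup>-(1-1/p)\<^esup>\<close>. Truncation at dyadic levels
  around a median turns the weak-type estimate into the strong one. Of the \<open>A\<^sub>\<infinity>\<close> constant only the
  lower bound \<open>1\<close> is needed.
\<close>

section \<open>Hoelder inequality and dyadic sums\<close>

text \<open>Two costs pull in opposite directions. A supremum over the generations leaves a
  geometric series of size 1/d, too much for small d; keeping only the top scale of the energy gives
  up the factor 1 - d, harmless only while d stays away from 1. Hence the case distinction at 1/2.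
  The gain of 1 - d has this origin: descending j generations through midpoints loses 2^(j(n+p)),
  while the kernel pays 2^(j(n+dp)). With weights 2^(-jp(1-d)) the estimates of all scales can be
  added, and the oscillation is then counted about 1/(p(1-d)) times against a single energy. The
  factor npr/(nr-dp) is an upper bound for q, and q enters as the sum of the geometric series before
  Hedberg's stopping index. Truncation survives the nonlocal energy because the layers of a function
  are monotone in its value, so the p-th powers of their differences add up to at most the p-th
  power of the full difference. It also makes every function that enters the dyadic argument
  bounded. Constants independent of p and q result from taking p-th and q-th roots of numbers that
  are at least 1.\<close>

lemma nn_integral_Hoelder:
  fixes u v :: "'a \<Rightarrow> real"
  assumes p: "1 < p" and [measurable]: "u \<in> borel_measurable N" "v \<in> borel_measurable N"
    and nonneg: "\<And>x. 0 \<le> u x" "\<And>x. 0 \<le> v x"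
    and S: "0 \<le> S" "(\<integral>\<^sup>+x. ennreal (u x powr p) \<partial>N) \<le> ennreal S"
    and V: "0 \<le> V" "(\<integral>\<^sup>+x. ennreal (v x powr (p / (p - 1))) \<partial>N) \<le> ennreal V"
  shows "(\<integral>\<^sup>+x. ennreal (u x * v x) \<partial>N) \<le> ennreal (S powr (1 / p) * V powr (1 - 1 / p))"
proof -
  define p' where "p' = p / (p - 1)"
  have p': "0 < p'" "1 / p' = 1 - 1 / p" using p by (auto simp: p'_def field_simps)
  have zero: "AE x in N. u x * v x = 0"
    if "(\<integral>\<^sup>+x. ennreal (g x powr s) \<partial>N) \<le> ennreal 0" "g \<in> borel_measurable N" "g = u \<or> g = v" "0 < s" for g s
  proof -
    have [measurable]: "g \<in> borel_measurable N" by fact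
    have "(\<integral>\<^sup>+x. ennreal (g x powr s) \<partial>N) = 0" using that by simp
    then have "AE x in N. ennreal (g x powr s) = 0" by (subst (asm) nn_integral_0_iff_AE) auto
    then show ?thesis
    proof eventually_elim
      case (elim x)
      then have "g x = 0" using that(4) by (simp add: ennreal_eq_0_iff)
      then show ?case using that(3) by auto
    qed
  qed
  have zero': "(\<integral>\<^sup>+x. ennreal (u x * v x) \<partial>N) = 0" if "AE x in N. u x * v x = 0"
    using that by (subst nn_integral_0_iff_AE) auto
  show ?thesis
  \<comment> \<open>With \<open>S\<close> or \<open>V\<close> zero the factors cannot be normalised,
    but then one of them vanishes almost everywhere.\<close>
  proof (cases "S = 0 \<or> V = 0")
    case True
    then have "AE x in N. u x * v x = 0"
      using zero[of u p] zero[of v p'] S V p p' by (auto simp: p'_def)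
    then show ?thesis by (simp add: zero')
  next
    case False
    then have pos: "0 < S" "0 < V" using S V by auto
    define s where "s = S powr (1 / p)"
    define t where "t = V powr (1 - 1 / p)"
    have st: "0 < s" "0 < t" "s powr p = S" "t powr p' = V"
      using pos p p'  by (auto simp: s_def t_def powr_powr p'(2)[symmetric])
    \<comment> \<open>Young's inequality for the factors scaled to norm one; after integration the
      two terms contribute 1/p and 1/p', which add up to 1.\<close>
    have young: "u x * v x \<le> (s * t) * (1 / (p * S) * u x powr p + 1 / (p' * V) * v x powr p')" for x
    proof -
      have "(u x / s) * (v x / t) \<le> (u x / s) powr p / p + (v x / t) powr p' / p'"
        by (rule Youngs_inequality) (use p p' nonneg st in \<open>auto simp: p'_def divide_simps\<close>)
      also have "\<dots> = 1 / (p * S) * u x powr p + 1 / (p' * V) * v x powr p'"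
        using st nonneg[of x] by (simp add: powr_divide field_simps)
      finally show ?thesis using st by (simp add: field_simps)
    qed
    have "(\<integral>\<^sup>+x. ennreal (u x * v x) \<partial>N)
        \<le> (\<integral>\<^sup>+x. ennreal (s * t) * (ennreal (1 / (p * S)) * ennreal (u x powr p)
            + ennreal (1 / (p' * V)) * ennreal (v x powr p')) \<partial>N)"
      using young st p p' pos
      by (intro nn_integral_mono)
        (auto simp flip: ennreal_mult ennreal_plus simp: mult_nonneg_nonneg intro!: ennreal_leI)
    also have "\<dots> = ennreal (s * t) * (ennreal (1 / (p * S)) * (\<integral>\<^sup>+x. ennreal (u x powr p) \<partial>N)
            + ennreal (1 / (p' * V)) * (\<integral>\<^sup>+x. ennreal (v x powr p') \<partial>N))"
      by (simp add: nn_integral_cmult nn_integral_add)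
    also have "\<dots> \<le> ennreal (s * t) * (ennreal (1 / (p * S)) * ennreal S + ennreal (1 / (p' * V)) * ennreal V)"
      using S V by (intro mult_left_mono add_mono) (auto simp: p'_def)
    also have "\<dots> = ennreal (s * t * (1 / (p * S) * S + 1 / (p' * V) * V))"
      using st pos p p' by (simp flip: ennreal_mult ennreal_plus)
    also have "1 / (p * S) * S + 1 / (p' * V) * V = 1" using pos p'(2) by simp
    finally show ?thesis by (simp add: s_def t_def)
  qed
qed

lemma nn_integral_powr_Jensen:
  fixes u :: "'a \<Rightarrow> real"
  assumes p: "1 \<le> p" and [measurable]: "u \<in> borel_measurable N" "E \<in> sets N"
    and nonneg: "\<And>x. 0 \<le> u x"
    and S: "0 \<le> S" "(\<integral>\<^sup>+x\<in>E. ennreal (u x powr p) \<partial>N) \<le> ennreal S"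
    and V: "0 \<le> V" "emeasure N E \<le> ennreal V"
  shows "(\<integral>\<^sup>+x\<in>E. ennreal (u x) \<partial>N) \<le> ennreal (V powr (1 - 1 / p) * S powr (1 / p))"
proof (cases "p = 1")
  case True
  \<comment> \<open>\<open>0 powr 0\<close> is 0, so for \<open>V = 0\<close> the right-hand side is
    0 even at \<open>p = 1\<close>; then \<open>E\<close> is a null set.\<close>
  then show ?thesis using S V nonneg by (cases "V = 0") (auto simp: nn_integral_null_set null_sets_def)
next
  case False
  then have p1: "1 < p" using p by simp
  have "(\<integral>\<^sup>+x. ennreal ((u x * indicator E x) * indicator E x) \<partial>N)
      \<le> ennreal (S powr (1 / p) * V powr (1 - 1 / p))"
  proof (rule nn_integral_Hoelder[OF p1])
    have "(\<integral>\<^sup>+x. ennreal ((u x * indicator E x) powr p) \<partial>N) = (\<integral>\<^sup>+x\<in>E. ennreal (u x powr p) \<partial>N)"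
      using p by (intro nn_integral_cong) (auto simp: indicator_def)
    then show "(\<integral>\<^sup>+x. ennreal ((u x * indicator E x) powr p) \<partial>N) \<le> ennreal S" using S by simp
    have "(\<integral>\<^sup>+x. ennreal (indicator E x powr (p / (p - 1))) \<partial>N) = (\<integral>\<^sup>+x. indicator E x \<partial>N)"
      using p1 by (intro nn_integral_cong) (auto simp: indicator_def)
    then show "(\<integral>\<^sup>+x. ennreal (indicator E x powr (p / (p - 1))) \<partial>N) \<le> ennreal V" using V by simp
  qed (use nonneg S V in auto)
  moreover have "(\<integral>\<^sup>+x. ennreal ((u x * indicator E x) * indicator E x) \<partial>N) = (\<integral>\<^sup>+x\<in>E. ennreal (u x) \<partial>N)"
    by (intro nn_integral_cong) (auto simp: indicator_def)
  ultimately show ?thesis by (simp add: mult.commute)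
qed

text \<open>The chord of the convex function 2^(-x) over [0, 1]. It bounds a geometric series of
  ratio 2^(-x) by 2/x.\<close>

lemma one_minus_two_powr_lower:
  fixes x :: real
  assumes "0 \<le> x" "x \<le> 1"
  shows "x / 2 \<le> 1 - 2 powr (- x)"
proof -
  have "2 powr (- x) = 2 powr ((1 - x) * 0 + x * (-1))" by simp
  have "convex_on UNIV (\<lambda>x. 2 powr x :: real)"
    unfolding powr_def by (rule convex_on_subset[of UNIV]) (auto intro!: f''_ge0_imp_convex derivative_eq_intros)
  then have "2 powr ((1 - x) *\<^sub>R 0 + x *\<^sub>R (-1)) \<le> (1 - x) * 2 powr 0 + x * (2 powr (-1) :: real)"
    using assms by (intro convex_onD) auto
  then show ?thesis by (simp add: powr_minus field_simps)
qed

text \<open>The tangent at 0, with ln 2 < 1. This direction is the one that produces the factor 1 -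
  d.\<close>

lemma one_minus_two_powr_upper:
  fixes x :: real
  assumes "0 \<le> x"
  shows "1 - 2 powr (- x) \<le> x"
proof -
  have "1 - x * ln 2 \<le> 2 powr (-x)" using exp_ge_add_one_self[of "- x * ln 2"] by (simp add: powr_def)
  moreover have "x * ln 2 \<le> x * (1::real)" by (intro mult_left_mono) (use assms ln_2_less_1 in auto)
  ultimately show ?thesis by linarith
qed

lemma geometric_powr_sum_le:
  fixes d :: real
  assumes "0 < d"
  shows "(\<Sum>k\<in>{N..<M}. 2 powr (- real k * d)) \<le> 2 powr (- real N * d) / (1 - 2 powr (- d))"
proof -
  define r where "r = (2::real) powr (- d)"
  have r: "0 < r" "r < 1" using assms by (auto simp: r_def powr_less_one)
  have eq: "2 powr (- real k * d) = r ^ k" for k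
    by (simp add: r_def powr_powr mult.commute flip: powr_realpow)
  have "(\<Sum>k\<in>{N..<M}. r ^ k) \<le> r ^ N / (1 - r)"
  proof (cases "N \<le> M")
    case True
    from True have "(1 - r) * (\<Sum>k\<in>{N..<M}. r ^ k) = r ^ N - r ^ M"
      by (induction M rule: dec_induct) (simp_all add: distrib_left, simp add: algebra_simps)
    then have "(\<Sum>k\<in>{N..<M}. r ^ k) = (r ^ N - r ^ M) / (1 - r)"
      using r by (simp add: eq_divide_eq mult.commute)
    then show ?thesis using r by (simp add: divide_right_mono)
  qed (use r in auto)
  then show ?thesis unfolding eq r_def .
qed

text \<open>As \<open>b \<ge> 1\<close>, each term at least doubles the previous one, so the largest
  dominates. With \<open>t\<close> the ratio of a diameter to |x - y|, the kernel dominates a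
  weighted sum of indicators of dyadic distances.\<close>

lemma dyadic_kernel_sum:
  fixes t b :: real
  assumes "1 \<le> b" "0 < t"
  shows "(\<Sum>j<J. if 2 ^ j \<le> t then (2 ^ j) powr b else 0) \<le> 2 * t powr b"
proof -
  \<comment> \<open>Capping \<open>t\<close> at 2^J / 2, the largest power that can have been
    summed, makes the bound inductive: raising the cap pays for the new term.\<close>
  have "(\<Sum>j<J. if 2 ^ j \<le> t then (2 ^ j) powr b else 0) \<le> 2 * (min t (2 ^ J / 2)) powr b"
  proof (induction J)
    case 0
    then show ?case by simp
  next
    case (Suc J)
    show ?case
    proof (cases "2 ^ J \<le> t")
      case True
      have "2 * (min t (2 ^ J / 2)) powr b \<le> 2 * (2 ^ J / 2) powr b"
        by (intro mult_left_mono powr_mono2) (use assms in auto)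
      also have "\<dots> = 2 * 2 powr (-b) * (2 ^ J) powr b"
        by (simp add: powr_divide powr_minus field_simps)
      also have "\<dots> \<le> 1 * (2 ^ J) powr b"
      proof (intro mult_right_mono)
        have "2 * 2 powr (- b) = 2 powr (1 - b)" by (simp add: powr_diff powr_minus field_simps)
        also have "\<dots> \<le> 1" using assms powr_mono[of "1-b" 0 2] by simp
        finally show "2 * 2 powr (- b) \<le> 1" .
      qed auto
      finally have "2 * (min t (2 ^ J / 2)) powr b \<le> (2 ^ J) powr b" by simp
      moreover have "min t (2 ^ Suc J / 2) = 2 ^ J" using True by simp
      ultimately show ?thesis using Suc True by simp
    next
      case False
      have "2 * (min t (2 ^ J / 2)) powr b \<le> 2 * (min t (2 ^ Suc J / 2)) powr b"
        using assms by (intro mult_left_mono powr_mono2) (auto simp: min_def)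
      then show ?thesis using Suc False by simp
    qed
  qed
  also have "\<dots> \<le> 2 * t powr b" using assms by (intro mult_left_mono powr_mono2) auto
  finally show ?thesis .
qed

text \<open>
  While \<open>2\<^bsup>-kd\<^esup>\<close> exceeds \<open>e (A\<^sup>p/g)\<^bsup>eta\<^esup>\<close> the mass bound makes the terms grow geometrically in \<open>k\<close>,
  so the last of them dominates; the remaining terms are covered by the tail bound.
\<close>
lemma hedberg_sum:
  fixes y om :: "nat \<Rightarrow> real"
  assumes p: "1 \<le> p" "p < q" and eta: "eta = 1 / p - 1 / q" "eta \<le> d" "0 < d"
    and A: "0 < A" and g: "0 \<le> g" and B: "0 \<le> B"
    and y: "\<And>k. 0 \<le> y k" and om: "\<And>k. 0 < om k"
    and decay: "\<And>k. 2 powr (- real k * d) \<le> exp 1 * om k powr eta"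
    and mass: "\<And>k. om k * y k \<le> A powr p"
    and tail: "\<And>N M. (\<Sum>k\<in>{N..<M}. 2 powr (- real k * d) * y k powr (1 / p)) \<le> B * 2 powr (- real N * d) * g powr (1 / p)"
  shows "(\<Sum>k<M. 2 powr (- real k * d) * y k powr (1 / p)) \<le> exp 1 * (2 * q + B) * A powr (1 - p / q) * g powr (1 / q)"
proof (cases "g = 0")
  case True
  then show ?thesis using tail[of 0 M] by (simp add: atLeast0LessThan)
next
  case False
  with g have g: "0 < g" by simp
  have eta0: "0 < eta" using p by (simp add: eta field_simps)
  define lam where "lam = A powr p / g"
  have lam: "0 < lam" using A g by (simp add: lam_def)
  \<comment> \<open>At this value of 2^(-kd) the mass bound and the tail bound balance.\<close>
  define sig where "sig = exp 1 * lam powr eta"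
  have sig: "0 < sig" using lam by (simp add: sig_def)
  \<comment> \<open>\<open>1 / (p * eta)\<close> turns the decay bound into one on
    \<open>om k powr (1 / p)\<close>; its excess \<open>th\<close> over 1 drives the geometric
    growth.\<close>
  define th where "th = 1 / (q * eta)"
  have th: "0 < th" "1 / (p * eta) = 1 + th"
    using eta0 p by (auto simp: th_def eta field_simps)
  have "(\<lambda>k. (2 powr (- d)) ^ k) \<longlonglongrightarrow> 0"
    using eta by (intro LIMSEQ_power_zero) (auto simp: powr_less_one)
  then have "\<forall>\<^sub>F k in sequentially. (2 powr (- d)) ^ k < sig" using sig by (rule order_tendstoD)
  then obtain N0 where "(2 powr (- d)) ^ N0 < sig" by (auto simp: eventually_sequentially)
  then have ex: "2 powr (- real N0 * d) \<le> sig" by (simp add: powr_powr mult.commute flip: powr_realpow)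
  define N where "N = (LEAST k. 2 powr (- real k * d) \<le> sig)"
  have N: "2 powr (- real N * d) \<le> sig" unfolding N_def by (rule LeastI) (rule ex)
  have less: "sig < 2 powr (- real k * d)" if "k < N" for k
    using not_less_Least[of k "\<lambda>k. 2 powr (- real k * d) \<le> sig"] that by (auto simp: N_def)
  have key1: "A powr (1 - p / q) * g powr (1 / q) = A * lam powr (- 1 / q)"
  proof -
    have "A powr (1 - p / q) = A * A powr (- (p / q))" using A by (subst powr_diff) (simp add: powr_minus divide_inverse)
    moreover have "lam powr (- 1 / q) = A powr (- (p / q)) * g powr (1 / q)"
      using A g by (simp add: lam_def powr_divide powr_powr powr_minus divide_simps)
    ultimately show ?thesis by simp
  qed
  have key2: "lam powr eta * g powr (1 / p) = A powr (1 - p / q) * g powr (1 / q)"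
  proof -
    have "lam powr eta * g powr (1 / p) = A powr (p * eta) * (g powr (1 / p) / g powr eta)"
      using A g by (simp add: lam_def powr_divide powr_powr)
    also have "p * eta = 1 - p / q" using p by (simp add: eta field_simps)
    also have "g powr (1 / p) / g powr eta = g powr (1 / q)"
      by (simp add: eta flip: powr_diff)
    finally show ?thesis .
  qed
  have large: "2 powr (- real k * d) * y k powr (1 / p)
      \<le> exp 1 * A * lam powr (- 1 / q) * 2 powr (- real (N - 1 - k) * (d * th))" if "k < N" for k
  proof -
    define rho where "rho = 2 powr (- real k * d)"
    have rho: "0 < rho" by (simp add: rho_def)
    have "y k \<le> A powr p / om k" using mass[of k] om[of k] by (simp add: field_simps)
    then have "y k powr (1 / p) \<le> (A powr p / om k) powr (1 / p)" using y p by (intro powr_mono2) auto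
    also have "\<dots> = A * om k powr (- 1 / p)"
      using A om[of k] p by (simp add: powr_divide powr_powr powr_minus divide_simps)
    finally have y1: "y k powr (1 / p) \<le> A * om k powr (- 1 / p)" .
    have "rho / exp 1 \<le> om k powr eta" using decay[of k] by (simp add: rho_def field_simps)
    then have "(rho / exp 1) powr (1 / (p * eta)) \<le> (om k powr eta) powr (1 / (p * eta))"
      using rho p eta0 by (intro powr_mono2) auto
    also have "\<dots> = om k powr (1 / p)" using eta0 by (simp add: powr_powr)
    finally have "om k powr (- 1 / p) \<le> (rho / exp 1) powr (- (1 + th))"
      using rho om[of k] unfolding th(2) minus_divide_left[symmetric] powr_minus
      by (intro le_imp_inverse_le) auto
    then have "rho * y k powr (1 / p) \<le> rho * (A * (rho / exp 1) powr (- (1 + th)))"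
      using y1 A rho by (smt (verit, ccfv_SIG) mult_left_mono)
    also have "\<dots> = A * exp 1 * (rho / exp 1) powr (- th)"
      using rho by (simp add: powr_diff powr_minus powr_add field_simps)
    also have "\<dots> \<le> A * exp 1 * (lam powr eta * 2 powr (real (N - 1 - k) * d)) powr (- th)"
    proof (intro mult_left_mono powr_mono2')
      have "sig < 2 powr (- real (N - 1) * d)" using less[of "N - 1"] that by simp
      then have "sig * 2 powr (real (N - 1 - k) * d) \<le> 2 powr (- real (N - 1) * d) * 2 powr (real (N - 1 - k) * d)"
        by (intro mult_right_mono) auto
      also have "\<dots> = rho"
        using that by (simp add: rho_def of_nat_diff algebra_simps flip: powr_add)
      finally show "lam powr eta * 2 powr (real (N - 1 - k) * d) \<le> rho / exp 1"
        by (simp add: sig_def field_simps)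
    qed (use A lam th in auto)
    also have "(lam powr eta * 2 powr (real (N - 1 - k) * d)) powr (- th) = lam powr (- 1 / q) * 2 powr (- real (N - 1 - k) * (d * th))"
      using lam eta0 p by (subst powr_mult) (auto simp: powr_powr th_def mult_ac)
    finally show ?thesis by (simp add: rho_def mult_ac)
  qed
  \<comment> \<open>Since \<open>eta \<le> d\<close>, consecutive bounds grow at least by the ratio
    2^(1/q), and the series costs 2q. This is how q enters the constant.\<close>
  have dth: "1 / q \<le> d * th" using eta eta0 p by (simp add: th_def divide_simps)
  have "(\<Sum>k<N. 2 powr (- real k * d) * y k powr (1 / p))
      \<le> (\<Sum>k<N. exp 1 * A * lam powr (- 1 / q) * 2 powr (- real (N - 1 - k) * (d * th)))"
    by (intro sum_mono large) auto
  also have "\<dots> = exp 1 * A * lam powr (- 1 / q) * (\<Sum>k<N. 2 powr (- real (N - 1 - k) * (d * th)))"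
    by (simp add: sum_distrib_left)
  also have "(\<Sum>k<N. 2 powr (- real (N - 1 - k) * (d * th))) = (\<Sum>k<N. 2 powr (- real k * (d * th)))"
    by (subst sum.nat_diff_reindex[symmetric]) simp
  also have "\<dots> \<le> 1 / (1 - 2 powr (- (d * th)))"
    using geometric_powr_sum_le[of "d * th" 0 N] eta th by (simp add: atLeast0LessThan)
  also have "\<dots> \<le> 2 * q"
  proof -
    have "1 / q / 2 \<le> 1 - 2 powr (- (1 / q))"
      by (rule one_minus_two_powr_lower) (use p in auto)
    also have "\<dots> \<le> 1 - 2 powr (- (d * th))" using dth by simp
    finally have *: "1 / q / 2 \<le> 1 - 2 powr (- (d * th))" .
    have q: "0 < 1 / q / 2" using p by simp
    have "1 / (1 - 2 powr (- (d * th))) \<le> 1 / (1 / q / 2)"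
      by (rule divide_left_mono[OF *]) (use less_le_trans[OF q *] q in \<open>auto intro: mult_pos_pos\<close>)
    then show ?thesis by simp
  qed
  finally have L: "(\<Sum>k<N. 2 powr (- real k * d) * y k powr (1 / p)) \<le> exp 1 * A * lam powr (- 1 / q) * (2 * q)"
    using A lam by (simp add: mult_left_mono)
  have "(\<Sum>k\<in>{N..<M}. 2 powr (- real k * d) * y k powr (1 / p)) \<le> B * 2 powr (- real N * d) * g powr (1 / p)"
    by (rule tail)
  also have "\<dots> \<le> B * sig * g powr (1 / p)"
    using N B by (intro mult_right_mono mult_left_mono) auto
  also have "\<dots> = exp 1 * B * (lam powr eta * g powr (1 / p))" by (simp add: sig_def)
  finally have R: "(\<Sum>k\<in>{N..<M}. 2 powr (- real k * d) * y k powr (1 / p)) \<le> exp 1 * B * (A powr (1 - p / q) * g powr (1 / q))"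
    unfolding key2 .
  have "(\<Sum>k<M. 2 powr (- real k * d) * y k powr (1 / p))
      \<le> (\<Sum>k\<in>{..<N} \<union> {N..<M}. 2 powr (- real k * d) * y k powr (1 / p))"
    by (intro sum_mono2) auto
  also have "\<dots> = (\<Sum>k<N. 2 powr (- real k * d) * y k powr (1 / p)) + (\<Sum>k\<in>{N..<M}. 2 powr (- real k * d) * y k powr (1 / p))"
    by (rule sum.union_disjoint) auto
  also have "\<dots> \<le> exp 1 * A * lam powr (- 1 / q) * (2 * q) + exp 1 * B * (A powr (1 - p / q) * g powr (1 / q))"
    using L R by linarith
  also have "\<dots> = exp 1 * (2 * q + B) * (A powr (1 - p / q) * g powr (1 / q))"
    unfolding key1 by (simp add: algebra_simps)
  finally show ?thesis by (simp add: mult_ac)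
qed

text \<open>Jensen for the measure with mass \<open>c k\<close> at \<open>k\<close>. The bound
  \<open>c k \<le> m\<close> lets the unweighted sum of \<open>y\<close> control the weighted one.
  The power of \<open>Z\<close> is only 1 - 1/p, which later saves a power 1/p of 1/d.\<close>

lemma weighted_powr_sum_le:
  fixes c y :: "'b \<Rightarrow> real"
  assumes p: "1 \<le> p" and fin: "finite I"
    and c: "\<And>k. k \<in> I \<Longrightarrow> 0 \<le> c k" "\<And>k. k \<in> I \<Longrightarrow> c k \<le> m" and y: "\<And>k. k \<in> I \<Longrightarrow> 0 \<le> y k"
    and Z: "(\<Sum>k\<in>I. c k) \<le> m * Z" "0 < Z" and Y: "(\<Sum>k\<in>I. y k) \<le> Y" and m: "0 < m"
  shows "(\<Sum>k\<in>I. c k * y k powr (1 / p)) \<le> m * Z powr (1 - 1 / p) * Y powr (1 / p)"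
proof -
  have Y0: "0 \<le> Y" using Y y by (meson order_trans sum_nonneg)
  let ?N = "point_measure I (\<lambda>k. ennreal (c k))"
  have int: "(\<integral>\<^sup>+k\<in>I. ennreal (h k) \<partial>?N) = ennreal (\<Sum>k\<in>I. c k * h k)"
    if "\<And>k. k \<in> I \<Longrightarrow> 0 \<le> h k" for h
  proof -
    have "(\<integral>\<^sup>+k\<in>I. ennreal (h k) \<partial>?N) = (\<Sum>k\<in>I. ennreal (c k * h k))"
      using fin c(1) that by (subst nn_integral_point_measure_finite) (auto simp: ennreal_mult intro!: sum.cong)
    also have "\<dots> = ennreal (\<Sum>k\<in>I. c k * h k)" using c(1) that by (intro sum_ennreal) auto
    finally show ?thesis .
  qed
  have "(\<integral>\<^sup>+k\<in>I. ennreal (y k powr (1 / p)) \<partial>?N) \<le> ennreal ((m * Z) powr (1 - 1 / p) * (m * Y) powr (1 / p))"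
  proof (rule nn_integral_powr_Jensen[OF p])
    have "(\<Sum>k\<in>I. c k * (y k powr (1 / p)) powr p) = (\<Sum>k\<in>I. c k * y k)"
      using p y by (intro sum.cong) (auto simp: powr_powr)
    also have "\<dots> \<le> (\<Sum>k\<in>I. m * y k)" using c y by (intro sum_mono mult_right_mono) auto
    also have "\<dots> \<le> m * Y" using Y m by (simp add: mult_left_mono flip: sum_distrib_left)
    finally show "(\<integral>\<^sup>+k\<in>I. ennreal ((y k powr (1 / p)) powr p) \<partial>?N) \<le> ennreal (m * Y)"
      by (simp add: int ennreal_leI)
    have "emeasure ?N I = (\<integral>\<^sup>+k\<in>I. ennreal 1 \<partial>?N)" by (simp add: sets_point_measure)
    also have "\<dots> = ennreal (\<Sum>k\<in>I. c k)" by (subst int) auto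
    finally show "emeasure ?N I \<le> ennreal (m * Z)" using Z by (simp add: ennreal_leI)
  qed (use m Z Y0 in \<open>auto simp: sets_point_measure\<close>)
  also have "(m * Z) powr (1 - 1 / p) * (m * Y) powr (1 / p) = m * Z powr (1 - 1 / p) * Y powr (1 / p)"
    using m Z Y0 by (simp add: powr_mult powr_diff)
  finally show ?thesis using m Z Y0 by (simp add: int)
qed

section \<open>Cubes and the midpoint inequality\<close>

text \<open>Half-open, so that the dyadic subcubes of one generation are disjoint; the closed cube
  differs by a null set.\<close>

definition hcube :: "real ^ 'n \<Rightarrow> real \<Rightarrow> (real ^ 'n) set" where
  "hcube b s = {x. \<forall>i. b $ i \<le> x $ i \<and> x $ i < b $ i + s}"

lemma measurable_vec_nth [measurable]: "(\<lambda>x :: real ^ 'n. x $ i) \<in> borel_measurable borel"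
  by (intro borel_measurable_continuous_onI continuous_intros)

lemma hcube_borel [measurable]: "hcube b s \<in> sets borel"
  unfolding hcube_def by measurable

lemma prod_Basis_const_diff: "(\<Prod>k\<in>Basis. (((\<chi> i. b $ i + s) :: real ^ 'n) - b) \<bullet> k) = s ^ CARD('n)"
proof -
  have "(\<Prod>k\<in>Basis. (((\<chi> i. b $ i + s) :: real ^ 'n) - b) \<bullet> k) = (\<Prod>k\<in>(Basis :: (real ^ 'n) set). s)"
    by (intro prod.cong) (auto simp: Basis_vec_def inner_axis)
  then show ?thesis by simp
qed

lemma emeasure_cube: "0 \<le> s \<Longrightarrow> emeasure lborel (cube b s :: (real ^ 'n) set) = ennreal (s ^ CARD('n))"
proof -
  assume s: "0 \<le> s"
  have h: "\<forall>k\<in>Basis. b \<bullet> k \<le> ((\<chi> i. b $ i + s) :: real ^ 'n) \<bullet> k"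
    using s by (auto simp: Basis_vec_def inner_axis)
  show ?thesis
    unfolding cube_def emeasure_lborel_cbox_eq if_P[OF h] prod_Basis_const_diff ..
qed

lemma hcube_subset_cube: "hcube b s \<subseteq> cube b s"
  by (auto simp: hcube_def cube_def mem_box_cart less_imp_le)

lemma emeasure_hcube:
  assumes s: "0 < s"
  shows "emeasure lborel (hcube b s :: (real ^ 'n) set) = ennreal (s ^ CARD('n))"
proof (rule antisym)
  show "emeasure lborel (hcube b s) \<le> ennreal (s ^ CARD('n))"
    using emeasure_mono[OF hcube_subset_cube, of b s lborel] emeasure_cube[of s b] s
    by (simp add: cube_def)
  have h: "\<forall>k\<in>Basis. b \<bullet> k \<le> ((\<chi> i. b $ i + s) :: real ^ 'n) \<bullet> k"
    using s by (auto simp: Basis_vec_def inner_axis)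
  have "ennreal (s ^ CARD('n)) = emeasure lborel (box b (\<chi> i. b $ i + s))"
    unfolding emeasure_lborel_box_eq if_P[OF h] prod_Basis_const_diff ..
  also have "\<dots> \<le> emeasure lborel (hcube b s)"
    by (intro emeasure_mono) (auto simp: hcube_def mem_box_cart intro: less_imp_le)
  finally show "ennreal (s ^ CARD('n)) \<le> emeasure lborel (hcube b s)" .
qed

lemma AE_hcube_cube:
  assumes s: "0 < s"
  shows "AE x in lborel. x \<in> hcube b s \<longleftrightarrow> x \<in> cube b s"
proof -
  have "emeasure lborel (cube b s - hcube b s) = emeasure lborel (cube b s) - emeasure lborel (hcube b s)"
    using s by (intro emeasure_Diff hcube_subset_cube) (auto simp: emeasure_hcube cube_def)
  then have "cube b s - hcube b s \<in> null_sets lborel"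
    using s emeasure_cube[of s b] by (auto simp: emeasure_hcube null_sets_def cube_def)
  from AE_not_in[OF this] show ?thesis
    by eventually_elim (use hcube_subset_cube in auto)
qed

lemma norm_le_sqrt_card:
  fixes z :: "real ^ 'n"
  assumes "\<And>i. \<bar>z $ i\<bar> \<le> s"
  shows "norm z \<le> sqrt (real CARD('n)) * s"
proof -
  have s: "0 \<le> s" using assms[of undefined] by linarith
  have "(\<Sum>i\<in>UNIV. (z $ i)\<^sup>2) \<le> (\<Sum>i\<in>(UNIV :: 'n set). s\<^sup>2)"
    by (intro sum_mono) (metis assms abs_ge_zero power2_abs power_mono)
  then have "norm z \<le> sqrt (real CARD('n) * s\<^sup>2)"
    unfolding norm_vec_def L2_set_def by (intro real_sqrt_le_mono) simp
  then show ?thesis using s by (simp add: real_sqrt_mult)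
qed

lemma hcube_diam: "x \<in> hcube b s \<Longrightarrow> y \<in> hcube b s \<Longrightarrow> norm (x - y) \<le> sqrt (real CARD('n)) * s"
  for x y :: "real ^ 'n"
proof (intro norm_le_sqrt_card)
  fix i
  assume "x \<in> hcube b s" "y \<in> hcube b s"
  then have "b $ i \<le> x $ i \<and> x $ i < b $ i + s" "b $ i \<le> y $ i \<and> y $ i < b $ i + s"
    by (auto simp: hcube_def)
  then show "\<bar>(x - y) $ i\<bar> \<le> s" unfolding vector_minus_component by linarith
qed

text \<open>Convexity: \<open>z\<close> is the midpoint of \<open>x\<close> and its
  reflection.\<close>

lemma hcube_midpoint:
  assumes "x \<in> hcube b s" "2 *\<^sub>R z - x \<in> hcube b s"
  shows "z \<in> hcube b s"
  unfolding hcube_def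
proof (intro CollectI allI)
  fix i
  have "b $ i \<le> x $ i \<and> x $ i < b $ i + s" "b $ i \<le> 2 * z $ i - x $ i \<and> 2 * z $ i - x $ i < b $ i + s"
    using assms by (auto simp: hcube_def)
  then show "b $ i \<le> z $ i \<and> z $ i < b $ i + s" by linarith
qed

lemma emeasure_norm_le:
  fixes x :: "real ^ 'n"
  assumes "0 \<le> s"
  shows "emeasure lborel {y. norm (x - y) \<le> s} \<le> ennreal ((2 * s) ^ CARD('n))"
proof -
  have "{y. norm (x - y) \<le> s} \<subseteq> cube (\<chi> i. x $ i - s) (2 * s)"
  proof
    fix y assume "y \<in> {y. norm (x - y) \<le> s}"
    then have "\<bar>x $ i - y $ i\<bar> \<le> s" for i using component_le_norm_cart[of "x - y" i] by simp
    then have "x $ i - y $ i \<le> s \<and> y $ i - x $ i \<le> s" for i by (simp add: abs_le_iff)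
    then show "y \<in> cube (\<chi> i. x $ i - s) (2 * s)"
      by (simp add: cube_def mem_box_cart algebra_simps)
  qed
  from emeasure_mono[OF this, of lborel] emeasure_cube[of "2 * s" "\<chi> i. x $ i - s"] assms
  show ?thesis by (simp add: cube_def)
qed

text \<open>The substitution y = 2z - x has Jacobian 2^n and makes z the midpoint of x and
  y.\<close>

lemma nn_integral_reflect_double:
  fixes g :: "real ^ 'n \<Rightarrow> ennreal"
  assumes [measurable]: "g \<in> borel_measurable borel"
  shows "(\<integral>\<^sup>+y. g y \<partial>lborel) = 2 ^ CARD('n) * (\<integral>\<^sup>+z. g (2 *\<^sub>R z - x) \<partial>lborel)"
proof -
  have eq: "lborel = density (distr lborel borel (\<lambda>z. - x + 2 *\<^sub>R z)) (\<lambda>_. ennreal (\<bar>2\<bar> ^ CARD('n)))"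
    using lborel_affine[of 2 "- x"] by simp
  have "(\<integral>\<^sup>+y. g y \<partial>lborel) = (\<integral>\<^sup>+z. ennreal (\<bar>2\<bar> ^ CARD('n)) * g (- x + 2 *\<^sub>R z) \<partial>lborel)"
    by (subst eq) (simp add: nn_integral_density nn_integral_distr)
  also have "\<dots> = ennreal (\<bar>2\<bar> ^ CARD('n)) * (\<integral>\<^sup>+z. g (2 *\<^sub>R z - x) \<partial>lborel)"
    by (subst nn_integral_cmult[symmetric]) auto
  also have "ennreal (\<bar>2\<bar> ^ CARD('n)) = 2 ^ CARD('n)" by (simp add: ennreal_power[symmetric])
  finally show ?thesis .
qed

section \<open>Fractional energy and the midpoint inequality\<close>

abbreviation frac_kernel :: "real \<Rightarrow> real \<Rightarrow> (real ^ 'n \<Rightarrow> real) \<Rightarrow> real ^ 'n \<Rightarrow> real ^ 'n \<Rightarrow> ennreal" where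
  "frac_kernel d p f x y \<equiv> ennreal (\<bar>f x - f y\<bar> powr p / norm (x - y) powr (real CARD('n) + d * p))"

abbreviation double_integral :: "(real ^ 'n) measure \<Rightarrow> (real ^ 'n) set \<Rightarrow> (real ^ 'n \<Rightarrow> real ^ 'n \<Rightarrow> ennreal) \<Rightarrow> ennreal" where
  "double_integral M P k \<equiv> (\<integral>\<^sup>+x\<in>P. (\<integral>\<^sup>+y\<in>P. k x y \<partial>lborel) \<partial>M)"

text \<open>Pass from f(x) to f(y) through the midpoint. The two halves are equal by symmetry, which
  gives a factor 2, and substituting y = 2z - x halves the distance at the cost of 2^n.\<close>

lemma midpoint_doubling:
  fixes f :: "real ^ 'n \<Rightarrow> real" and P :: "(real ^ 'n) set"
  assumes [measurable]: "f \<in> borel_measurable borel" "P \<in> sets borel"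
    and mid: "\<And>x z. x \<in> P \<Longrightarrow> 2 *\<^sub>R z - x \<in> P \<Longrightarrow> z \<in> P"
  shows "double_integral lborel P (\<lambda>x y. ennreal (\<bar>f x - f y\<bar>) * indicator {h. norm h \<le> s} (x - y))
    \<le> 2 ^ (CARD('n) + 1) *
      double_integral lborel P (\<lambda>x y. ennreal (\<bar>f x - f y\<bar>) * indicator {h. norm h \<le> s / 2} (x - y))"
proof -
  define H where "H t x y = ennreal (\<bar>f x - f y\<bar>) * indicator {h. norm h \<le> t} (x - y) * indicator P y * indicator P x" for t x y
  define U where "U x y = ennreal (\<bar>f x - f ((1/2) *\<^sub>R (x + y))\<bar>) * indicator {h. norm h \<le> s} (x - y) * indicator P y * indicator P x" for x y
  have H_meas [measurable]: "case_prod (H t) \<in> borel_measurable (lborel \<Otimes>\<^sub>M lborel)" for t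
    unfolding H_def split_def by measurable
  have U_meas [measurable]: "case_prod U \<in> borel_measurable (lborel \<Otimes>\<^sub>M lborel)"
    unfolding U_def split_def by measurable
  have U_meas' [measurable]: "(\<lambda>(x, y). U y x) \<in> borel_measurable (lborel \<Otimes>\<^sub>M lborel)"
    unfolding U_def split_def by measurable
  have eqH: "double_integral lborel P (\<lambda>x y. ennreal (\<bar>f x - f y\<bar>) * indicator {h. norm h \<le> t} (x - y))
      = (\<integral>\<^sup>+x. (\<integral>\<^sup>+y. H t x y \<partial>lborel) \<partial>lborel)" for t
    unfolding H_def by (intro nn_integral_cong) (auto split: split_indicator)
  have tri: "H s x y \<le> U x y + U y x" for x y
  proof (cases "x \<in> P \<and> y \<in> P \<and> norm (x - y) \<le> s")
    case True
    have "\<bar>f x - f y\<bar> \<le> \<bar>f x - f ((1/2) *\<^sub>R (x + y))\<bar> + \<bar>f y - f ((1/2) *\<^sub>R (y + x))\<bar>"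
      by (simp add: add.commute)
    then have "ennreal \<bar>f x - f y\<bar> \<le> ennreal \<bar>f x - f ((1/2) *\<^sub>R (x + y))\<bar> + ennreal \<bar>f y - f ((1/2) *\<^sub>R (y + x))\<bar>"
      by (simp flip: ennreal_plus)
    then show ?thesis using True by (simp add: H_def U_def norm_minus_commute)
  qed (auto simp: H_def indicator_def)
  have subst: "(\<integral>\<^sup>+y. U x y \<partial>lborel) \<le> 2 ^ CARD('n) * (\<integral>\<^sup>+z. H (s / 2) x z \<partial>lborel)" for x
  proof -
    have "(\<integral>\<^sup>+y. U x y \<partial>lborel) = 2 ^ CARD('n) * (\<integral>\<^sup>+z. U x (2 *\<^sub>R z - x) \<partial>lborel)"
      by (rule nn_integral_reflect_double) (simp add: U_def)
    also have "\<dots> \<le> 2 ^ CARD('n) * (\<integral>\<^sup>+z. H (s / 2) x z \<partial>lborel)"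
    proof (intro mult_left_mono nn_integral_mono)
      fix z
      have "norm (x - (2 *\<^sub>R z - x)) = 2 * norm (x - z)"
        by (metis (no_types, opaque_lifting) abs_numeral diff_diff_eq2 norm_scaleR scaleR_2 scaleR_right_diff_distrib)
      then show "U x (2 *\<^sub>R z - x) \<le> H (s / 2) x z"
        using mid[of x z] by (auto simp: U_def H_def indicator_def)
    qed auto
    finally show ?thesis .
  qed
  have "(\<integral>\<^sup>+x. (\<integral>\<^sup>+y. H s x y \<partial>lborel) \<partial>lborel) \<le> (\<integral>\<^sup>+x. (\<integral>\<^sup>+y. U x y + U y x \<partial>lborel) \<partial>lborel)"
    by (intro nn_integral_mono tri)
  also have "\<dots> = (\<integral>\<^sup>+x. (\<integral>\<^sup>+y. U x y \<partial>lborel) \<partial>lborel) + (\<integral>\<^sup>+x. (\<integral>\<^sup>+y. U y x \<partial>lborel) \<partial>lborel)"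
  proof -
    have [measurable]: "U x \<in> borel_measurable lborel" "(\<lambda>y. U y x) \<in> borel_measurable lborel" for x
      unfolding U_def by measurable
    have "(\<integral>\<^sup>+x. (\<integral>\<^sup>+y. U x y + U y x \<partial>lborel) \<partial>lborel)
        = (\<integral>\<^sup>+x. (\<integral>\<^sup>+y. U x y \<partial>lborel) + (\<integral>\<^sup>+y. U y x \<partial>lborel) \<partial>lborel)"
      by (intro nn_integral_cong nn_integral_add) measurable
    also have "\<dots> = (\<integral>\<^sup>+x. (\<integral>\<^sup>+y. U x y \<partial>lborel) \<partial>lborel) + (\<integral>\<^sup>+x. (\<integral>\<^sup>+y. U y x \<partial>lborel) \<partial>lborel)"
      by (rule nn_integral_add) measurable
    finally show ?thesis .
  qed
  also have "(\<integral>\<^sup>+x. (\<integral>\<^sup>+y. U y x \<partial>lborel) \<partial>lborel) = (\<integral>\<^sup>+x. (\<integral>\<^sup>+y. U x y \<partial>lborel) \<partial>lborel)"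
    by (rule lborel_pair.Fubini') simp
  also have "(\<integral>\<^sup>+x. (\<integral>\<^sup>+y. U x y \<partial>lborel) \<partial>lborel) + (\<integral>\<^sup>+x. (\<integral>\<^sup>+y. U x y \<partial>lborel) \<partial>lborel)
      = 2 * (\<integral>\<^sup>+x. (\<integral>\<^sup>+y. U x y \<partial>lborel) \<partial>lborel)" by (simp add: mult_2)
  also have "\<dots> \<le> 2 * (\<integral>\<^sup>+x. 2 ^ CARD('n) * (\<integral>\<^sup>+z. H (s / 2) x z \<partial>lborel) \<partial>lborel)"
    by (intro mult_left_mono nn_integral_mono subst) auto
  also have "\<dots> = 2 ^ (CARD('n) + 1) * (\<integral>\<^sup>+x. (\<integral>\<^sup>+z. H (s / 2) x z \<partial>lborel) \<partial>lborel)"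
    by (subst nn_integral_cmult) (auto simp: mult.assoc)
  finally show ?thesis unfolding eqH .
qed

text \<open>The iteration starts at the diameter sqrt(n) s, where the cutoff is vacuous.\<close>

lemma midpoint_iterated:
  fixes f :: "real ^ 'n \<Rightarrow> real"
  assumes [measurable]: "f \<in> borel_measurable borel"
  shows "double_integral lborel (hcube b s) (\<lambda>x y. ennreal \<bar>f x - f y\<bar>)
    \<le> 2 ^ (j * (CARD('n) + 1)) * double_integral lborel (hcube b s) (\<lambda>x y. ennreal \<bar>f x - f y\<bar> *
        indicator {h. norm h \<le> sqrt (real CARD('n)) * s / 2 ^ j} (x - y))"
proof -
  let ?n = "real CARD('n)"
  define Phi where "Phi t = double_integral lborel (hcube b s) (\<lambda>x y. ennreal \<bar>f x - f y\<bar> *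
        indicator {h. norm h \<le> t} (x - y))" for t
  have doubling: "Phi t \<le> 2 ^ (CARD('n) + 1) * Phi (t / 2)" for t
    unfolding Phi_def by (rule midpoint_doubling) (auto elim: hcube_midpoint)
  have "double_integral lborel (hcube b s) (\<lambda>x y. ennreal \<bar>f x - f y\<bar>)
    \<le> 2 ^ (j * (CARD('n) + 1)) * Phi (sqrt ?n * s / 2 ^ j)"
  proof (induction j)
    case 0
    have "double_integral lborel (hcube b s) (\<lambda>x y. ennreal \<bar>f x - f y\<bar>) \<le> Phi (sqrt ?n * s)"
      unfolding Phi_def
    proof (intro nn_integral_mono)
      fix x
      show "(\<integral>\<^sup>+y\<in>hcube b s. ennreal \<bar>f x - f y\<bar> \<partial>lborel) * indicator (hcube b s) x
        \<le> (\<integral>\<^sup>+y\<in>hcube b s. ennreal \<bar>f x - f y\<bar> *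
          indicator {h. norm h \<le> sqrt ?n * s} (x - y) \<partial>lborel) * indicator (hcube b s) x"
      proof (cases "x \<in> hcube b s")
        case True
        then show ?thesis using hcube_diam[OF True]
          by (intro mult_right_mono[OF nn_integral_mono]) (auto simp: indicator_def)
      qed simp
    qed
    then show ?case by simp
  next
    case (Suc j)
    note Suc
    also have "2 ^ (j * (CARD('n) + 1)) * Phi (sqrt ?n * s / 2 ^ j)
      \<le> 2 ^ (j * (CARD('n) + 1)) * (2 ^ (CARD('n) + 1) * Phi (sqrt ?n * s / 2 ^ j / 2))"
      by (intro mult_left_mono doubling) simp
    also have "\<dots> = 2 ^ (Suc j * (CARD('n) + 1)) * Phi (sqrt ?n * s / 2 ^ Suc j)"
      by (simp add: power_add mult_ac)
    finally show ?case .
  qed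
  then show ?thesis by (simp only: Phi_def)
qed

section \<open>Oscillation on a cube\<close>

text \<open>For \<open>M = w dx\<close> this is the \<open>A\<^sub>p\<close> condition, tested on functions instead of the dual weight.\<close>
definition averaging :: "(real ^ 'n) measure \<Rightarrow> (real ^ 'n) set \<Rightarrow> real \<Rightarrow> real \<Rightarrow> bool" where
  "averaging M Q p W \<longleftrightarrow> (\<forall>b s. 0 < s \<longrightarrow> hcube b s \<subseteq> Q \<longrightarrow> 0 < measure M (hcube b s) \<and>
    (\<forall>g S. g \<in> borel_measurable borel \<longrightarrow> (\<forall>x. 0 \<le> g x) \<longrightarrow> 0 \<le> S \<longrightarrow>
      (\<integral>\<^sup>+x\<in>hcube b s. ennreal (g x powr p) \<partial>M) \<le> ennreal S \<longrightarrow>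
      (\<integral>\<^sup>+x\<in>hcube b s. ennreal (g x) \<partial>lborel)
        \<le> ennreal (s ^ CARD('n) * (W * S / measure M (hcube b s)) powr (1 / p))))"

lemma averagingD:
  fixes M :: "(real ^ 'n) measure"
  assumes "averaging M Q p W" "0 < s" "hcube b s \<subseteq> Q"
  shows "0 < measure M (hcube b s)"
    and "\<lbrakk>g \<in> borel_measurable borel; \<And>x. 0 \<le> g x; 0 \<le> S;
      (\<integral>\<^sup>+x\<in>hcube b s. ennreal (g x powr p) \<partial>M) \<le> ennreal S\<rbrakk> \<Longrightarrow>
      (\<integral>\<^sup>+x\<in>hcube b s. ennreal (g x) \<partial>lborel)
        \<le> ennreal (s ^ CARD('n) * (W * S / measure M (hcube b s)) powr (1 / p))"
  using assms unfolding averaging_def by blast+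

locale cube_measure =
  fixes M :: "(real ^ 'n) measure" and Q :: "(real ^ 'n) set" and p W :: real
  assumes sets_M [measurable_cong, simp]: "sets M = sets borel"
    and finite_M: "finite_measure M"
    and avg: "averaging M Q p W"
    and p1: "1 \<le> p" and W0: "0 < W"
begin

text \<open>Hoelder twice: in y over a ball of radius \<open>t\<close>, whose volume enters to the
  power p - 1, and in x through the averaging property, which exchanges Lebesgue measure for
  \<open>M\<close>.\<close>

lemma osc_cutoff:
  fixes f :: "real ^ 'n \<Rightarrow> real"
  assumes [measurable]: "f \<in> borel_measurable borel" and F: "\<And>x. \<bar>f x\<bar> \<le> F"
    and s: "0 < s" "hcube b s \<subseteq> Q" and t: "0 < t"
    and S: "0 \<le> S" "double_integral M (hcube b s) (\<lambda>x y. ennreal (\<bar>f x - f y\<bar> powr p) * indicator {h. norm h \<le> t} (x - y)) \<le> ennreal S"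
  shows "double_integral lborel (hcube b s) (\<lambda>x y. ennreal \<bar>f x - f y\<bar> * indicator {h. norm h \<le> t} (x - y))
    \<le> ennreal (s ^ CARD('n) * (W * (((2 * t) ^ CARD('n)) powr (p - 1) * S) / measure M (hcube b s)) powr (1 / p))"
proof -
  define P where "P = hcube b s"
  have [measurable]: "P \<in> sets borel" by (simp add: P_def)
  define V where "V = (2 * t) ^ CARD('n)"
  have V: "0 < V" using t by (simp add: V_def)
  define h where "h x = (\<integral>\<^sup>+y\<in>P. ennreal \<bar>f x - f y\<bar> * indicator {h. norm h \<le> t} (x - y) \<partial>lborel)" for x
  define k where "k x = (\<integral>\<^sup>+y\<in>P. ennreal (\<bar>f x - f y\<bar> powr p) * indicator {h. norm h \<le> t} (x - y) \<partial>lborel)" for x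
  have [measurable]: "h \<in> borel_measurable borel" "k \<in> borel_measurable borel"
    unfolding h_def k_def by measurable
  \<comment> \<open>The averaging property speaks of real functions; boundedness of \<open>f\<close>
    makes \<open>h\<close> one.\<close>
  have h_fin: "h x < \<infinity>" for x
  proof -
    have "\<bar>f x - f y\<bar> \<le> 2 * F" for y using F[of x] F[of y] by linarith
    then have "h x \<le> (\<integral>\<^sup>+y. ennreal (2 * F) * indicator P y \<partial>lborel)"
      unfolding h_def by (intro nn_integral_mono) (auto simp: indicator_def intro!: ennreal_leI)
    also have "\<dots> = ennreal (2 * F) * ennreal (s ^ CARD('n))"
      using s by (simp add: P_def nn_integral_cmult_indicator emeasure_hcube)
    also have "\<dots> < \<infinity>" by (simp add: ennreal_mult_less_top)
    finally show ?thesis .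
  qed
  have pointwise: "ennreal (enn2real (h x) powr p) \<le> ennreal (V powr (p - 1)) * k x" for x
  proof (cases "k x")
    case (real c)
    let ?E = "P \<inter> {y. norm (x - y) \<le> t}"
    have "h x = (\<integral>\<^sup>+y\<in>?E. ennreal \<bar>f x - f y\<bar> \<partial>lborel)"
      unfolding h_def by (intro nn_integral_cong) (auto simp: indicator_def)
    also have "\<dots> \<le> ennreal (V powr (1 - 1 / p) * c powr (1 / p))"
    proof (rule nn_integral_powr_Jensen[OF p1])
      have "k x = (\<integral>\<^sup>+y\<in>?E. ennreal (\<bar>f x - f y\<bar> powr p) \<partial>lborel)"
        unfolding k_def by (intro nn_integral_cong) (auto simp: indicator_def)
      then show "(\<integral>\<^sup>+y\<in>?E. ennreal (\<bar>f x - f y\<bar> powr p) \<partial>lborel) \<le> ennreal c" using real by simp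
      have "emeasure lborel ?E \<le> emeasure lborel {y. norm (x - y) \<le> t}" by (intro emeasure_mono) auto
      then show "emeasure lborel ?E \<le> ennreal V"
        using emeasure_norm_le[of t x] t by (auto simp: V_def)
    qed (use real V in auto)
    finally have "enn2real (h x) \<le> V powr (1 - 1 / p) * c powr (1 / p)"
      using h_fin[of x] by (intro enn2real_leI) auto
    then have "enn2real (h x) powr p \<le> (V powr (1 - 1 / p) * c powr (1 / p)) powr p"
      using p1 by (intro powr_mono2) auto
    also have "\<dots> = V powr ((1 - 1 / p) * p) * c"
      using V p1 real by (simp add: powr_mult powr_powr)
    also have "(1 - 1 / p) * p = p - 1" using p1 by (simp add: field_simps)
    finally show ?thesis using real V by (simp add: ennreal_mult[symmetric])
  next
    case top
    then show ?thesis using V by (simp add: ennreal_mult_top)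
  qed
  have "(\<integral>\<^sup>+x\<in>P. ennreal (enn2real (h x)) \<partial>lborel)
    \<le> ennreal (s ^ CARD('n) * (W * (V powr (p - 1) * S) / measure M P) powr (1 / p))"
    unfolding P_def
  proof (rule averagingD(2)[OF avg s])
    have "(\<integral>\<^sup>+x\<in>P. ennreal (enn2real (h x) powr p) \<partial>M) \<le> (\<integral>\<^sup>+x. ennreal (V powr (p - 1)) * (k x * indicator P x) \<partial>M)"
      by (intro nn_integral_mono) (use pointwise in \<open>auto simp: indicator_def\<close>)
    also have "\<dots> = ennreal (V powr (p - 1)) * (\<integral>\<^sup>+x\<in>P. k x \<partial>M)"
      by (rule nn_integral_cmult) measurable
    also have "\<dots> \<le> ennreal (V powr (p - 1)) * ennreal S"
      using S(2) by (intro mult_left_mono) (auto simp: k_def P_def)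
    also have "\<dots> = ennreal (V powr (p - 1) * S)" using S by (simp add: ennreal_mult)
    finally show "(\<integral>\<^sup>+x\<in>hcube b s. ennreal (enn2real (h x) powr p) \<partial>M) \<le> ennreal (V powr (p - 1) * S)"
      by (simp add: P_def)
  qed (use S in auto)
  moreover have "ennreal (enn2real (h x)) = h x" for x using h_fin[of x] by simp
  ultimately show ?thesis by (simp add: h_def P_def V_def)
qed

text \<open>Power count at distance 2^(-j): the midpoint iteration loses 2^(j(n+1)p) and the ball
  volume regains 2^(-jn(p-1)), which leaves 2^(j(p+n)).\<close>

lemma osc_scale:
  fixes f :: "real ^ 'n \<Rightarrow> real"
  assumes [measurable]: "f \<in> borel_measurable borel" and F: "\<And>x. \<bar>f x\<bar> \<le> F"
    and s: "0 < s" "hcube b s \<subseteq> Q"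
    and S: "0 \<le> S" "double_integral M (hcube b s) (\<lambda>x y. ennreal (\<bar>f x - f y\<bar> powr p) * indicator {h. norm h \<le> sqrt (real CARD('n)) * s / 2 ^ j} (x - y)) \<le> ennreal S"
    and I: "double_integral lborel (hcube b s) (\<lambda>x y. ennreal \<bar>f x - f y\<bar>) = ennreal i" "0 \<le> i"
  shows "(i / s ^ (2 * CARD('n))) powr p * measure M (hcube b s)
    \<le> W * ((2 * sqrt (real CARD('n))) ^ CARD('n)) powr (p - 1) * (2 ^ j) powr (p + real CARD('n)) / s ^ CARD('n) * S"
proof -
  define n where "n = CARD('n)"
  define c where "c = (2 * sqrt (real n)) ^ n"
  have c: "0 < c" by (simp add: c_def n_def)
  define m where "m = measure M (hcube b s)"
  have m: "0 < m" using averagingD(1)[OF avg s] by (simp add: m_def)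
  define t where "t = sqrt (real n) * s / 2 ^ j"
  have t: "0 < t" using s by (simp add: t_def n_def)
  have Vt: "(2 * t) ^ n = c * s ^ n / (2 ^ j) ^ n" by (simp add: t_def c_def power_mult_distrib power_divide)
  define Z where "Z = (W * (((2 * t) ^ n) powr (p - 1) * S) / m) powr (1 / p)"
  have Z: "0 \<le> Z" by (simp add: Z_def)
  have "ennreal i \<le> 2 ^ (j * (n + 1)) * ennreal (s ^ n * Z)"
  proof -
    have "double_integral lborel (hcube b s) (\<lambda>x y. ennreal \<bar>f x - f y\<bar> * indicator {h. norm h \<le> t} (x - y))
        \<le> ennreal (s ^ n * Z)"
      unfolding Z_def m_def n_def
      by (rule osc_cutoff[OF assms(1) F s t S(1)]) (use S(2) in \<open>simp add: t_def n_def\<close>)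
    then have "2 ^ (j * (n + 1)) * double_integral lborel (hcube b s) (\<lambda>x y. ennreal \<bar>f x - f y\<bar> * indicator {h. norm h \<le> t} (x - y))
        \<le> 2 ^ (j * (n + 1)) * ennreal (s ^ n * Z)" by (rule mult_left_mono) simp
    with midpoint_iterated[OF assms(1), of b s j] show ?thesis
      unfolding I n_def t_def by (rule order_trans)
  qed
  also have "\<dots> = ennreal (2 ^ (j * (n + 1)) * (s ^ n * Z))"
    using s Z by (simp add: ennreal_mult ennreal_power[symmetric])
  finally have "i \<le> 2 ^ (j * (n + 1)) * (s ^ n * Z)" using s Z by (subst (asm) ennreal_le_iff) auto
  then have "i powr p \<le> (2 ^ (j * (n + 1)) * (s ^ n * Z)) powr p"
    using I p1 by (intro powr_mono2) auto
  also have "\<dots> = (2 ^ (j * (n + 1))) powr p * (s ^ n) powr p * (W * (((2 * t) ^ n) powr (p - 1) * S) / m)"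
    using s Z p1 m W0 S by (simp add: powr_mult Z_def powr_powr)
  also have "((2 * t) ^ n) powr (p - 1) = c powr (p - 1) * (s ^ n) powr p / s ^ n * (2 ^ j) ^ n / (2 ^ (j * n)) powr p"
    unfolding Vt using s c by (simp add: powr_mult powr_divide powr_diff power_mult field_simps)
  also have "(2 ^ (j * (n + 1))) powr p = (2 ^ j) powr p * (2 ^ (j * n)) powr (p :: real)"
    by (simp add: powr_mult power_add)
  finally have "i powr p \<le> ((2 ^ j) powr p * (2 ^ j) ^ n * ((s ^ n) powr p * (s ^ n) powr p) * (W * c powr (p - 1) / s ^ n * S)) / m"
    by (simp add: field_simps)
  then have main: "i powr p * m \<le> (2 ^ j) powr p * (2 ^ j) ^ n * ((s ^ n) powr p * (s ^ n) powr p) * (W * c powr (p - 1) / s ^ n * S)"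
    using m by (simp only: pos_le_divide_eq)
  have "(i / s ^ (2 * n)) powr p = i powr p / ((s ^ n) powr p * (s ^ n) powr p)"
    using I s by (simp add: powr_divide power_mult power2_eq_square mult_2 power_add powr_mult)
  then have "(i / s ^ (2 * n)) powr p * m = (i powr p * m) / ((s ^ n) powr p * (s ^ n) powr p)" by simp
  also have "\<dots> \<le> (2 ^ j) powr p * (2 ^ j) ^ n * (W * c powr (p - 1) / s ^ n * S)"
    using main s by (subst pos_divide_le_eq) (auto simp: mult_ac)
  also have "(2 ^ j) powr p * (2 ^ j) ^ n = ((2 :: real) ^ j) powr (p + real n)"
    by (simp add: powr_add powr_realpow)
  finally show ?thesis by (simp add: n_def m_def c_def mult_ac)
qed

text \<open>The case \<open>j = 0\<close>, with the cutoff dropped.\<close>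

lemma osc_small_order:
  fixes f :: "real ^ 'n \<Rightarrow> real"
  assumes [measurable]: "f \<in> borel_measurable borel" and F: "\<And>x. \<bar>f x\<bar> \<le> F"
    and s: "0 < s" "hcube b s \<subseteq> Q"
    and S: "0 \<le> S" "double_integral M (hcube b s) (\<lambda>x y. ennreal (\<bar>f x - f y\<bar> powr p)) \<le> ennreal S"
    and I: "double_integral lborel (hcube b s) (\<lambda>x y. ennreal \<bar>f x - f y\<bar>) = ennreal i" "0 \<le> i"
  shows "(i / s ^ (2 * CARD('n))) powr p * measure M (hcube b s)
    \<le> W * ((2 * sqrt (real CARD('n))) ^ CARD('n)) powr (p - 1) / s ^ CARD('n) * S"
proof -
  have "double_integral M (hcube b s) (\<lambda>x y. ennreal (\<bar>f x - f y\<bar> powr p) * indicator {h. norm h \<le> sqrt (real CARD('n)) * s / 2 ^ 0} (x - y))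
      \<le> double_integral M (hcube b s) (\<lambda>x y. ennreal (\<bar>f x - f y\<bar> powr p))"
    by (intro nn_integral_mono mult_right_mono) (auto simp: indicator_def)
  then show ?thesis using osc_scale[OF assms(1) F s S(1), where j = 0] S(2) I by (auto simp: mult_ac)
qed

text \<open>The kernel weighs distance 2^(-j) with 2^(j(n+dp)), while \<open>osc_scale\<close> asks
  for 2^(j(n+p)). After multiplication by 2^(-jp(1-d)) the estimates of all scales are added: the
  right-hand sides stay below a multiple of one kernel, and the left-hand side is counted about
  1/(p(1-d)) times.\<close>

lemma osc_large_order:
  fixes f :: "real ^ 'n \<Rightarrow> real"
  assumes [measurable]: "f \<in> borel_measurable borel" and F: "\<And>x. \<bar>f x\<bar> \<le> F"
    and s: "0 < s" "hcube b s \<subseteq> Q" and d: "0 < d" "d < 1"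
    and S: "0 \<le> S" "double_integral M (hcube b s) (frac_kernel d p f) \<le> ennreal S"
    and I: "double_integral lborel (hcube b s) (\<lambda>x y. ennreal \<bar>f x - f y\<bar>) = ennreal i" "0 \<le> i"
  shows "(i / s ^ (2 * CARD('n))) powr p * measure M (hcube b s)
    \<le> W * ((2 * sqrt (real CARD('n))) ^ CARD('n)) powr (p - 1) / s ^ CARD('n) *
      (4 * p * (1 - d) * (sqrt (real CARD('n)) * s) powr (real CARD('n) + d * p) * S)"
proof -
  define n where "n = real CARD('n)"
  have n: "1 \<le> n" by (simp add: n_def Suc_le_eq)
  define P where "P = hcube b s"
  have [measurable]: "P \<in> sets borel" by (simp add: P_def)
  define be where "be = n + d * p"
  have be: "1 \<le> be" using n d p1 by (simp add: be_def add_increasing2)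
  define dm where "dm = sqrt n * s"
  have dm: "0 < dm" using s n by (simp add: dm_def)
  define K where "K x y = ennreal (\<bar>f x - f y\<bar> powr p / norm (x - y) powr be) * indicator P y * indicator P x" for x y
  define T where "T j = double_integral M P (\<lambda>x y. ennreal (\<bar>f x - f y\<bar> powr p) * indicator {h. norm h \<le> dm / 2 ^ j} (x - y))" for j :: nat
  define H where "H j x y = ennreal (\<bar>f x - f y\<bar> powr p) * indicator {h. norm h \<le> dm / 2 ^ j} (x - y) * indicator P y * indicator P x" for j :: nat and x y
  have [measurable]: "case_prod (H j) \<in> borel_measurable (borel \<Otimes>\<^sub>M lborel)" for j
    unfolding H_def split_def by measurable
  have [measurable]: "case_prod K \<in> borel_measurable (borel \<Otimes>\<^sub>M lborel)"
    unfolding K_def split_def by measurable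
  have T_H: "T j = (\<integral>\<^sup>+x. (\<integral>\<^sup>+y. H j x y \<partial>lborel) \<partial>M)" for j
    unfolding T_def H_def by (intro nn_integral_cong) (auto split: split_indicator)
  have S_K: "(\<integral>\<^sup>+x. (\<integral>\<^sup>+y. K x y \<partial>lborel) \<partial>M) \<le> ennreal S"
  proof -
    have "(\<integral>\<^sup>+x. (\<integral>\<^sup>+y. K x y \<partial>lborel) \<partial>M) = double_integral M P (\<lambda>x y. ennreal (\<bar>f x - f y\<bar> powr p / norm (x - y) powr be))"
      unfolding K_def by (intro nn_integral_cong) (auto split: split_indicator)
    then show ?thesis using S(2) by (simp add: P_def be_def n_def)
  qed
  \<comment> \<open>\<open>H j\<close> lives where 2^j \<le> dm / |x - y|, so
    \<open>dyadic_kernel_sum\<close> applies pointwise.\<close>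
  have sum_H: "(\<Sum>j<J. ennreal ((2 ^ j) powr be) * H j x y) \<le> ennreal (2 * dm powr be) * K x y" for J x y
  proof (cases "x \<in> P \<and> y \<in> P \<and> x \<noteq> y")
    case True
    then have pos: "0 < norm (x - y)" by simp
    have le: "norm (x - y) \<le> dm / 2 ^ j \<longleftrightarrow> 2 ^ j \<le> dm / norm (x - y)" for j
      using pos by (simp add: field_simps)
    define c where "c j = (if 2 ^ j \<le> dm / norm (x - y) then (2 ^ j) powr be else 0)" for j :: nat
    have c0: "0 \<le> c j" for j by (simp add: c_def)
    have "ennreal ((2 ^ j) powr be) * H j x y = ennreal (c j) * ennreal (\<bar>f x - f y\<bar> powr p)" for j
      using True by (simp add: H_def c_def le)
    then have "(\<Sum>j<J. ennreal ((2 ^ j) powr be) * H j x y)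
        = (\<Sum>j<J. ennreal (c j)) * ennreal (\<bar>f x - f y\<bar> powr p)"
      by (simp add: sum_distrib_right)
    also have "(\<Sum>j<J. ennreal (c j)) = ennreal (\<Sum>j<J. c j)" by (rule sum_ennreal) (rule c0)
    also have "\<dots> * ennreal (\<bar>f x - f y\<bar> powr p) = ennreal ((\<Sum>j<J. c j) * \<bar>f x - f y\<bar> powr p)"
      by (rule ennreal_mult[symmetric]) (auto intro: sum_nonneg c0)
    also have "\<dots> \<le> ennreal (2 * (dm / norm (x - y)) powr be * \<bar>f x - f y\<bar> powr p)"
      unfolding c_def using pos dm be by (intro ennreal_leI mult_right_mono dyadic_kernel_sum) auto
    also have "2 * (dm / norm (x - y)) powr be * \<bar>f x - f y\<bar> powr p
        = 2 * dm powr be * (\<bar>f x - f y\<bar> powr p / norm (x - y) powr be)"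
      using pos dm by (simp add: powr_divide)
    also have "ennreal \<dots> = ennreal (2 * dm powr be) * K x y"
      using True unfolding K_def by (subst ennreal_mult) auto
    finally show ?thesis .
  qed (auto simp: H_def indicator_def)
  have sum_T: "(\<Sum>j<J. ennreal ((2 ^ j) powr be) * T j) \<le> ennreal (2 * dm powr be * S)" for J
  proof -
    have "(\<Sum>j<J. ennreal ((2 ^ j) powr be) * T j) = (\<integral>\<^sup>+x. (\<integral>\<^sup>+y. (\<Sum>j<J. ennreal ((2 ^ j) powr be) * H j x y) \<partial>lborel) \<partial>M)"
      by (simp add: T_H nn_integral_sum nn_integral_cmult)
    also have "\<dots> \<le> (\<integral>\<^sup>+x. (\<integral>\<^sup>+y. ennreal (2 * dm powr be) * K x y \<partial>lborel) \<partial>M)"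
      by (intro nn_integral_mono sum_H)
    also have "\<dots> = ennreal (2 * dm powr be) * (\<integral>\<^sup>+x. (\<integral>\<^sup>+y. K x y \<partial>lborel) \<partial>M)"
      by (simp add: nn_integral_cmult)
    also have "\<dots> \<le> ennreal (2 * dm powr be) * ennreal S" using S_K by (intro mult_left_mono) auto
    finally show ?thesis using S by (simp add: ennreal_mult)
  qed
  have T_fin: "T j < \<infinity>" for j
  proof -
    have "ennreal ((2 ^ j) powr be) * T j \<le> ennreal (2 * dm powr be * S)"
      by (rule order_trans[OF _ sum_T[of "Suc j"]]) (simp add: add_increasing)
    then have "ennreal ((2 ^ j) powr be) * T j < \<infinity>" by (rule le_less_trans) simp
    then show ?thesis by (auto simp: ennreal_mult_less_top less_top)
  qed
  define m where "m = measure M P"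
  define C where "C = W * ((2 * sqrt n) ^ CARD('n)) powr (p - 1) / s ^ CARD('n)"
  have C: "0 \<le> C" using W0 s by (simp add: C_def)
  define X where "X = (i / s ^ (2 * CARD('n))) powr p * m"
  have X0: "0 \<le> X" by (simp add: X_def m_def)
  define ga where "ga = p * (1 - d)"
  have ga: "0 < ga" using p1 d by (simp add: ga_def)
  have step: "X * 2 powr (- real j * ga) \<le> C * ((2 ^ j) powr be * enn2real (T j))" for j
  proof -
    have "X \<le> C * (2 ^ j) powr (p + n) * enn2real (T j)"
      unfolding X_def C_def n_def m_def P_def
      using osc_scale[OF assms(1) F s _ _ I, of "enn2real (T j)" j] T_fin[of j]
      by (simp add: T_def P_def dm_def n_def mult_ac)
    then have "X * 2 powr (- real j * ga) \<le> C * (2 ^ j) powr (p + n) * enn2real (T j) * 2 powr (- real j * ga)"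
      by (intro mult_right_mono) auto
    also have "\<dots> = C * ((2 ^ j) powr (p + n) * 2 powr (- real j * ga)) * enn2real (T j)" by simp
    also have "(2 ^ j) powr (p + n) * 2 powr (- real j * ga) = (2 ^ j) powr be"
      by (simp add: powr_powr ga_def be_def algebra_simps flip: powr_realpow powr_add)
    finally show ?thesis by (simp add: mult_ac)
  qed
  have bound: "X * (\<Sum>j<J. 2 powr (- real j * ga)) \<le> C * (2 * dm powr be * S)" for J
  proof -
    have "X * (\<Sum>j<J. 2 powr (- real j * ga)) \<le> C * (\<Sum>j<J. (2 ^ j) powr be * enn2real (T j))"
      unfolding sum_distrib_left by (intro sum_mono step)
    also have "ennreal (\<Sum>j<J. (2 ^ j) powr be * enn2real (T j)) = (\<Sum>j<J. ennreal ((2 ^ j) powr be) * T j)"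
      using T_fin by (subst sum_ennreal[symmetric]) (auto simp: ennreal_mult intro!: sum.cong)
    with sum_T[of J] have "ennreal (\<Sum>j<J. (2 ^ j) powr be * enn2real (T j)) \<le> ennreal (2 * dm powr be * S)"
      by simp
    then have "(\<Sum>j<J. (2 ^ j) powr be * enn2real (T j)) \<le> 2 * dm powr be * S"
      using S(1) by (subst (asm) ennreal_le_iff) auto
    then have "C * (\<Sum>j<J. (2 ^ j) powr be * enn2real (T j)) \<le> C * (2 * dm powr be * S)"
      using C by (rule mult_left_mono)
    finally show ?thesis .
  qed
  \<comment> \<open>Finitely many scales suffice: once \<open>rho ^ J < 1 / 2\<close>, the geometric
    sum is at least half its limit, hence at least \<open>1 / (2 * ga)\<close>.\<close>
  define rho where "rho = (2::real) powr (- ga)"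
  have rho: "0 < rho" "rho < 1" using ga by (auto simp: rho_def powr_less_one)
  have "(\<lambda>J. rho ^ J) \<longlonglongrightarrow> 0" using rho by (intro LIMSEQ_power_zero) auto
  then have "\<forall>\<^sub>F J in sequentially. rho ^ J < 1 / 2" by (rule order_tendstoD) simp
  then obtain J where J: "rho ^ J < 1 / 2" by (auto simp: eventually_sequentially)
  have "1 / (2 * ga) \<le> 1 / (2 * (1 - rho))"
    using one_minus_two_powr_upper[of ga] rho ga by (intro divide_left_mono) (auto simp: rho_def)
  also have "\<dots> = (1 / 2) / (1 - rho)" by simp
  also have "\<dots> \<le> (1 - rho ^ J) / (1 - rho)" using J rho by (intro divide_right_mono) auto
  also have "\<dots> = (\<Sum>j<J. rho ^ j)" using rho by (simp add: sum_gp_strict)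
  also have "\<dots> = (\<Sum>j<J. 2 powr (- real j * ga))"
    by (simp add: rho_def powr_powr mult.commute flip: powr_realpow)
  finally have "X * (1 / (2 * ga)) \<le> C * (2 * dm powr be * S)"
    using bound[of J] X0 by (meson mult_left_mono order_trans)
  then have "X \<le> C * (4 * ga * dm powr be * S)" using ga by (simp add: field_simps)
  then show ?thesis by (simp add: X_def C_def m_def P_def ga_def dm_def be_def n_def mult_ac)
qed

end

section \<open>Dyadic cells and the pointwise estimate\<close>

text \<open>All that the argument retains of the weight: averaging at exponent \<open>p\<close>, and
  \<open>decay\<close>, which condenses the A_r condition and the definition of q.
  \<open>dp_le\<close> keeps n + dp below 2n, so that powers of sqrt(n) are bounded in terms of n
  alone.\<close>

locale dyadic_cube = cube_measure M "hcube a l" p W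
  for M :: "(real ^ 'n) measure" and a l p W +
  fixes q d :: real
  assumes l0: "0 < l" and pq: "p < q" and d0: "0 < d" and d1: "d < 1"
    and eta_le: "1 / p - 1 / q \<le> d"
    and dp_le: "d * p \<le> real CARD('n)"
    and decay: "0 < s \<Longrightarrow> hcube b s \<subseteq> hcube a l \<Longrightarrow>
      (s / l) powr d \<le> exp 1 * (measure M (hcube b s) / measure M (hcube a l)) powr (1 / p - 1 / q)"
begin

abbreviation "Q \<equiv> hcube a l"
abbreviation "mQ \<equiv> measure M Q"

definition side :: "nat \<Rightarrow> real" where "side k = l / 2 ^ k"

text \<open>Cells are handled through integer labels: lying in a common cell is equality of labels,
  and the labels are countable, which gives countable partitions as well as measurability.\<close>

definition idx :: "nat \<Rightarrow> real ^ 'n \<Rightarrow> int ^ 'n" where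
  "idx k x = (\<chi> i. \<lfloor>(x $ i - a $ i) / side k\<rfloor>)"

definition cell :: "nat \<Rightarrow> real ^ 'n \<Rightarrow> (real ^ 'n) set" where
  "cell k x = hcube (\<chi> i. a $ i + of_int (idx k x $ i) * side k) (side k)"

lemma side_pos [simp]: "0 < side k" using l0 by (simp add: side_def)

lemma side_Suc: "side k = 2 * side (Suc k)" by (simp add: side_def)

lemma side_powr: "side k powr d = l powr d * 2 powr (- real k * d)"
  using l0 by (simp add: side_def powr_divide powr_powr powr_minus divide_simps flip: powr_realpow)

lemma mQ_pos: "0 < mQ" by (rule averagingD(1)[OF avg l0]) simp

lemma emeasure_M: "emeasure M A = ennreal (measure M A)"
  by (rule finite_measure.emeasure_eq_measure[OF finite_M])

lemma cell_borel [measurable]: "cell k x \<in> sets borel" by (simp add: cell_def)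

lemma mem_cell_iff: "y \<in> cell k x \<longleftrightarrow> idx k y = idx k x"
proof -
  have "a $ i + of_int j * side k \<le> y $ i \<and> y $ i < a $ i + of_int j * side k + side k
      \<longleftrightarrow> \<lfloor>(y $ i - a $ i) / side k\<rfloor> = j" for i j
    using side_pos[of k] by (subst floor_eq_iff) (auto simp: field_simps)
  then show ?thesis by (simp add: cell_def hcube_def idx_def vec_eq_iff)
qed

lemma mem_cell_self [simp]: "x \<in> cell k x" by (simp add: mem_cell_iff)

lemma cell_eq: "y \<in> cell k x \<Longrightarrow> cell k y = cell k x"
  by (simp only: mem_cell_iff) (simp add: cell_def)

text \<open>Doubling the side is integer division of the label by 2, so a label determines its
  predecessor.\<close>

lemma idx_antimono_Suc: "idx (Suc k) y = idx (Suc k) x \<Longrightarrow> idx k y = idx k x"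
proof -
  assume eq: "idx (Suc k) y = idx (Suc k) x"
  have "\<lfloor>(z $ i - a $ i) / side k\<rfloor> = \<lfloor>(z $ i - a $ i) / side (Suc k)\<rfloor> div 2" for z i
  proof -
    have eq: "(z $ i - a $ i) / side k = ((z $ i - a $ i) / side (Suc k)) / of_int 2"
      by (simp add: side_Suc[of k])
    show ?thesis unfolding eq by (rule floor_divide_real_eq_div) simp
  qed
  then show ?thesis using eq by (simp add: idx_def vec_eq_iff)
qed

lemma idx_antimono: "j \<le> k \<Longrightarrow> idx k y = idx k x \<Longrightarrow> idx j y = idx j x"
  by (induction k rule: dec_induct) (auto dest: idx_antimono_Suc)

lemma cell_antimono: "j \<le> k \<Longrightarrow> cell k x \<subseteq> cell j x"
  by (auto simp: mem_cell_iff intro: idx_antimono)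

lemma cell_0: "x \<in> Q \<Longrightarrow> cell 0 x = Q"
proof -
  assume x: "x \<in> Q"
  have "idx 0 x = 0"
    using x l0 by (auto simp: idx_def vec_eq_iff side_def hcube_def floor_eq_iff divide_simps algebra_simps)
  then show ?thesis by (simp add: cell_def side_def)
qed

lemma cell_subset: "x \<in> Q \<Longrightarrow> cell k x \<subseteq> Q"
  using cell_antimono[of 0 k x] cell_0 by simp

lemma emeasure_cell: "emeasure lborel (cell k x) = ennreal (side k ^ CARD('n))"
  unfolding cell_def by (rule emeasure_hcube) simp

lemma measure_cell_pos: "x \<in> Q \<Longrightarrow> 0 < measure M (cell k x)"
  using averagingD(1)[OF avg side_pos] cell_subset[of x k] by (simp add: cell_def)

lemma idx_measurable [measurable]: "idx k \<in> borel \<rightarrow>\<^sub>M count_space UNIV"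
proof (rule measurable_count_space_eq2_countable[THEN iffD2])
  have "idx k -` {v} \<in> sets borel" for v
  proof -
    have "idx k -` {v} = {x. \<forall>i. \<lfloor>(x $ i - a $ i) / side k\<rfloor> = v $ i}"
      by (auto simp: idx_def vec_eq_iff)
    also have "\<dots> \<in> sets borel" by measurable
    finally show ?thesis .
  qed
  then show "idx k \<in> space borel \<rightarrow> UNIV \<and> (\<forall>v\<in>UNIV. idx k -` {v} \<inter> space borel \<in> sets borel)" by simp
qed

text \<open>\<open>E\<close> is a union of cells of generation \<open>k\<close>, countably many
  because labels are; the comparison is made on each cell and summed. It serves both for cell
  averages and for stopping sets.\<close>

lemma cell_integral_le:
  assumes E [measurable]: "E \<in> sets borel" and sat: "\<And>x. x \<in> E \<Longrightarrow> cell k x \<subseteq> E"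
    and [measurable]: "phi \<in> borel_measurable borel" "kap \<in> borel_measurable borel"
    and const: "\<And>x y. y \<in> cell k x \<Longrightarrow> phi y = phi x"
    and le: "\<And>x. x \<in> E \<Longrightarrow> phi x * emeasure M (cell k x) \<le> (\<integral>\<^sup>+y\<in>cell k x. kap y \<partial>M)"
  shows "(\<integral>\<^sup>+x\<in>E. phi x \<partial>M) \<le> (\<integral>\<^sup>+x\<in>E. kap x \<partial>M)"
proof -
  define Bn where "Bn m = {x \<in> E. to_nat (idx k x) = m}" for m
  have meas [measurable]: "Bn m \<in> sets borel" for m unfolding Bn_def by measurable
  have disj: "disjoint_family Bn" by (auto simp: disjoint_family_on_def Bn_def)
  have un: "(\<Union>m. Bn m) = E" by (auto simp: Bn_def)
  have "(\<integral>\<^sup>+x\<in>E. g x \<partial>M) = (\<Sum>m. \<integral>\<^sup>+x\<in>Bn m. g x \<partial>M)" if "g \<in> borel_measurable borel" for g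
    using nn_integral_disjoint_family[of g M Bn] that disj un by simp
  moreover have "(\<integral>\<^sup>+x\<in>Bn m. phi x \<partial>M) \<le> (\<integral>\<^sup>+x\<in>Bn m. kap x \<partial>M)" for m
  proof (cases "Bn m = {}")
    case False
    then obtain x where x: "x \<in> E" "to_nat (idx k x) = m" by (auto simp: Bn_def)
    then have Bn: "Bn m = cell k x"
      using sat[OF x(1)] by (auto simp: Bn_def mem_cell_iff)
    have "(\<integral>\<^sup>+y\<in>cell k x. phi y \<partial>M) = (\<integral>\<^sup>+y. phi x * indicator (cell k x) y \<partial>M)"
      by (intro nn_integral_cong) (auto simp: const split: split_indicator)
    also have "\<dots> = phi x * emeasure M (cell k x)" by (simp add: nn_integral_cmult_indicator)
    finally show ?thesis using le[OF x(1)] by (simp add: Bn)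
  qed simp
  ultimately show ?thesis by (simp add: suminf_le)
qed

end

text \<open>The functions inserted here are truncations, hence bounded; this makes all means and
  oscillations finite.\<close>

locale dyadic_function = dyadic_cube M a l p W q d
  for M :: "(real ^ 'n) measure" and a l p W q d +
  fixes f :: "real ^ 'n \<Rightarrow> real" and F :: real
  assumes f_borel [measurable]: "f \<in> borel_measurable borel" and f_bounded: "\<And>x. \<bar>f x\<bar> \<le> F"
begin

definition kern :: "real ^ 'n \<Rightarrow> real ^ 'n \<Rightarrow> ennreal" where
  "kern x y = frac_kernel d p f x y"

definition dens :: "real ^ 'n \<Rightarrow> ennreal" where "dens x = (\<integral>\<^sup>+y\<in>Q. kern x y \<partial>lborel)"

definition osc :: "nat \<Rightarrow> real ^ 'n \<Rightarrow> real" where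
  "osc k x = enn2real (double_integral lborel (cell k x) (\<lambda>y z. ennreal \<bar>f y - f z\<bar>))"

definition mean :: "nat \<Rightarrow> real ^ 'n \<Rightarrow> real" where
  "mean k x = (\<integral>y. f y * indicator (cell k x) y \<partial>lborel) / side k ^ CARD('n)"

lemma kern_measurable [measurable]: "case_prod kern \<in> borel_measurable (borel \<Otimes>\<^sub>M borel)"
  unfolding kern_def split_def by measurable

lemma dens_measurable [measurable]: "dens \<in> borel_measurable borel"
  unfolding dens_def by measurable

lemma F_nonneg: "0 \<le> F" using f_bounded[of 0] by linarith

lemma f_diff_le: "\<bar>f x - f y\<bar> \<le> 2 * F" using f_bounded[of x] f_bounded[of y] by linarith

lemma osc_eq:
  "double_integral lborel (cell k x) (\<lambda>y z. ennreal \<bar>f y - f z\<bar>) = ennreal (osc k x)"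
  "0 \<le> osc k x"
proof -
  have "double_integral lborel (cell k x) (\<lambda>y z. ennreal \<bar>f y - f z\<bar>)
      \<le> double_integral lborel (cell k x) (\<lambda>y z. ennreal (2 * F))"
    by (intro nn_integral_mono mult_right_mono ennreal_leI f_diff_le) auto
  also have "\<dots> < \<infinity>"
    by (simp add: nn_integral_cmult_indicator emeasure_cell ennreal_mult_less_top)
  finally show "double_integral lborel (cell k x) (\<lambda>y z. ennreal \<bar>f y - f z\<bar>) = ennreal (osc k x)"
    unfolding osc_def by simp
qed (simp add: osc_def)

lemma integrable_on_cell: "integrable lborel (\<lambda>y. f y * indicator (cell k x) y)"
proof (rule Bochner_Integration.integrable_bound)
  show "integrable lborel (\<lambda>y. F * indicator (cell k x) y)"
    by (intro integrable_mult_right integrable_real_indicator) (auto simp: emeasure_cell)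
  show "AE y in lborel. norm (f y * indicator (cell k x) y) \<le> norm (F * indicator (cell k x) y)"
    using f_bounded F_nonneg by (auto simp: indicator_def)
qed measurable

lemma mean_deviation:
  "ennreal (side k ^ CARD('n) * \<bar>mean k x - c\<bar>) \<le> (\<integral>\<^sup>+y\<in>cell k x. ennreal \<bar>f y - c\<bar> \<partial>lborel)"
proof -
  have ind: "integrable lborel (\<lambda>y. c * indicator (cell k x) y)"
    by (intro integrable_mult_right integrable_real_indicator) (auto simp: emeasure_cell)
  have meas: "measure lborel (cell k x) = side k ^ CARD('n)"
    unfolding measure_def emeasure_cell by (simp add: less_imp_le)
  have "(\<integral>y. f y * indicator (cell k x) y - c * indicator (cell k x) y \<partial>lborel)
      = side k ^ CARD('n) * (mean k x - c)"
    using integrable_on_cell[of k x] ind less_imp_neq[OF side_pos[of k]]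
    by (simp add: mean_def meas algebra_simps)
  then have "ennreal (side k ^ CARD('n) * \<bar>mean k x - c\<bar>)
      = ennreal (norm (\<integral>y. f y * indicator (cell k x) y - c * indicator (cell k x) y \<partial>lborel))"
    by (simp add: abs_mult less_imp_le)
  also have "\<dots> \<le> (\<integral>\<^sup>+y. norm (f y * indicator (cell k x) y - c * indicator (cell k x) y) \<partial>lborel)"
    by (intro integral_norm_bound_ennreal Bochner_Integration.integrable_diff integrable_on_cell ind)
  also have "\<dots> = (\<integral>\<^sup>+y\<in>cell k x. ennreal \<bar>f y - c\<bar> \<partial>lborel)"
    by (intro nn_integral_cong) (auto simp: indicator_def)
  finally show ?thesis .
qed

text \<open>\<open>osc k x / side k ^ (2 * CARD('n))\<close> is the mean of |f(y) - f(z)| over pairs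
  in the parent cell. Averaging over the child instead costs the volume ratio 2^n.\<close>

lemma mean_step: "\<bar>mean (Suc k) x - mean k x\<bar> \<le> 2 ^ CARD('n) * (osc k x / side k ^ (2 * CARD('n)))"
proof -
  define s where "s = side k ^ CARD('n)"
  define s' where "s' = side (Suc k) ^ CARD('n)"
  have s: "0 < s" "0 < s'" "s = 2 ^ CARD('n) * s'"
    by (auto simp: s_def s'_def side_Suc[of k] power_mult_distrib)
  have "ennreal (s * (s' * \<bar>mean (Suc k) x - mean k x\<bar>)) = ennreal s * ennreal (s' * \<bar>mean (Suc k) x - mean k x\<bar>)"
    using s by (simp add: ennreal_mult)
  also have "\<dots> \<le> ennreal s * (\<integral>\<^sup>+y\<in>cell (Suc k) x. ennreal \<bar>f y - mean k x\<bar> \<partial>lborel)"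
    unfolding s'_def by (intro mult_left_mono mean_deviation) auto
  also have "\<dots> \<le> ennreal s * (\<integral>\<^sup>+y\<in>cell k x. ennreal \<bar>f y - mean k x\<bar> \<partial>lborel)"
    using cell_antimono[of k "Suc k" x]
    by (intro mult_left_mono nn_integral_mono) (auto simp: indicator_def)
  also have "\<dots> = (\<integral>\<^sup>+y\<in>cell k x. ennreal (s * \<bar>mean k x - f y\<bar>) \<partial>lborel)"
    using s by (subst nn_integral_cmult[symmetric]) (auto simp: ennreal_mult abs_minus_commute mult.assoc)
  also have "\<dots> \<le> double_integral lborel (cell k x) (\<lambda>y z. ennreal \<bar>f y - f z\<bar>)"
    unfolding s_def using mean_deviation[of k x]
    by (intro nn_integral_mono mult_right_mono) (auto simp: abs_minus_commute)
  also have "\<dots> = ennreal (osc k x)" by (rule osc_eq)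
  finally have "s * (s' * \<bar>mean (Suc k) x - mean k x\<bar>) \<le> osc k x"
    using osc_eq(2) by (subst (asm) ennreal_le_iff) auto
  then have "\<bar>mean (Suc k) x - mean k x\<bar> \<le> osc k x / (s * s')" using s by (simp add: field_simps)
  also have "\<dots> = 2 ^ CARD('n) * (osc k x / (s * s))" using s by simp
  also have "s * s = side k ^ (2 * CARD('n))" by (simp add: s_def mult_2 power_add)
  finally show ?thesis .
qed

text \<open>Finiteness of the fractional energy at \<open>x\<close> replaces the Lebesgue differentiation theorem.\<close>
lemma mean_tendsto:
  assumes x: "x \<in> Q" and fin: "dens x < \<infinity>"
  shows "(\<lambda>k. mean k x) \<longlonglongrightarrow> f x"
proof -
  define n where "n = real CARD('n)"
  define be where "be = n + d * p"
  have be: "0 < be" using d0 p1 by (auto simp: be_def n_def intro!: add_nonneg_pos)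
  obtain D where D: "dens x = ennreal D" "0 \<le> D" using fin by (cases "dens x") auto
  define c where "c = (sqrt n powr be * D) powr (1 / p)"
  \<comment> \<open>On the cell |x - y| is at most sqrt(n) times the side, so the kernel is bounded
    below; in Hoelder's inequality the powers of the side combine to exactly
    \<open>d\<close>.\<close>
  have bound: "\<bar>mean k x - f x\<bar> \<le> c * side k powr d" for k
  proof -
    define s where "s = side k"
    have s: "0 < s" by (simp add: s_def)
    have dist: "norm (x - y) \<le> sqrt n * s" if "y \<in> cell k x" for y
      using hcube_diam[of x _ s y] that mem_cell_self[of x k] unfolding cell_def s_def n_def by blast
    have kern_lower: "ennreal (\<bar>f x - f y\<bar> powr p) \<le> ennreal ((sqrt n * s) powr be) * kern x y" if "y \<in> cell k x" for y
    proof (cases "x = y")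
      case False
      then have pos: "0 < norm (x - y)" by simp
      have "norm (x - y) powr be \<le> (sqrt n * s) powr be"
        using dist[OF that] be by (intro powr_mono2) auto
      then have "\<bar>f x - f y\<bar> powr p * norm (x - y) powr be \<le> \<bar>f x - f y\<bar> powr p * (sqrt n * s) powr be"
        by (intro mult_left_mono) auto
      then have "\<bar>f x - f y\<bar> powr p \<le> (sqrt n * s) powr be * (\<bar>f x - f y\<bar> powr p / norm (x - y) powr be)"
        using pos by (simp add: field_simps)
      then show ?thesis
        unfolding kern_def be_def n_def by (subst ennreal_mult[symmetric]) (auto intro: ennreal_leI)
    qed simp
    have "(\<integral>\<^sup>+y\<in>cell k x. ennreal (\<bar>f x - f y\<bar> powr p) \<partial>lborel)
        \<le> (\<integral>\<^sup>+y. ennreal ((sqrt n * s) powr be) * (kern x y * indicator Q y) \<partial>lborel)"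
      using kern_lower cell_subset[OF x, of k] by (intro nn_integral_mono) (auto simp: indicator_def)
    also have "\<dots> = ennreal ((sqrt n * s) powr be) * dens x"
      unfolding dens_def by (intro nn_integral_cmult) measurable
    also have "\<dots> = ennreal ((sqrt n * s) powr be * D)" using D by (simp add: ennreal_mult)
    finally have int: "(\<integral>\<^sup>+y\<in>cell k x. ennreal (\<bar>f x - f y\<bar> powr p) \<partial>lborel) \<le> ennreal ((sqrt n * s) powr be * D)" .
    have "ennreal (s ^ CARD('n) * \<bar>mean k x - f x\<bar>) \<le> (\<integral>\<^sup>+y\<in>cell k x. ennreal \<bar>f x - f y\<bar> \<partial>lborel)"
      using mean_deviation[of k x "f x"] by (simp add: s_def abs_minus_commute)
    also have "\<dots> \<le> ennreal ((s ^ CARD('n)) powr (1 - 1 / p) * ((sqrt n * s) powr be * D) powr (1 / p))"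
      by (rule nn_integral_powr_Jensen[OF p1]) (use int D s in \<open>auto simp: emeasure_cell s_def less_imp_le\<close>)
    finally have "s ^ CARD('n) * \<bar>mean k x - f x\<bar> \<le> (s ^ CARD('n)) powr (1 - 1 / p) * ((sqrt n * s) powr be * D) powr (1 / p)"
      by (subst (asm) ennreal_le_iff) auto
    also have "\<dots> = s ^ CARD('n) * (c * s powr d)"
    proof -
      have "s ^ CARD('n) = s powr n" using s by (simp add: n_def powr_realpow)
      moreover have "((sqrt n * s) powr be * D) powr (1 / p) = c * s powr (be / p)"
        using s D by (simp add: c_def powr_mult powr_powr n_def mult_ac)
      moreover have "n * (1 - 1 / p) + be / p = n + d" using p1 by (simp add: be_def field_simps)
      ultimately have "(s ^ CARD('n)) powr (1 - 1 / p) * ((sqrt n * s) powr be * D) powr (1 / p) = c * s powr (n + d)"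
        by (simp only: powr_powr mult.left_commute[of _ c] powr_add[symmetric])
      then show ?thesis using \<open>s ^ CARD('n) = s powr n\<close> by (simp add: powr_add mult_ac)
    qed
    finally show ?thesis using s by (simp add: s_def)
  qed
  have "(\<lambda>k. c * side k powr d) \<longlonglongrightarrow> 0"
  proof -
    have "side k powr d = l powr d * (2 powr (- d)) ^ k" for k
      by (simp add: side_powr powr_powr mult.commute flip: powr_realpow)
    moreover have "(\<lambda>k. c * (l powr d * (2 powr (- d)) ^ k)) \<longlonglongrightarrow> c * (l powr d * 0)"
      using d0 by (intro tendsto_mult tendsto_const LIMSEQ_power_zero) (auto simp: powr_less_one)
    ultimately show ?thesis by simp
  qed
  then have "(\<lambda>k. mean k x - f x) \<longlonglongrightarrow> 0"
    by (rule Lim_null_comparison[rotated]) (use bound in auto)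
  then show ?thesis by (simp add: LIM_zero_iff)
qed

text \<open>Telescoping of the means along the cells of \<open>x\<close>, then
  \<open>hedberg_sum\<close> with the mass fraction of the k-th cell as \<open>om k\<close>. The
  sequence \<open>y\<close> stays abstract because small and large \<open>d\<close> choose it
  differently.\<close>

lemma pointwise_bound:
  assumes x: "x \<in> Q" and fin: "dens x < \<infinity>"
    and K: "0 \<le> K" and B: "0 \<le> B" and A: "0 < A" and g: "0 \<le> g"
    and y: "\<And>k. 0 \<le> y k"
    and osc: "\<And>k. osc k x / side k ^ (2 * CARD('n)) \<le> K * side k powr d * y k powr (1 / p)"
    and mass: "\<And>k. measure M (cell k x) * y k \<le> A powr p * mQ"
    and tail: "\<And>N L. (\<Sum>k\<in>{N..<L}. 2 powr (- real k * d) * y k powr (1 / p))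
      \<le> B * 2 powr (- real N * d) * g powr (1 / p)"
  shows "\<bar>f x - mean 0 x\<bar> \<le> 2 ^ CARD('n) * K * l powr d * (exp 1 * (2 * q + B) * A powr (1 - p / q) * g powr (1 / q))"
    (is "_ \<le> ?C * ?H")
proof -
  have partial: "\<bar>mean L x - mean 0 x\<bar> \<le> ?C * ?H" for L
  proof -
    have "mean L x - mean 0 x = (\<Sum>k<L. mean (Suc k) x - mean k x)" by (rule sum_lessThan_telescope[symmetric])
    then have "\<bar>mean L x - mean 0 x\<bar> \<le> (\<Sum>k<L. \<bar>mean (Suc k) x - mean k x\<bar>)" by (simp add: sum_abs)
    also have "\<dots> \<le> (\<Sum>k<L. 2 ^ CARD('n) * (K * side k powr d * y k powr (1 / p)))"
      by (intro sum_mono order_trans[OF mean_step] mult_left_mono osc) auto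
    also have "\<dots> = ?C * (\<Sum>k<L. 2 powr (- real k * d) * y k powr (1 / p))"
      by (simp add: sum_distrib_left side_powr mult_ac)
    also have "\<dots> \<le> ?C * ?H"
    proof (intro mult_left_mono hedberg_sum[OF p1 pq refl eta_le d0 A g B y])
      fix k
      show "0 < measure M (cell k x) / mQ" using measure_cell_pos[OF x] mQ_pos by simp
      show "2 powr (- real k * d) \<le> exp 1 * (measure M (cell k x) / mQ) powr (1 / p - 1 / q)"
        using decay[of "side k" "\<chi> i. a $ i + of_int (idx k x $ i) * side k"] cell_subset[OF x, of k] l0
        by (simp add: cell_def powr_divide side_powr)
      show "measure M (cell k x) / mQ * y k \<le> A powr p" using mass[of k] mQ_pos by (simp add: field_simps)
    qed (use tail K in auto)
    finally show ?thesis .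
  qed
  have "(\<lambda>L. \<bar>mean L x - mean 0 x\<bar>) \<longlonglongrightarrow> \<bar>f x - mean 0 x\<bar>"
    by (intro tendsto_intros mean_tendsto x fin)
  then show ?thesis by (rule LIMSEQ_le_const2) (use partial in auto)
qed

text \<open>Up to a null set, the level set of the deviation lies in a level set of
  \<open>G\<close>. \<open>tail\<close> asks for a real bound \<open>g\<close> on \<open>G x\<close>
  because \<open>G\<close> may take the value infinity.\<close>

lemma weak_type:
  assumes fin: "(\<integral>\<^sup>+x\<in>Q. dens x \<partial>M) < \<infinity>"
    and K: "0 < K" and B: "0 \<le> B" and A: "0 < A"
    and G [measurable]: "G \<in> borel_measurable borel"
    and y: "\<And>k x. x \<in> Q \<Longrightarrow> 0 \<le> y k x"
    and osc: "\<And>k x. x \<in> Q \<Longrightarrow> osc k x / side k ^ (2 * CARD('n)) \<le> K * side k powr d * y k x powr (1 / p)"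
    and mass: "\<And>k x. x \<in> Q \<Longrightarrow> measure M (cell k x) * y k x \<le> A powr p * mQ"
    and tail: "\<And>N L x g. x \<in> Q \<Longrightarrow> 0 \<le> g \<Longrightarrow> G x \<le> ennreal g \<Longrightarrow>
      (\<Sum>k\<in>{N..<L}. 2 powr (- real k * d) * y k x powr (1 / p)) \<le> B * 2 powr (- real N * d) * g powr (1 / p)"
    and weak: "\<And>s. 0 < s \<Longrightarrow> ennreal s * emeasure M {x \<in> Q. ennreal s < G x} \<le> ennreal (A powr p * mQ)"
    and t: "0 < t"
  shows "emeasure M {x \<in> Q. t \<le> \<bar>f x - mean 0 a\<bar>}
    \<le> ennreal (mQ * (2 * (2 ^ CARD('n) * K * l powr d * (exp 1 * (2 * q + B))) * A / t) powr q)"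
proof -
  define E where "E = 2 ^ CARD('n) * K * l powr d * (exp 1 * (2 * q + B))"
  have q1: "1 < q" using pq p1 by linarith
  have E: "0 < E" unfolding E_def using K l0 B q1 by (intro mult_pos_pos add_pos_nonneg) auto
  \<comment> \<open>Chosen so that \<open>G x \<le> s\<close> forces a deviation of at most t/2,
    which contradicts a deviation of at least t.\<close>
  define s where "s = (t / (2 * E)) powr q * A powr (p - q)"
  have s: "0 < s" using t E A by (simp add: s_def)
  have E_s: "E * (A powr (1 - p / q) * s powr (1 / q)) = t / 2"
  proof -
    have "s powr (1 / q) = (t / (2 * E)) * A powr (p / q - 1)"
      using t E A q1 by (simp add: s_def powr_mult powr_powr field_simps)
    moreover have "A powr (1 - p / q) * A powr (p / q - 1) = 1"
      using A by (simp flip: powr_add)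
    ultimately have "A powr (1 - p / q) * s powr (1 / q) = t / (2 * E)" by (simp add: mult_ac)
    then show ?thesis using E by simp
  qed
  \<comment> \<open>The corner \<open>a\<close> belongs to the half-open cube, so
    \<open>mean 0 a\<close> is the mean over Q.\<close>
  have aQ: "a \<in> Q" using l0 by (simp add: hcube_def)
  have mean0: "mean 0 x = mean 0 a" if "x \<in> Q" for x
    using cell_0[OF that] cell_0[OF aQ] by (simp add: mean_def)
  have "AE x in M. dens x * indicator Q x \<noteq> \<infinity>"
    using fin by (intro nn_integral_PInf_AE) auto
  then have "AE x in M. x \<in> {x \<in> Q. t \<le> \<bar>f x - mean 0 a\<bar>} \<longrightarrow> x \<in> {x \<in> Q. ennreal s < G x}"
  proof eventually_elim
    case (elim x)
    show ?case
    proof safe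
      assume x: "x \<in> Q" and tx: "t \<le> \<bar>f x - mean 0 a\<bar>"
      have "dens x < \<infinity>" using elim x by (simp add: less_top)
      note pw = pointwise_bound[OF x this _ B A, of K s "\<lambda>k. y k x"]
      show "ennreal s < G x"
      proof (rule ccontr)
        assume "\<not> ennreal s < G x"
        then have le: "G x \<le> ennreal s" by simp
        have "\<bar>f x - mean 0 x\<bar> \<le> 2 ^ CARD('n) * K * l powr d * (exp 1 * (2 * q + B) * A powr (1 - p / q) * s powr (1 / q))"
          by (rule pw) (use K s y[OF x] osc[OF x] mass[OF x] tail[OF x _ le] in auto)
        also have "\<dots> = E * (A powr (1 - p / q) * s powr (1 / q))" by (simp add: E_def mult_ac)
        finally show False using tx t mean0[OF x] unfolding E_s by simp
      qed
    qed
  qed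
  then have "emeasure M {x \<in> Q. t \<le> \<bar>f x - mean 0 a\<bar>} \<le> emeasure M {x \<in> Q. ennreal s < G x}"
    by (rule emeasure_mono_AE) measurable
  also have "\<dots> = ennreal (measure M {x \<in> Q. ennreal s < G x})" by (rule emeasure_M)
  also have "\<dots> \<le> ennreal (mQ * (2 * E * A / t) powr q)"
  proof (rule ennreal_leI)
    have "ennreal (s * measure M {x \<in> Q. ennreal s < G x}) \<le> ennreal (A powr p * mQ)"
      using weak[OF s] s by (simp add: emeasure_M ennreal_mult)
    then have "s * measure M {x \<in> Q. ennreal s < G x} \<le> A powr p * mQ"
      using mQ_pos A by (subst (asm) ennreal_le_iff) auto
    then have "measure M {x \<in> Q. ennreal s < G x} \<le> mQ * (A powr p / s)" using s by (simp add: field_simps)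
    also have "A powr p / s = (2 * E * A / t) powr q"
      using t E A by (simp add: s_def powr_divide powr_mult powr_diff field_simps)
    finally show "measure M {x \<in> Q. ennreal s < G x} \<le> mQ * (2 * E * A / t) powr q" .
  qed
  finally show ?thesis unfolding E_def .
qed

end

section \<open>Weak-type estimates\<close>

context dyadic_cube
begin

text \<open>Such a function factors through the labels, where every set is measurable.\<close>

lemma cell_const_measurable:
  assumes "\<And>x y. idx k y = idx k x \<Longrightarrow> h y = h x"
  shows "h \<in> borel_measurable borel"
proof -
  define g where "g v = h (SOME x. idx k x = v)" for v
  have "h x = g (idx k x)" for x
    unfolding g_def by (rule assms[symmetric]) (rule someI[of _ x], rule refl)
  then have "h = (\<lambda>x. g (idx k x))" by auto
  then show ?thesis by (simp add: measurable_compose[OF idx_measurable])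
qed

lemma mem_cell_measurable [measurable]: "Measurable.pred (borel \<Otimes>\<^sub>M borel) (\<lambda>w. snd w \<in> cell k (fst w))"
proof -
  have "(\<lambda>w. snd w \<in> cell k (fst w)) = (\<lambda>w. \<exists>v. idx k (fst w) = v \<and> idx k (snd w) = v)"
    by (auto simp: mem_cell_iff)
  also have "Measurable.pred (borel \<Otimes>\<^sub>M borel) \<dots>" by measurable
  finally show ?thesis .
qed

lemma geometric_constant: "1 / (1 - 2 powr (- d)) \<le> 2 / d"
proof -
  have "d / 2 \<le> 1 - 2 powr (- d)" using one_minus_two_powr_lower[of d] d0 d1 by simp
  then have "1 / (1 - 2 powr (- d)) \<le> 1 / (d / 2)"
    using d0 by (intro divide_left_mono mult_pos_pos) (auto intro: less_le_trans[of 0 "d/2"])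
  then show ?thesis by simp
qed

text \<open>Here (2 sqrt n)^n comes from the cube around a ball of radius sqrt(n), and n^n bounds
  sqrt(n)^(n+dp). The 8 bounds (4p)^(1/p) for large d; for small d it compensates (1 - d)^(1/p),
  which is then at least 1/2.\<close>

definition osc_const :: real where
  "osc_const = 8 * ((2 * sqrt (real CARD('n))) ^ CARD('n)) * real CARD('n) ^ CARD('n) * W powr (1 / p) * (1 - d) powr (1 / p)"

lemma osc_const_pos: "0 < osc_const" using W0 d1 by (simp add: osc_const_def)

definition loss :: real where "loss = (1 / d) powr (1 - 1 / p)"

lemma loss_ge_1: "1 \<le> loss"
  unfolding loss_def using d0 d1 p1 by (intro ge_one_powr_ge_zero) auto

end

section \<open>Cell averages, and weak type for small order\<close>

context dyadic_function
begin

lemma order_bounds: "1 \<le> real CARD('n) + d * p" "real CARD('n) + d * p \<le> 2 * real CARD('n)"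
proof -
  have "1 \<le> real CARD('n)" by (simp add: Suc_le_eq)
  moreover have "0 < d * p" using d0 p1 by simp
  ultimately show "1 \<le> real CARD('n) + d * p" "real CARD('n) + d * p \<le> 2 * real CARD('n)" using dp_le by linarith+
qed

lemma diam_const: "0 < sqrt (real CARD('n)) powr (real CARD('n) + d * p)" "sqrt (real CARD('n)) powr (real CARD('n) + d * p) \<le> real CARD('n) ^ CARD('n)"
proof -
  let ?n = "real CARD('n)"
  have "sqrt ?n powr (?n + d * p) \<le> sqrt ?n powr (2 * ?n)"
    using order_bounds by (intro powr_mono) (auto simp: Suc_le_eq)
  also have "\<dots> = (sqrt ?n ^ 2) ^ CARD('n)"
    by (subst power_mult[symmetric], subst powr_realpow[symmetric]) auto
  finally show "sqrt ?n powr (?n + d * p) \<le> ?n ^ CARD('n)" by simp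
qed simp

lemma cell_dist: "z \<in> cell k x \<Longrightarrow> y \<in> cell k x \<Longrightarrow> norm (y - z) \<le> sqrt (real CARD('n)) * side k"
  unfolding cell_def by (rule hcube_diam)

text \<open>\<open>x\<close> and \<open>z\<close> share a cell of generation k only while |x - z|
  \<le> sqrt(n) \<open>side k\<close>. So the kernel frozen at the size of the cell, summed over all
  generations, costs a multiple of one kernel.\<close>

lemma kern_sum:
  assumes "x \<in> Q" "z \<in> Q"
  shows "(\<Sum>k<J. ennreal (\<bar>f x - f z\<bar> powr p / side k powr (real CARD('n) + d * p)) * indicator (cell k x) z)
    \<le> ennreal (2 * sqrt (real CARD('n)) powr (real CARD('n) + d * p)) * kern x z"
proof (cases "x = z")
  case False
  then have pos: "0 < norm (x - z)" by simp
  define t where "t = sqrt (real CARD('n)) * l / norm (x - z)"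
  have t: "0 < t" using pos l0 by (simp add: t_def)
  define c where "c k = (if 2 ^ k \<le> t then (2 ^ k) powr (real CARD('n) + d * p) else 0)" for k :: nat
  have c0: "0 \<le> c k" for k by (simp add: c_def)
  define e where "e = \<bar>f x - f z\<bar> powr p / l powr (real CARD('n) + d * p)"
  have e0: "0 \<le> e" by (simp add: e_def)
  have "ennreal (\<bar>f x - f z\<bar> powr p / side k powr (real CARD('n) + d * p)) * indicator (cell k x) z \<le> ennreal (c k * e)" for k
  proof (cases "z \<in> cell k x")
    case True
    have "norm (x - z) \<le> sqrt (real CARD('n)) * (l / 2 ^ k)" using cell_dist[OF True mem_cell_self] by (simp add: side_def)
    then have "2 ^ k \<le> t" using pos by (simp add: t_def field_simps)
    then show ?thesis using True l0 by (simp add: c_def e_def side_def powr_divide mult.commute)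
  qed simp
  then have "(\<Sum>k<J. ennreal (\<bar>f x - f z\<bar> powr p / side k powr (real CARD('n) + d * p)) * indicator (cell k x) z)
      \<le> (\<Sum>k<J. ennreal (c k * e))" by (intro sum_mono)
  also have "\<dots> = ennreal ((\<Sum>k<J. c k) * e)"
    using c0 e0 by (simp add: sum_distrib_right)
  also have "\<dots> \<le> ennreal (2 * t powr (real CARD('n) + d * p) * e)"
    unfolding c_def using t e0 order_bounds by (intro ennreal_leI mult_right_mono dyadic_kernel_sum) auto
  also have "2 * t powr (real CARD('n) + d * p) * e = 2 * sqrt (real CARD('n)) powr (real CARD('n) + d * p) * (\<bar>f x - f z\<bar> powr p / norm (x - z) powr (real CARD('n) + d * p))"
    using pos l0 by (simp add: t_def e_def powr_divide powr_mult)
  also have "ennreal \<dots> = ennreal (2 * sqrt (real CARD('n)) powr (real CARD('n) + d * p)) * kern x z"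
    unfolding kern_def by (rule ennreal_mult) auto
  finally show ?thesis .
qed simp

lemma geo_ge_1: "1 \<le> (2 * sqrt (real CARD('n))) ^ CARD('n)"
proof -
  have "1 \<le> sqrt (real CARD('n))" by (simp add: Suc_le_eq)
  then have "1 \<le> 2 * sqrt (real CARD('n))" by linarith
  then show ?thesis by (rule one_le_power)
qed

lemma pow_card_ge_1: "1 \<le> real CARD('n) ^ CARD('n)"
  by (intro one_le_power) (simp add: Suc_le_eq)

lemma powr_le_self: "1 \<le> (c::real) \<Longrightarrow> (c powr (p - 1)) powr (1 / p) \<le> c"
proof -
  assume c: "1 \<le> c"
  have "(c powr (p - 1)) powr (1 / p) = c powr (1 - 1 / p)" using p1 by (simp add: powr_powr field_simps)
  also have "\<dots> \<le> c powr 1" using c p1 by (intro powr_mono) auto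
  finally show ?thesis using c by simp
qed

lemma powr_root_le_self: "1 \<le> (c::real) \<Longrightarrow> c powr (1 / p) \<le> c"
  using powr_mono[of "1 / p" 1 c] p1 by simp

text \<open>The p-th root, taken once for both ranges: \<open>E\<close> is 1 for small order and
  4p(1-d) sqrt(n)^(n+dp) for large order. The geometric constant is at least 1, so its power (p-1)/p
  is at most itself, which removes the dependence on p.\<close>

lemma osc_bound:
  assumes x: "x \<in> Q" and E: "0 \<le> E" "E powr (1 / p) \<le> 8 * real CARD('n) ^ CARD('n) * (1 - d) powr (1 / p)"
    and y: "0 \<le> y"
    and le: "(osc k x / side k ^ (2 * CARD('n))) powr p * measure M (cell k x)
      \<le> W * ((2 * sqrt (real CARD('n))) ^ CARD('n)) powr (p - 1) / side k ^ CARD('n) *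
        (E * side k powr (real CARD('n) + d * p) * (y * measure M (cell k x)))"
  shows "osc k x / side k ^ (2 * CARD('n)) \<le> osc_const * side k powr d * y powr (1 / p)"
proof -
  define s where "s = side k"
  have s: "0 < s" by (simp add: s_def)
  define m where "m = measure M (cell k x)"
  have m: "0 < m" using measure_cell_pos[OF x] by (simp add: m_def)
  define u where "u = osc k x / s ^ (2 * CARD('n))"
  have u0: "0 \<le> u" using osc_eq(2) s by (simp add: u_def)
  define g where "g = (2 * sqrt (real CARD('n))) ^ CARD('n)"
  have g: "1 \<le> g" using geo_ge_1 by (simp add: g_def)
  have "u powr p * m \<le> W * g powr (p - 1) / s ^ CARD('n) * (E * s powr (real CARD('n) + d * p) * (y * m))"
    using le by (simp only: u_def m_def s_def g_def)
  also have "\<dots> = (W * g powr (p - 1) * E * (s powr (d * p)) * y) * m"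
    using s by (simp add: powr_add powr_realpow)
  finally have "u powr p \<le> W * g powr (p - 1) * E * (s powr (d * p)) * y" using m by simp
  then have "(u powr p) powr (1 / p) \<le> (W * g powr (p - 1) * E * (s powr (d * p)) * y) powr (1 / p)"
    using p1 by (intro powr_mono2) auto
  then have "u \<le> W powr (1 / p) * (g powr (p - 1)) powr (1 / p) * E powr (1 / p) * s powr d * y powr (1 / p)"
    using p1 u0 W0 y E by (simp add: powr_mult powr_powr)
  also have "\<dots> \<le> W powr (1 / p) * g * (8 * real CARD('n) ^ CARD('n) * (1 - d) powr (1 / p)) * s powr d * y powr (1 / p)"
    by (intro mult_right_mono mult_mono powr_le_self[OF g] E(2)) (use W0 g in auto)
  finally show ?thesis by (simp add: osc_const_def u_def s_def g_def mult_ac)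
qed

lemma weak_small_order:
  assumes d: "d \<le> 1 / 2" and N: "0 < N" "(\<integral>\<^sup>+x\<in>Q. dens x \<partial>M) \<le> ennreal (N powr p * mQ)" and t: "0 < t"
  shows "emeasure M {x \<in> Q. t \<le> \<bar>f x - mean 0 a\<bar>}
    \<le> ennreal (mQ * (2 * (2 ^ CARD('n) * osc_const * l powr d *
      (exp 1 * (2 * q + 4 * loss))) * (2 * real CARD('n) ^ CARD('n) * N) / t) powr q)"
proof -
  let ?n = "real CARD('n)"
  define pair where "pair k x = double_integral M (cell k x) (\<lambda>y z. ennreal (\<bar>f y - f z\<bar> powr p))" for k x
  \<comment> \<open>The kernel with |x - z| replaced by the side of the cell: a pair enters at every
    generation at which it shares a cell.\<close>
  define kap where "kap k x = (\<integral>\<^sup>+z. ennreal (\<bar>f x - f z\<bar> powr p / side k powr (?n + d * p)) * indicator (cell k x) z \<partial>lborel)" for k x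
  have kap_meas [measurable]: "kap k \<in> borel_measurable borel" for k
  proof -
    have [measurable]: "(\<lambda>w. indicator (cell k (fst w)) (snd w) :: ennreal) \<in> borel_measurable (borel \<Otimes>\<^sub>M lborel)"
    proof -
      have "(\<lambda>w. indicator (cell k (fst w)) (snd w) :: ennreal) = indicator {w \<in> space (borel \<Otimes>\<^sub>M borel). snd w \<in> cell k (fst w)}"
        by (auto simp: indicator_def space_pair_measure fun_eq_iff)
      also have "\<dots> \<in> borel_measurable (borel \<Otimes>\<^sub>M borel)" by measurable
      finally show ?thesis by (simp cong: measurable_cong_sets)
    qed
    show ?thesis unfolding kap_def by measurable
  qed
  have pair_kap: "pair k x = ennreal (side k powr (?n + d * p)) * (\<integral>\<^sup>+y\<in>cell k x. kap k y \<partial>M)" for k x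
  proof -
    have "(\<integral>\<^sup>+z\<in>cell k x. ennreal (\<bar>f y - f z\<bar> powr p) \<partial>lborel) = ennreal (side k powr (?n + d * p)) * kap k y" if "y \<in> cell k x" for y
      unfolding kap_def cell_eq[OF that]
      by (subst nn_integral_cmult[symmetric])
        (auto simp flip: mult.assoc ennreal_mult simp: less_imp_neq[OF side_pos, symmetric] intro!: nn_integral_cong)
    then have "pair k x = (\<integral>\<^sup>+y. ennreal (side k powr (?n + d * p)) * (kap k y * indicator (cell k x) y) \<partial>M)"
      unfolding pair_def by (intro nn_integral_cong) (auto split: split_indicator)
    also have "\<dots> = ennreal (side k powr (?n + d * p)) * (\<integral>\<^sup>+y\<in>cell k x. kap k y \<partial>M)"
      by (rule nn_integral_cmult) measurable
    finally show ?thesis .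
  qed
  have kap_sum: "(\<Sum>k. kap k x) \<le> ennreal (2 * sqrt ?n powr (?n + d * p)) * dens x" if x: "x \<in> Q" for x
  proof (rule suminf_le_const)
    fix J
    have "(\<Sum>k<J. kap k x) = (\<integral>\<^sup>+z. (\<Sum>k<J. ennreal (\<bar>f x - f z\<bar> powr p / side k powr (?n + d * p)) * indicator (cell k x) z) \<partial>lborel)"
      unfolding kap_def by (rule nn_integral_sum[symmetric]) measurable
    also have "\<dots> \<le> (\<integral>\<^sup>+z. ennreal (2 * sqrt ?n powr (?n + d * p)) * (kern x z * indicator Q z) \<partial>lborel)"
    proof (intro nn_integral_mono)
      fix z
      show "(\<Sum>k<J. ennreal (\<bar>f x - f z\<bar> powr p / side k powr (?n + d * p)) * indicator (cell k x) z)
          \<le> ennreal (2 * sqrt ?n powr (?n + d * p)) * (kern x z * indicator Q z)"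
      proof (cases "z \<in> Q")
        case False
        then have "z \<notin> cell k x" for k using cell_subset[OF x] by auto
        then show ?thesis by simp
      qed (use kern_sum[OF x] in auto)
    qed
    also have "\<dots> = ennreal (2 * sqrt ?n powr (?n + d * p)) * dens x"
      unfolding dens_def by (rule nn_integral_cmult) measurable
    finally show "(\<Sum>k<J. kap k x) \<le> ennreal (2 * sqrt ?n powr (?n + d * p)) * dens x" .
  qed simp
  have kap_total: "(\<Sum>k. \<integral>\<^sup>+x\<in>Q. kap k x \<partial>M) \<le> ennreal ((2 * ?n ^ CARD('n) * N) powr p * mQ)"
  proof -
    have "(\<Sum>k. \<integral>\<^sup>+x\<in>Q. kap k x \<partial>M) = (\<integral>\<^sup>+x. (\<Sum>k. kap k x * indicator Q x) \<partial>M)"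
      by (rule nn_integral_suminf[symmetric]) measurable
    also have "\<dots> \<le> (\<integral>\<^sup>+x. ennreal (2 * sqrt ?n powr (?n + d * p)) * (dens x * indicator Q x) \<partial>M)"
      using kap_sum by (intro nn_integral_mono) (auto split: split_indicator)
    also have "\<dots> = ennreal (2 * sqrt ?n powr (?n + d * p)) * (\<integral>\<^sup>+x\<in>Q. dens x \<partial>M)"
      by (rule nn_integral_cmult) measurable
    also have "\<dots> \<le> ennreal (2 * sqrt ?n powr (?n + d * p)) * ennreal (N powr p * mQ)"
      by (intro mult_left_mono N) auto
    also have "\<dots> = ennreal (2 * sqrt ?n powr (?n + d * p) * (N powr p * mQ))"
      by (rule ennreal_mult[symmetric]) auto
    also have "\<dots> \<le> ennreal ((2 * ?n ^ CARD('n)) powr p * (N powr p * mQ))"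
    proof (intro ennreal_leI mult_right_mono)
      \<comment> \<open>\<open>p \<ge> 1\<close> moves the constant under the power p, where it is
        merged with \<open>N\<close>.\<close>
      have "2 * sqrt ?n powr (?n + d * p) \<le> (2 * ?n ^ CARD('n)) powr 1" using diam_const by simp
      also have "\<dots> \<le> (2 * ?n ^ CARD('n)) powr p" using p1
      proof (intro powr_mono)
        show "1 \<le> 2 * ?n ^ CARD('n)" using pow_card_ge_1 by linarith
      qed
      finally show "2 * sqrt ?n powr (?n + d * p) \<le> (2 * ?n ^ CARD('n)) powr p" .
    qed simp
    finally show ?thesis using N by (simp add: powr_mult mult_ac)
  qed
  have cell_Q: "(\<integral>\<^sup>+y\<in>cell k x. kap k y \<partial>M) \<le> ennreal ((2 * ?n ^ CARD('n) * N) powr p * mQ)" if "x \<in> Q" for k x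
  proof -
    have "(\<integral>\<^sup>+y\<in>cell k x. kap k y \<partial>M) \<le> (\<integral>\<^sup>+y\<in>Q. kap k y \<partial>M)"
      using cell_subset[OF that] by (intro nn_integral_mono) (auto split: split_indicator)
    also have "\<dots> \<le> (\<Sum>k. \<integral>\<^sup>+x\<in>Q. kap k x \<partial>M)"
      using sum_le_suminf[of "\<lambda>k. \<integral>\<^sup>+x\<in>Q. kap k x \<partial>M" "{k}"] by simp
    also note kap_total
    finally show ?thesis .
  qed
  \<comment> \<open>\<open>enn2real\<close> would send an infinite integral to 0; on Q this is
    excluded by \<open>cell_Q\<close>.\<close>
  define y where "y k x = enn2real (\<integral>\<^sup>+y\<in>cell k x. kap k y \<partial>M) / measure M (cell k x)" for k x
  have y_const: "y k z = y k x" if "idx k z = idx k x" for k x z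
    using cell_eq[of z k x] that by (simp add: y_def mem_cell_iff)
  have y_meas [measurable]: "y k \<in> borel_measurable borel" for k
    by (rule cell_const_measurable[of k]) (rule y_const)
  have y0: "0 \<le> y k x" for k x by (simp add: y_def)
  have y_mass: "ennreal (y k x * measure M (cell k x)) = (\<integral>\<^sup>+y\<in>cell k x. kap k y \<partial>M)" if "x \<in> Q" for k x
  proof -
    have "(\<integral>\<^sup>+y\<in>cell k x. kap k y \<partial>M) < \<infinity>" using cell_Q[OF that] by (rule le_less_trans) simp
    then show ?thesis using measure_cell_pos[OF that, of k] by (simp add: y_def)
  qed
  define G where "G x = (\<Sum>k. ennreal (y k x))" for x
  have [measurable]: "G \<in> borel_measurable borel" unfolding G_def by measurable
  have G_int: "(\<integral>\<^sup>+x\<in>Q. G x \<partial>M) \<le> ennreal ((2 * ?n ^ CARD('n) * N) powr p * mQ)"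
  proof -
    have "(\<integral>\<^sup>+x\<in>Q. G x \<partial>M) = (\<integral>\<^sup>+x. (\<Sum>k. ennreal (y k x) * indicator Q x) \<partial>M)"
      unfolding G_def by (intro nn_integral_cong) (auto split: split_indicator)
    also have "\<dots> = (\<Sum>k. \<integral>\<^sup>+x\<in>Q. ennreal (y k x) \<partial>M)"
      by (rule nn_integral_suminf) measurable
    also have "\<dots> \<le> (\<Sum>k. \<integral>\<^sup>+x\<in>Q. kap k x \<partial>M)"
    proof (intro suminf_le)
      fix k
      show "(\<integral>\<^sup>+x\<in>Q. ennreal (y k x) \<partial>M) \<le> (\<integral>\<^sup>+x\<in>Q. kap k x \<partial>M)"
      proof (rule cell_integral_le[of _ k])
        show "ennreal (y k x) * emeasure M (cell k x) \<le> (\<integral>\<^sup>+y\<in>cell k x. kap k y \<partial>M)" if "x \<in> Q" for x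
          using y_mass[OF that, of k] y0[of k x] by (simp add: emeasure_M ennreal_mult)
        show "ennreal (y k z) = ennreal (y k x)" if "z \<in> cell k x" for x z
          using y_const[of k z x] that by (simp only: mem_cell_iff)
      qed (simp_all add: cell_subset)
    qed auto
    also note kap_total
    finally show ?thesis .
  qed
  show ?thesis
  proof (rule weak_type[where G = G and y = y])
    show "(\<integral>\<^sup>+x\<in>Q. dens x \<partial>M) < \<infinity>" using N(2) by (rule le_less_trans) simp
    show "0 < osc_const" by (rule osc_const_pos)
    show "0 \<le> 4 * loss" "0 < 2 * ?n ^ CARD('n) * N" using loss_ge_1 N by auto
    show "measure M (cell k x) * y k x \<le> (2 * ?n ^ CARD('n) * N) powr p * mQ" if "x \<in> Q" for k x
    proof -
      have "ennreal (y k x * measure M (cell k x)) \<le> ennreal ((2 * ?n ^ CARD('n) * N) powr p * mQ)"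
        unfolding y_mass[OF that] by (rule cell_Q[OF that])
      then show ?thesis by (subst (asm) ennreal_le_iff) (auto simp: mult.commute)
    qed
    show "osc k x / side k ^ (2 * CARD('n))
        \<le> osc_const * side k powr d * y k x powr (1 / p)"
      if x: "x \<in> Q" for k x
    proof (rule osc_bound[OF x, of 1])
      \<comment> \<open>The factor (1 - d)^(1/p) of \<open>osc_const\<close> is not gained in this
        range, only bounded below.\<close>
      have half: "1 / 2 \<le> (1 - d) powr (1 / p)"
      proof -
        have "1 / 2 = (1 / 2) powr (1 :: real)" by simp
        also have "\<dots> \<le> (1 / 2) powr (1 / p)" using p1 by (intro powr_mono') auto
        also have "\<dots> \<le> (1 - d) powr (1 / p)" using d p1 by (intro powr_mono2) auto
        finally show ?thesis .
      qed
      have "1 \<le> 8 * 1 * (1 / 2 :: real)" by simp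
      also have "\<dots> \<le> 8 * ?n ^ CARD('n) * (1 - d) powr (1 / p)"
        using half pow_card_ge_1 by (intro mult_mono) auto
      finally show "1 powr (1 / p) \<le> 8 * ?n ^ CARD('n) * (1 - d) powr (1 / p)" by simp
      have "pair k x = ennreal (1 * side k powr (?n + d * p) * (y k x * measure M (cell k x)))"
        using pair_kap[of k x] y_mass[OF x, of k] y0[of k x] by (simp add: ennreal_mult)
      then show "(osc k x / side k ^ (2 * CARD('n))) powr p * measure M (cell k x)
          \<le> W * ((2 * sqrt ?n) ^ CARD('n)) powr (p - 1) / side k ^ CARD('n) *
            (1 * side k powr (?n + d * p) * (y k x * measure M (cell k x)))"
        using cell_subset[OF x, of k] osc_eq[of k x] y0[of k x] unfolding pair_def cell_def
        by (intro osc_small_order[OF f_borel f_bounded]) auto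
    qed (use y0 in auto)
    show "(\<Sum>k\<in>{N..<L}. 2 powr (- real k * d) * y k x powr (1 / p)) \<le> 4 * loss * 2 powr (- real N * d) * g powr (1 / p)"
      if "x \<in> Q" "0 \<le> g" "G x \<le> ennreal g" for N L x g
    proof -
      \<comment> \<open>Hoelder over the scales: the weights are at most the first one and sum to at
        most 2/d times it, so only (2/d)^(1-1/p) is lost.\<close>
      have "(\<Sum>k\<in>{N..<L}. 2 powr (- real k * d) * y k x powr (1 / p))
          \<le> 2 powr (- real N * d) * (2 / d) powr (1 - 1 / p) * g powr (1 / p)"
      proof (rule weighted_powr_sum_le[OF p1])
        have "(\<Sum>k\<in>{N..<L}. 2 powr (- real k * d)) \<le> 2 powr (- real N * d) * (1 / (1 - 2 powr (- d)))"
          using geometric_powr_sum_le[OF d0, of N L] by simp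
        also have "\<dots> \<le> 2 powr (- real N * d) * (2 / d)"
          by (intro mult_left_mono geometric_constant) auto
        finally show "(\<Sum>k\<in>{N..<L}. 2 powr (- real k * d)) \<le> 2 powr (- real N * d) * (2 / d)" .
        have "ennreal (\<Sum>k\<in>{N..<L}. y k x) = (\<Sum>k\<in>{N..<L}. ennreal (y k x))" using y0 by simp
        also have "\<dots> \<le> G x" unfolding G_def by (rule sum_le_suminf) auto
        also note that(3)
        finally show "(\<Sum>k\<in>{N..<L}. y k x) \<le> g" using that(2) by (subst (asm) ennreal_le_iff) auto
        show "2 powr (- real k * d) \<le> 2 powr (- real N * d)" if "k \<in> {N..<L}" for k
          using that d0 by (intro powr_mono) auto
      qed (use y0 d0 in auto)
      also have "\<dots> \<le> 2 powr (- real N * d) * (4 * loss) * g powr (1 / p)"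
      proof (intro mult_right_mono mult_left_mono)
        have "(2 / d) powr (1 - 1 / p) = 2 powr (1 - 1 / p) * loss"
          using d0 by (simp add: loss_def powr_mult[symmetric])
        also have "\<dots> \<le> 2 powr 1 * loss"
          using p1 loss_ge_1 by (intro mult_right_mono powr_mono) auto
        finally show "(2 / d) powr (1 - 1 / p) \<le> 4 * loss" using loss_ge_1 by simp
      qed auto
      finally show ?thesis by (simp add: mult_ac)
    qed
    show "ennreal s * emeasure M {x \<in> Q. ennreal s < G x} \<le> ennreal ((2 * ?n ^ CARD('n) * N) powr p * mQ)" if "0 < s" for s
    proof -
      have "ennreal s * emeasure M {x \<in> Q. ennreal s < G x} = (\<integral>\<^sup>+x. ennreal s * indicator {x \<in> Q. ennreal s < G x} x \<partial>M)"
        by (rule nn_integral_cmult_indicator[symmetric]) measurable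
      also have "\<dots> \<le> (\<integral>\<^sup>+x\<in>Q. G x \<partial>M)"
        by (intro nn_integral_mono) (auto split: split_indicator simp: less_imp_le)
      also note G_int
      finally show ?thesis .
    qed
  qed (use y0 t in \<open>auto\<close>)
qed

end

section \<open>Weak type for large order\<close>

context dyadic_function
begin

text \<open>\<open>G\<close> is the dyadic maximal function of \<open>dens\<close> with respect to
  \<open>M\<close>. Dyadic cells are nested or disjoint, so its weak-type constant is 1 for every
  such measure, doubling or not.\<close>

lemma weak_large_order:
  assumes d: "1 / 2 \<le> d" and N: "0 < N" "(\<integral>\<^sup>+x\<in>Q. dens x \<partial>M) \<le> ennreal (N powr p * mQ)" and t: "0 < t"
  shows "emeasure M {x \<in> Q. t \<le> \<bar>f x - mean 0 a\<bar>}
    \<le> ennreal (mQ * (2 * (2 ^ CARD('n) * osc_const * l powr d *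
      (exp 1 * (2 * q + 4 * loss))) * (2 * real CARD('n) ^ CARD('n) * N) / t) powr q)"
proof -
  let ?n = "real CARD('n)"
  define y where "y k x = enn2real (\<integral>\<^sup>+y\<in>cell k x. dens y \<partial>M) / measure M (cell k x)" for k x
  have y_const: "y k z = y k x" if "idx k z = idx k x" for k x z
    using cell_eq[of z k x] that by (simp add: y_def mem_cell_iff)
  have y_meas [measurable]: "y k \<in> borel_measurable borel" for k
    by (rule cell_const_measurable[of k]) (rule y_const)
  have y0: "0 \<le> y k x" for k x by (simp add: y_def)
  have cell_Q: "(\<integral>\<^sup>+y\<in>cell k x. dens y \<partial>M) \<le> ennreal (N powr p * mQ)" if "x \<in> Q" for k x
  proof -
    have "(\<integral>\<^sup>+y\<in>cell k x. dens y \<partial>M) \<le> (\<integral>\<^sup>+y\<in>Q. dens y \<partial>M)"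
      using cell_subset[OF that] by (intro nn_integral_mono) (auto split: split_indicator)
    also note N(2)
    finally show ?thesis .
  qed
  have y_mass: "ennreal (y k x * measure M (cell k x)) = (\<integral>\<^sup>+y\<in>cell k x. dens y \<partial>M)" if "x \<in> Q" for k x
  proof -
    have "(\<integral>\<^sup>+y\<in>cell k x. dens y \<partial>M) < \<infinity>" using cell_Q[OF that] by (rule le_less_trans) simp
    then show ?thesis using measure_cell_pos[OF that, of k] by (simp add: y_def)
  qed
  define G where "G x = (SUP k. ennreal (y k x))" for x
  have [measurable]: "G \<in> borel_measurable borel" unfolding G_def by measurable
  have N_A: "N powr p \<le> (2 * ?n ^ CARD('n) * N) powr p"
  proof (intro powr_mono2)
    have "1 * N \<le> 2 * ?n ^ CARD('n) * N"
      using N pow_card_ge_1 by (intro mult_right_mono) linarith+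
    then show "N \<le> 2 * ?n ^ CARD('n) * N" by simp
  qed (use N p1 in auto)
  show ?thesis
  proof (rule weak_type[where G = G and y = y])
    show "(\<integral>\<^sup>+x\<in>Q. dens x \<partial>M) < \<infinity>" using N(2) by (rule le_less_trans) simp
    show "0 < osc_const" by (rule osc_const_pos)
    show "0 \<le> 4 * loss" "0 < 2 * ?n ^ CARD('n) * N" using loss_ge_1 N by auto
    show "measure M (cell k x) * y k x \<le> (2 * ?n ^ CARD('n) * N) powr p * mQ" if "x \<in> Q" for k x
    proof -
      have "ennreal (y k x * measure M (cell k x)) \<le> ennreal (N powr p * mQ)"
        unfolding y_mass[OF that] by (rule cell_Q[OF that])
      then have "y k x * measure M (cell k x) \<le> N powr p * mQ"
        by (subst (asm) ennreal_le_iff) auto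
      also have "\<dots> \<le> (2 * ?n ^ CARD('n) * N) powr p * mQ"
        by (intro mult_right_mono N_A) simp
      finally show ?thesis by (simp add: mult.commute)
    qed
    show "osc k x / side k ^ (2 * CARD('n))
        \<le> osc_const * side k powr d * y k x powr (1 / p)"
      if x: "x \<in> Q" for k x
    proof (rule osc_bound[OF x])
      define v where "v = sqrt ?n powr (?n + d * p)"
      have v: "0 < v" "v \<le> ?n ^ CARD('n)" using diam_const by (simp_all add: v_def)
      show "0 \<le> 4 * p * (1 - d) * v" using v p1 d1 by simp
      \<comment> \<open>From the tangent of 2^(p-1) at p = 1, with 2 ln 2 \<ge> 1. It yields p^(1/p)
        \<le> 2.\<close>
      have "p \<le> 2 powr p"
      proof -
        have "(p - 1) * 1 \<le> (p - 1) * (2 * ln 2)"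
          using p1 ln2_ge_two_thirds by (intro mult_left_mono) linarith+
        then have "p \<le> 2 * (1 + (p - 1) * ln 2)" by simp
        also have "\<dots> \<le> 2 * exp ((p - 1) * ln 2)"
          by (intro mult_left_mono exp_ge_add_one_self) auto
        also have "\<dots> = 2 powr p" by (simp add: powr_def exp_diff algebra_simps)
        finally show ?thesis .
      qed
      then have "p powr (1 / p) \<le> (2 powr p) powr (1 / p)" using p1 by (intro powr_mono2) auto
      also have "\<dots> = 2" using p1 by (simp add: powr_powr)
      finally have "4 powr (1 / p) * p powr (1 / p) \<le> 4 * 2"
        using powr_root_le_self[of 4] by (intro mult_mono) auto
      moreover have "v powr (1 / p) \<le> ?n ^ CARD('n)"
      proof -
        have "v powr (1 / p) \<le> (?n ^ CARD('n)) powr (1 / p)" using v p1 by (intro powr_mono2) auto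
        also have "\<dots> \<le> ?n ^ CARD('n)" by (rule powr_root_le_self[OF pow_card_ge_1])
        finally show ?thesis .
      qed
      ultimately have le: "(4 powr (1 / p) * p powr (1 / p)) * v powr (1 / p) * (1 - d) powr (1 / p)
          \<le> 8 * ?n ^ CARD('n) * (1 - d) powr (1 / p)"
        by (intro mult_right_mono mult_mono) auto
      show "(4 * p * (1 - d) * v) powr (1 / p) \<le> 8 * ?n ^ CARD('n) * (1 - d) powr (1 / p)"
      proof -
        define e where "e = 1 - d"
        have "0 < e" using d1 by (simp add: e_def)
        then have "(4 * p * e * v) powr (1 / p) = (4 powr (1 / p) * p powr (1 / p)) * v powr (1 / p) * e powr (1 / p)"
          using p1 v by (simp add: powr_mult mult_ac)
        with le show ?thesis by (simp only: e_def)
      qed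
      have pair: "double_integral M (cell k x) (frac_kernel d p f)
          \<le> ennreal (y k x * measure M (cell k x))"
        unfolding y_mass[OF x] dens_def kern_def using cell_subset[OF x, of k]
        by (intro nn_integral_mono mult_right_mono) (auto split: split_indicator)
      have "(osc k x / side k ^ (2 * CARD('n))) powr p * measure M (cell k x)
        \<le> W * ((2 * sqrt ?n) ^ CARD('n)) powr (p - 1) / side k ^ CARD('n) *
          (4 * p * (1 - d) * (sqrt ?n * side k) powr (?n + d * p) * (y k x * measure M (cell k x)))"
        unfolding cell_def
        by (rule osc_large_order[OF f_borel f_bounded])
          (use pair cell_subset[OF x, of k] osc_eq[of k x] y0 d0 d1 in \<open>auto simp: cell_def\<close>)
      then show "(osc k x / side k ^ (2 * CARD('n))) powr p * measure M (cell k x)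
        \<le> W * ((2 * sqrt ?n) ^ CARD('n)) powr (p - 1) / side k ^ CARD('n) *
          (4 * p * (1 - d) * v * side k powr (?n + d * p) * (y k x * measure M (cell k x)))"
        by (simp add: v_def powr_mult less_imp_le mult_ac)
    qed (rule y0)
    show "(\<Sum>k\<in>{L..<L'}. 2 powr (- real k * d) * y k x powr (1 / p)) \<le> 4 * loss * 2 powr (- real L * d) * g powr (1 / p)"
      if "x \<in> Q" "0 \<le> g" "G x \<le> ennreal g" for L L' x g
    proof -
      have y_le: "y k x \<le> g" for k
      proof -
        have "ennreal (y k x) \<le> G x" unfolding G_def by (rule SUP_upper) simp
        also note that(3)
        finally show ?thesis using that(2) by (subst (asm) ennreal_le_iff) auto
      qed
      have "(\<Sum>k\<in>{L..<L'}. 2 powr (- real k * d) * y k x powr (1 / p))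
          \<le> (\<Sum>k\<in>{L..<L'}. 2 powr (- real k * d) * g powr (1 / p))"
        using y_le y0 p1 by (intro sum_mono mult_left_mono powr_mono2) auto
      also have "\<dots> = (\<Sum>k\<in>{L..<L'}. 2 powr (- real k * d)) * g powr (1 / p)"
        by (simp add: sum_distrib_right)
      also have "\<dots> \<le> (2 powr (- real L * d) * (4 * loss)) * g powr (1 / p)"
      proof (rule mult_right_mono)
        have "(\<Sum>k\<in>{L..<L'}. 2 powr (- real k * d)) \<le> 2 powr (- real L * d) * (1 / (1 - 2 powr (- d)))"
          using geometric_powr_sum_le[OF d0, of L L'] by simp
        also have "\<dots> \<le> 2 powr (- real L * d) * (4 * loss)"
        proof (rule mult_left_mono)
          \<comment> \<open>Here \<open>d \<ge> 1 / 2\<close> bounds the geometric series by 4; the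
            factor \<open>loss\<close> is inserted to share the constant with the other
            range.\<close>
          have "1 / (1 - 2 powr (- d)) \<le> 2 / d" by (rule geometric_constant)
          also have "\<dots> \<le> 4 * 1" using d by (simp add: field_simps)
          also have "\<dots> \<le> 4 * loss" using loss_ge_1 by (intro mult_left_mono) auto
          finally show "1 / (1 - 2 powr (- d)) \<le> 4 * loss" .
        qed simp
        finally show "(\<Sum>k\<in>{L..<L'}. 2 powr (- real k * d)) \<le> 2 powr (- real L * d) * (4 * loss)" .
      qed simp
      finally show ?thesis by (simp add: mult_ac)
    qed
    show "ennreal s * emeasure M {x \<in> Q. ennreal s < G x} \<le> ennreal ((2 * ?n ^ CARD('n) * N) powr p * mQ)" if s: "0 < s" for s
    proof -
      \<comment> \<open>Stopping time: \<open>E k\<close> collects the points whose first average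
        above \<open>s\<close> occurs at generation k. It is a union of cells of that generation,
        because the averages up to k are constant on them.\<close>
      define E where "E k = {x \<in> Q. s < y k x \<and> (\<forall>j\<in>{..<k}. y j x \<le> s)}" for k
      have E_meas [measurable]: "E k \<in> sets borel" for k unfolding E_def by measurable
      have disj: "disjoint_family E"
        unfolding disjoint_family_on_def
      proof (intro ballI impI)
        fix i j :: nat
        assume "i \<noteq> j"
        then show "E i \<inter> E j = {}" by (cases "i < j") (auto simp: E_def not_less[symmetric])
      qed
      have un: "{x \<in> Q. ennreal s < G x} = (\<Union>k. E k)"
      proof safe
        fix x assume x: "x \<in> Q" "ennreal s < G x"
        then obtain k where "s < y k x"
          using s by (auto simp: G_def less_SUP_iff ennreal_less_iff)
        then have "s < y (LEAST k. s < y k x) x" by (rule LeastI)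
        moreover have "y j x \<le> s" if "j < (LEAST k. s < y k x)" for j
          using not_less_Least[OF that] by simp
        ultimately show "x \<in> (\<Union>k. E k)" using x(1) unfolding E_def by blast
      next
        fix x k assume "x \<in> E k"
        then have "x \<in> Q" "ennreal s < ennreal (y k x)" using s by (auto simp: E_def ennreal_less_iff)
        moreover have "ennreal (y k x) \<le> G x" unfolding G_def by (rule SUP_upper) simp
        ultimately show "x \<in> Q" "ennreal s < G x" by (auto intro: less_le_trans)
      qed
      have E_le: "(\<integral>\<^sup>+x\<in>E k. ennreal s \<partial>M) \<le> (\<integral>\<^sup>+x\<in>E k. dens x \<partial>M)" for k
      proof (rule cell_integral_le[of _ k])
        show "cell k x \<subseteq> E k" if x: "x \<in> E k" for x
        proof
          fix z assume z: "z \<in> cell k x"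
          have "y j z = y j x" if "j \<le> k" for j
            using z that by (intro y_const idx_antimono[of j k]) (simp_all add: mem_cell_iff)
          then show "z \<in> E k" using x z cell_subset[of x k] by (auto simp: E_def)
        qed
        show "ennreal s * emeasure M (cell k x) \<le> (\<integral>\<^sup>+y\<in>cell k x. dens y \<partial>M)" if "x \<in> E k" for x
        proof -
          have x: "x \<in> Q" "s < y k x" using that by (auto simp: E_def)
          have "ennreal s * emeasure M (cell k x) = ennreal (s * measure M (cell k x))"
            using s by (simp add: emeasure_M ennreal_mult)
          also have "\<dots> \<le> ennreal (y k x * measure M (cell k x))"
            using x by (intro ennreal_leI mult_right_mono) auto
          finally show ?thesis unfolding y_mass[OF x(1)] .
        qed
      qed auto
      have "ennreal s * emeasure M {x \<in> Q. ennreal s < G x} = (\<integral>\<^sup>+x\<in>(\<Union>k. E k). ennreal s \<partial>M)"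
        unfolding un by (rule nn_integral_cmult_indicator[symmetric]) measurable
      also have "\<dots> = (\<Sum>k. \<integral>\<^sup>+x\<in>E k. ennreal s \<partial>M)"
        by (rule nn_integral_disjoint_family[OF _ _ disj]) auto
      also have "\<dots> \<le> (\<Sum>k. \<integral>\<^sup>+x\<in>E k. dens x \<partial>M)" by (intro suminf_le E_le) auto
      also have "\<dots> = (\<integral>\<^sup>+x\<in>(\<Union>k. E k). dens x \<partial>M)"
        by (rule nn_integral_disjoint_family[OF _ _ disj, symmetric]) auto
      also have "\<dots> \<le> (\<integral>\<^sup>+x\<in>Q. dens x \<partial>M)"
        by (intro nn_integral_mono) (auto simp: E_def split: split_indicator)
      also note N(2)
      also have "ennreal (N powr p * mQ) \<le> ennreal ((2 * ?n ^ CARD('n) * N) powr p * mQ)"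
        by (intro ennreal_leI mult_right_mono N_A) simp
      finally show ?thesis .
    qed
  qed (use y0 t in \<open>auto\<close>)
qed

lemma weak_inequality:
  assumes N: "0 < N" "(\<integral>\<^sup>+x\<in>Q. dens x \<partial>M) \<le> ennreal (N powr p * mQ)" and t: "0 < t"
  shows "emeasure M {x \<in> Q. t \<le> \<bar>f x - mean 0 a\<bar>}
    \<le> ennreal (mQ * (576 * (2 * (2 * sqrt (real CARD('n))) * real CARD('n) * real CARD('n)) ^ CARD('n) *
        (W powr (1 / p) * (1 - d) powr (1 / p) * loss * l powr d * q) * N / t) powr q)"
proof -
  let ?n = "real CARD('n)"
  have q1: "1 \<le> q" using pq p1 by simp
  \<comment> \<open>Uses e \<le> 3; \<open>q\<close> and \<open>loss\<close> are at least 1, so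
    their product absorbs the sum.\<close>
  have e: "exp 1 * (2 * q + 4 * loss) \<le> 3 * (6 * (q * loss))"
  proof (rule mult_mono)
    show "2 * q + 4 * loss \<le> 6 * (q * loss)"
      using mult_right_mono[OF q1, of loss] mult_left_mono[OF loss_ge_1, of q] q1 loss_ge_1 by linarith
  qed (use exp_le q1 loss_ge_1 in auto)
  have "emeasure M {x \<in> Q. t \<le> \<bar>f x - mean 0 a\<bar>}
    \<le> ennreal (mQ * (2 * (2 ^ CARD('n) * osc_const * l powr d *
      (exp 1 * (2 * q + 4 * loss))) * (2 * ?n ^ CARD('n) * N) / t) powr q)"
    using weak_small_order[OF _ N t] weak_large_order[OF _ N t] by (cases "d \<le> 1 / 2") auto
  also have "\<dots> \<le> ennreal (mQ * (2 * (2 ^ CARD('n) * osc_const * l powr d *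
      (3 * (6 * (q * loss)))) * (2 * ?n ^ CARD('n) * N) / t) powr q)"
    using t N q1 loss_ge_1 osc_const_pos
    by (intro ennreal_leI mult_left_mono powr_mono2 divide_right_mono mult_right_mono e) auto
  \<comment> \<open>576 = 2 * 8 * 18 * 2. The four n-th powers come from the volume ratio of parent
    and child, the cube around a ball, the diameter in the oscillation, and the kernel sum.\<close>
  also have "2 * (2 ^ CARD('n) * osc_const * l powr d * (3 * (6 * (q * loss)))) * (2 * ?n ^ CARD('n) * N)
    = 576 * (2 ^ CARD('n) * (2 * sqrt ?n) ^ CARD('n) * ?n ^ CARD('n) * ?n ^ CARD('n)) *
      (W powr (1 / p) * (1 - d) powr (1 / p) * loss * l powr d * q) * N"
    by (simp add: osc_const_def)
  also have "2 ^ CARD('n) * (2 * sqrt ?n) ^ CARD('n) * ?n ^ CARD('n) * ?n ^ CARD('n)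
      = (2 * (2 * sqrt ?n) * ?n * ?n) ^ CARD('n)"
    by (simp only: power_mult_distrib)
  finally show ?thesis .
qed

end

section \<open>Truncation\<close>

context dyadic_cube
begin

definition energy :: "(real ^ 'n \<Rightarrow> real) \<Rightarrow> ennreal" where
  "energy u = double_integral M Q (frac_kernel d p u)"

definition poincare_const :: real where
  "poincare_const = 576 * (2 * (2 * sqrt (real CARD('n))) * real CARD('n) * real CARD('n)) ^ CARD('n) *
    (W powr (1 / p) * (1 - d) powr (1 / p) * loss * l powr d * q)"

lemma poincare_const_nonneg: "0 \<le> poincare_const"
  unfolding poincare_const_def using pq p1 loss_ge_1 by simp

lemma energy_mono:
  assumes "\<And>x y. \<bar>u x - u y\<bar> \<le> \<bar>v x - v y\<bar>"
  shows "energy u \<le> energy v"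
  unfolding energy_def using p1 assms
  by (intro nn_integral_mono mult_right_mono ennreal_leI divide_right_mono powr_mono2) auto

lemma weak_bounded:
  assumes u [measurable]: "u \<in> borel_measurable borel" and F: "\<And>x. \<bar>u x\<bar> \<le> F"
    and N: "0 \<le> N" "energy u \<le> ennreal (N powr p * mQ)"
  shows "\<exists>c. \<forall>t>0. measure M {x \<in> Q. t \<le> \<bar>u x - c\<bar>} \<le> mQ * (poincare_const * N / t) powr q"
proof -
  interpret dyadic_function M a l p W q d u F
    by unfold_locales (use u F in auto)
  have en: "energy u = (\<integral>\<^sup>+x\<in>Q. dens x \<partial>M)"
    by (simp add: energy_def dens_def kern_def)
  have bound: "measure M {x \<in> Q. t \<le> \<bar>u x - mean 0 a\<bar>} \<le> mQ * (poincare_const * N' / t) powr q"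
    if t: "0 < t" and N': "0 < N'" "N \<le> N'" for t N'
  proof -
    have "energy u \<le> ennreal (N' powr p * mQ)"
      using N N' p1 by (elim order_trans) (auto intro!: ennreal_leI mult_right_mono powr_mono2)
    then have "emeasure M {x \<in> Q. t \<le> \<bar>u x - mean 0 a\<bar>} \<le> ennreal (mQ * (poincare_const * N' / t) powr q)"
      unfolding poincare_const_def using weak_inequality[OF N'(1) _ t] by (simp add: en)
    then show ?thesis by (simp add: emeasure_M)
  qed
  \<comment> \<open>\<open>weak_inequality\<close> asks for a positive \<open>N\<close>; zero energy
    is reached by letting larger values decrease to \<open>N\<close>, with the same constant
    \<open>mean 0 a\<close> throughout.\<close>
  have "measure M {x \<in> Q. t \<le> \<bar>u x - mean 0 a\<bar>} \<le> mQ * (poincare_const * N / t) powr q" if t: "0 < t" for t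
  proof (rule LIMSEQ_le_const)
    show "(\<lambda>k. mQ * (poincare_const * (N + 1 / real (Suc k)) / t) powr q) \<longlonglongrightarrow> mQ * (poincare_const * N / t) powr q"
    proof -
      have "(\<lambda>k. mQ * (poincare_const * (N + 1 / real (Suc k)) / t) powr q) \<longlonglongrightarrow> mQ * (poincare_const * (N + 0) / t) powr q"
        using t N p1 pq poincare_const_nonneg
        by (intro tendsto_mult tendsto_const tendsto_powr' tendsto_divide tendsto_add LIMSEQ_inverse_real_of_nat[unfolded inverse_eq_divide])
          (auto intro!: always_eventually divide_nonneg_nonneg mult_nonneg_nonneg)
      then show ?thesis by simp
    qed
    show "\<exists>k0. \<forall>k\<ge>k0. measure M {x \<in> Q. t \<le> \<bar>u x - mean 0 a\<bar>} \<le> mQ * (poincare_const * (N + 1 / real (Suc k)) / t) powr q"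
      using bound[OF t] N by (auto simp: add_nonneg_pos)
  qed
  then show ?thesis by blast
qed

text \<open>A median rather than the mean: both the positive and the negative part of f - c then
  vanish on half of the mass, which anchors the truncations.\<close>

lemma median:
  fixes f :: "real ^ 'n \<Rightarrow> real"
  assumes f [measurable]: "f \<in> borel_measurable borel"
  shows "\<exists>c. mQ / 2 \<le> measure M {x \<in> Q. f x \<le> c} \<and> mQ / 2 \<le> measure M {x \<in> Q. c \<le> f x}"
proof -
  interpret finite_measure M by (rule finite_M)
  define h where "h t = measure M {x \<in> Q. f x \<le> t}" for t :: real
  have h_mono: "h s \<le> h t" if "s \<le> t" for s t
    unfolding h_def using that by (intro finite_measure_mono) auto
  have "(\<lambda>k. h (real k)) \<longlonglongrightarrow> measure M (\<Union>k. {x \<in> Q. f x \<le> real k})"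
    unfolding h_def by (intro finite_Lim_measure_incseq) (auto simp: incseq_def)
  also have "(\<Union>k. {x \<in> Q. f x \<le> real k}) = Q" using real_arch_simple by auto
  finally have "\<forall>\<^sub>F k in sequentially. mQ / 2 < h (real k)"
    by (rule order_tendstoD) (use mQ_pos in simp)
  then obtain k1 :: nat where k1: "mQ / 2 < h (real k1)" by (auto simp: eventually_sequentially)
  have "(\<lambda>k. h (- real k)) \<longlonglongrightarrow> measure M (\<Inter>k. {x \<in> Q. f x \<le> - real k})"
    unfolding h_def by (intro finite_Lim_measure_decseq) (auto simp: decseq_def)
  also have "(\<Inter>k. {x \<in> Q. f x \<le> - real k}) = {}"
  proof -
    have "\<exists>k. \<not> f x \<le> - real k" for x using reals_Archimedean2[of "- f x"] by (auto simp: not_le)  (metis minus_less_iff)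
    then show ?thesis by auto
  qed
  finally have "(\<lambda>k. h (- real k)) \<longlonglongrightarrow> 0" by simp
  then have "\<forall>\<^sub>F k in sequentially. h (- real k) < mQ / 2"
    by (rule order_tendstoD) (use mQ_pos in simp)
  then obtain k2 :: nat where k2: "h (- real k2) < mQ / 2" by (auto simp: eventually_sequentially)
  define T where "T = {t. mQ / 2 \<le> h t}"
  have T: "T \<noteq> {}" "bdd_below T"
  proof -
    show "T \<noteq> {}" using k1 by (auto simp: T_def intro: less_imp_le)
    show "bdd_below T"
    proof (rule bdd_belowI)
      fix t assume "t \<in> T"
      then show "- real k2 \<le> t" using k2 h_mono[of t "- real k2"] by (force simp: T_def)
    qed
  qed
  \<comment> \<open>The least point at which the distribution function reaches half of the mass:
    continuity from above gives the first inequality, approximation from below the second.\<close>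
  define c where "c = Inf T"
  have "mQ / 2 \<le> measure M {x \<in> Q. f x \<le> c}"
  proof (rule LIMSEQ_le_const)
    have "(\<lambda>k. h (c + 1 / real (Suc k))) \<longlonglongrightarrow> measure M (\<Inter>k. {x \<in> Q. f x \<le> c + 1 / real (Suc k)})"
      unfolding h_def
      by (intro finite_Lim_measure_decseq) (auto simp: decseq_def frac_le elim!: order_trans)
    also have "(\<Inter>k. {x \<in> Q. f x \<le> c + 1 / real (Suc k)}) = {x \<in> Q. f x \<le> c}"
    proof (safe)
      fix x assume "x \<in> (\<Inter>k. {x \<in> Q. f x \<le> c + 1 / real (Suc k)})"
      then have "f x \<le> c + 1 / real (Suc k)" for k by auto
      moreover have "(\<lambda>k. c + 1 / real (Suc k)) \<longlonglongrightarrow> c + 0"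
        by (intro tendsto_intros LIMSEQ_inverse_real_of_nat[unfolded inverse_eq_divide])
      ultimately show "f x \<le> c" by (auto intro: LIMSEQ_le_const)
    qed (auto intro: add_increasing2)
    finally show "(\<lambda>k. h (c + 1 / real (Suc k))) \<longlonglongrightarrow> measure M {x \<in> Q. f x \<le> c}" .
    have "mQ / 2 \<le> h (c + 1 / real (Suc k))" for k
    proof -
      have "Inf T < c + 1 / real (Suc k)" by (simp add: c_def)
      then obtain t where "t \<in> T" "t < c + 1 / real (Suc k)" using T by (auto simp: cInf_less_iff)
      then show ?thesis using h_mono[of t "c + 1 / real (Suc k)"] by (auto simp: T_def)
    qed
    then show "\<exists>k0. \<forall>k\<ge>k0. mQ / 2 \<le> h (c + 1 / real (Suc k))" by auto
  qed
  moreover have "measure M {x \<in> Q. f x < c} \<le> mQ / 2"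
  proof (rule LIMSEQ_le_const2)
    have "(\<lambda>k. h (c - 1 / real (Suc k))) \<longlonglongrightarrow> measure M (\<Union>k. {x \<in> Q. f x \<le> c - 1 / real (Suc k)})"
      unfolding h_def
      by (intro finite_Lim_measure_incseq) (auto simp: incseq_def frac_le elim!: order_trans)
    also have "(\<Union>k. {x \<in> Q. f x \<le> c - 1 / real (Suc k)}) = {x \<in> Q. f x < c}"
    proof safe
      fix x k assume "f x \<le> c - 1 / real (Suc k)"
      moreover have "0 < 1 / real (Suc k)" by simp
      ultimately show "f x < c" by linarith
    next
      fix x assume x: "x \<in> Q" "f x < c"
      then obtain k where "inverse (real (Suc k)) < c - f x" using reals_Archimedean[of "c - f x"] by auto
      then have "f x \<le> c - 1 / real (Suc k)" by (simp add: inverse_eq_divide)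
      then show "x \<in> (\<Union>k. {x \<in> Q. f x \<le> c - 1 / real (Suc k)})" using x by blast
    qed
    finally show "(\<lambda>k. h (c - 1 / real (Suc k))) \<longlonglongrightarrow> measure M {x \<in> Q. f x < c}" .
    have "h (c - 1 / real (Suc k)) \<le> mQ / 2" for k
    proof (rule ccontr)
      assume "\<not> h (c - 1 / real (Suc k)) \<le> mQ / 2"
      then have "c - 1 / real (Suc k) \<in> T" by (simp add: T_def)
      then have "c \<le> c - 1 / real (Suc k)" unfolding c_def using T(2) by (rule cInf_lower)
      moreover have "0 < 1 / real (Suc k)" by simp
      ultimately show False by linarith
    qed
    then show "\<exists>k0. \<forall>k\<ge>k0. h (c - 1 / real (Suc k)) \<le> mQ / 2" by auto
  qed
  moreover have "measure M {x \<in> Q. c \<le> f x} = mQ - measure M {x \<in> Q. f x < c}"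
  proof -
    have "{x \<in> Q. c \<le> f x} = Q - {x \<in> Q. f x < c}" by auto
    then show ?thesis by (simp add: finite_measure_Diff)
  qed
  ultimately show ?thesis by (intro exI[of _ c]) auto
qed

text \<open>The layer of \<open>u\<close> between tau and 2 tau equals 0 where \<open>u\<close>
  vanishes and tau where u \<ge> 2 tau. Whatever constant the weak estimate supplies, it is at least
  tau/2 away from one of these values. If that value is 0, the deviation set carries half of the
  mass and the bound exceeds that of all of Q.\<close>

lemma truncation_level:
  assumes u [measurable]: "u \<in> borel_measurable borel" and u0: "\<And>x. 0 \<le> u x"
    and half: "mQ / 2 \<le> measure M {x \<in> Q. u x = 0}"
    and tau: "0 < tau"
    and N: "0 \<le> N" "energy (\<lambda>x. min (u x) (2 * tau) - min (u x) tau) \<le> ennreal (N powr p * mQ)"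
  shows "measure M {x \<in> Q. 2 * tau \<le> u x} \<le> 2 * mQ * (2 * poincare_const * N / tau) powr q"
proof -
  interpret finite_measure M by (rule finite_M)
  define v where "v x = min (u x) (2 * tau) - min (u x) tau" for x
  have [measurable]: "v \<in> borel_measurable borel" unfolding v_def by measurable
  have "\<bar>v x\<bar> \<le> tau" for x using u0[of x] tau by (auto simp: v_def min_def)
  then obtain c where c: "\<And>t. 0 < t \<Longrightarrow> measure M {x \<in> Q. t \<le> \<bar>v x - c\<bar>} \<le> mQ * (poincare_const * N / t) powr q"
    using weak_bounded[of v tau N] N by (auto simp: v_def[abs_def])
  have eq: "poincare_const * N / (tau / 2) = 2 * poincare_const * N / tau" by simp
  define R where "R = mQ * (2 * poincare_const * N / tau) powr q"
  have R: "measure M {x \<in> Q. tau / 2 \<le> \<bar>v x - c\<bar>} \<le> R" "0 \<le> R"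
    using c[of "tau / 2"] tau unfolding eq R_def by simp_all
  have "measure M {x \<in> Q. 2 * tau \<le> u x} \<le> 2 * R"
  proof (cases "tau / 2 \<le> c")
    case True
    have "measure M {x \<in> Q. u x = 0} \<le> measure M {x \<in> Q. tau / 2 \<le> \<bar>v x - c\<bar>}"
      using True tau by (intro finite_measure_mono) (auto simp: v_def)
    then have "mQ \<le> 2 * R" using half R by linarith
    moreover have "measure M {x \<in> Q. 2 * tau \<le> u x} \<le> mQ" by (intro finite_measure_mono) auto
    ultimately show ?thesis by linarith
  next
    case False
    have "measure M {x \<in> Q. 2 * tau \<le> u x} \<le> measure M {x \<in> Q. tau / 2 \<le> \<bar>v x - c\<bar>}"
      using False tau by (intro finite_measure_mono) (auto simp: v_def)
    then show ?thesis using R by linarith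
  qed
  then show ?thesis by (simp add: R_def)
qed

text \<open>Every layer is monotone, so the layer differences have one sign and telescope to at most
  |x - y|; for p \<ge> 1 a sum of p-th powers is at most the p-th power of the sum.\<close>

lemma truncation_powr_sum:
  fixes x y sg :: real
  assumes "0 < sg"
  shows "(\<Sum>j<m. \<bar>(min x (2 * (2 ^ j * sg)) - min x (2 ^ j * sg)) - (min y (2 * (2 ^ j * sg)) - min y (2 ^ j * sg))\<bar> powr p)
    \<le> \<bar>x - y\<bar> powr p"
proof -
  let ?g = "\<lambda>j x. min x (2 * (2 ^ j * sg)) - min x (2 ^ j * sg)"
  have *: "(\<Sum>j<m. \<bar>?g j x - ?g j y\<bar> powr p) \<le> (y - x) powr p" if le: "x \<le> y" for x y :: real
  proof -
    define b where "b j = ?g j y - ?g j x" for j :: nat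
    have b0: "0 \<le> b j" for j
    proof -
      have "0 < 2 ^ j * sg" using assms by simp
      then show ?thesis using le unfolding b_def min_def by (smt (verit))
    qed
    define S where "S = (\<Sum>j<m. b j)"
    have "S = (\<Sum>j<m. (min y (2 ^ Suc j * sg) - min x (2 ^ Suc j * sg)) - (min y (2 ^ j * sg) - min x (2 ^ j * sg)))"
      unfolding S_def b_def by (intro sum.cong) (auto simp: mult.assoc)
    also have "\<dots> = (min y (2 ^ m * sg) - min x (2 ^ m * sg)) - (min y (2 ^ 0 * sg) - min x (2 ^ 0 * sg))"
      by (rule sum_lessThan_telescope)
    also have "\<dots> \<le> y - x" using le by (simp add: min_def)
    finally have S: "S \<le> y - x" .
    have S0: "0 \<le> S" unfolding S_def by (intro sum_nonneg b0)
    have b_le: "b j \<le> S" if "j < m" for j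
      unfolding S_def using that b0 by (intro member_le_sum) auto
    have "(\<Sum>j<m. b j powr p) \<le> (\<Sum>j<m. b j * S powr (p - 1))"
    proof (intro sum_mono)
      fix j assume j: "j \<in> {..<m}"
      have "b j powr p = b j * b j powr (p - 1)"
        using b0[of j] by (cases "b j = 0") (auto simp: powr_diff)
      also have "\<dots> \<le> b j * S powr (p - 1)"
        using b0 b_le j p1 by (intro mult_left_mono powr_mono2) auto
      finally show "b j powr p \<le> b j * S powr (p - 1)" .
    qed
    also have "\<dots> = S * S powr (p - 1)" by (simp add: S_def sum_distrib_right)
    also have "\<dots> = S powr p" using S0 by (cases "S = 0") (auto simp: powr_diff)
    also have "\<dots> \<le> (y - x) powr p" using S S0 p1 by (intro powr_mono2) auto
    finally show ?thesis by (simp add: b_def abs_minus_commute[of "min x _ - min x _"] abs_of_nonneg[OF b0, unfolded b_def])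
  qed
  show ?thesis
  proof (cases "x \<le> y")
    case True
    then show ?thesis using *[of x y] by (simp only: abs_minus_commute[of x y] abs_of_nonneg[of "y - x"] diff_ge_0_iff_ge)
  next
    case False
    then have "y \<le> x" by simp
    from *[OF this] have "(\<Sum>j<m. \<bar>?g j x - ?g j y\<bar> powr p) \<le> (x - y) powr p"
      by (subst abs_minus_commute)
    then show ?thesis using \<open>y \<le> x\<close> by (simp only: abs_of_nonneg[of "x - y"] diff_ge_0_iff_ge)
  qed
qed

text \<open>On each level tau^q cancels against the weak estimate of the layer and leaves E^(q/p),
  with E the energy of the layer. As q \<ge> p, these add up to at most the total energy to the
  power q/p.\<close>

lemma truncated_strong:
  assumes u [measurable]: "u \<in> borel_measurable borel" and u0: "\<And>x. 0 \<le> u x"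
    and half: "mQ / 2 \<le> measure M {x \<in> Q. u x = 0}"
    and sg: "0 < sg"
    and N: "0 \<le> N" "energy u \<le> ennreal (N powr p * mQ)"
  shows "(\<integral>\<^sup>+x\<in>{x \<in> Q. 2 * sg \<le> u x \<and> u x < 2 * (2 ^ m * sg)}. ennreal (u x powr q) \<partial>M)
    \<le> ennreal (2 * mQ * (8 * poincare_const * N) powr q)"
proof -
  have q1: "1 \<le> q" using p1 pq by simp
  define tau where "tau j = 2 ^ j * sg" for j :: nat
  have tau: "0 < tau j" for j using sg by (simp add: tau_def)
  define v where "v j x = min (u x) (2 * tau j) - min (u x) (tau j)" for j x
  have [measurable]: "v j \<in> borel_measurable borel" for j unfolding v_def by measurable
  define k where "k w x y = frac_kernel d p w x y * indicator Q y * indicator Q x"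
    for w :: "real ^ 'n \<Rightarrow> real" and x y
  have k_meas [measurable]: "case_prod (k w) \<in> borel_measurable (borel \<Otimes>\<^sub>M lborel)" if [measurable]: "w \<in> borel_measurable borel" for w
    unfolding k_def split_def by measurable
  have energy_k: "energy w = (\<integral>\<^sup>+x. (\<integral>\<^sup>+y. k w x y \<partial>lborel) \<partial>M)" for w
    unfolding energy_def k_def by (intro nn_integral_cong) (auto split: split_indicator)
  have energy_sum: "(\<Sum>j<m. energy (v j)) \<le> ennreal (N powr p * mQ)"
  proof -
    have [measurable]: "case_prod (k (v j)) \<in> borel_measurable (borel \<Otimes>\<^sub>M lborel)" for j by (rule k_meas) simp
    have "(\<Sum>j<m. energy (v j)) = (\<integral>\<^sup>+x. (\<integral>\<^sup>+y. (\<Sum>j<m. k (v j) x y) \<partial>lborel) \<partial>M)"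
      by (simp add: energy_k nn_integral_sum)
    also have "\<dots> \<le> (\<integral>\<^sup>+x. (\<integral>\<^sup>+y. k u x y \<partial>lborel) \<partial>M)"
    proof (intro nn_integral_mono)
      fix x y
      have "(\<Sum>j<m. \<bar>v j x - v j y\<bar> powr p / norm (x - y) powr (real CARD('n) + d * p))
          \<le> \<bar>u x - u y\<bar> powr p / norm (x - y) powr (real CARD('n) + d * p)"
        unfolding sum_divide_distrib[symmetric] v_def tau_def
        by (intro divide_right_mono truncation_powr_sum sg) auto
      then have "(\<Sum>j<m. ennreal (\<bar>v j x - v j y\<bar> powr p / norm (x - y) powr (real CARD('n) + d * p)))
          \<le> frac_kernel d p u x y"
        by (simp add: ennreal_leI)
      then show "(\<Sum>j<m. k (v j) x y) \<le> k u x y"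
        unfolding k_def sum_distrib_right[symmetric] by (intro mult_right_mono) auto
    qed
    also have "\<dots> = energy u" by (simp add: energy_k)
    finally show ?thesis using N(2) by (rule order_trans)
  qed
  \<comment> \<open>Normalised by the mass of Q, so that \<open>E j powr (1 / p)\<close> takes the
    role of \<open>N\<close> for the layer.\<close>
  define E where "E j = enn2real (energy (v j)) / mQ" for j
  have E0: "0 \<le> E j" for j using mQ_pos by (simp add: E_def)
  have E_eq: "energy (v j) = ennreal (E j * mQ)" if "j < m" for j
  proof -
    have "energy (v j) \<le> (\<Sum>j<m. energy (v j))" using that by (intro member_le_sum) auto
    also note energy_sum
    finally have "energy (v j) < \<infinity>" by (rule le_less_trans) simp
    then show ?thesis using mQ_pos by (simp add: E_def)
  qed
  have E_sum: "(\<Sum>j<m. E j) \<le> N powr p"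
  proof -
    have "(\<Sum>j<m. energy (v j)) = (\<Sum>j<m. ennreal (E j * mQ))" by (intro sum.cong) (auto simp: E_eq)
    also have "\<dots> = ennreal (\<Sum>j<m. E j * mQ)" using E0 by (intro sum_ennreal) auto
    finally have "ennreal (\<Sum>j<m. E j * mQ) \<le> ennreal (N powr p * mQ)" using energy_sum by simp
    then have "(\<Sum>j<m. E j * mQ) \<le> N powr p * mQ" by (subst (asm) ennreal_le_iff) auto
    then show ?thesis using mQ_pos by (simp flip: sum_distrib_right)
  qed
  have level: "measure M {x \<in> Q. 2 * tau j \<le> u x} \<le> 2 * mQ * (2 * poincare_const * E j powr (1 / p) / tau j) powr q"
    if "j < m" for j
  proof (rule truncation_level[OF u u0 half tau])
    show "energy (\<lambda>x. min (u x) (2 * tau j) - min (u x) (tau j)) \<le> ennreal ((E j powr (1 / p)) powr p * mQ)"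
      using E_eq[OF that] E0[of j] p1 by (simp add: v_def[abs_def] powr_powr)
  qed simp_all
  have pointwise: "ennreal (u x powr q) * indicator {x \<in> Q. 2 * sg \<le> u x \<and> u x < 2 * (2 ^ m * sg)} x
      \<le> (\<Sum>j<m. ennreal ((4 * tau j) powr q) * indicator {x \<in> Q. 2 * tau j \<le> u x} x)" for x
  proof (cases "x \<in> {x \<in> Q. 2 * sg \<le> u x \<and> u x < 2 * (2 ^ m * sg)}")
    case True
    have "\<exists>j<m. 2 * tau j \<le> u x \<and> u x \<le> 4 * tau j" if "2 * sg \<le> u x" "u x < 2 * (2 ^ m * sg)"
      using that
    proof (induction m)
      case (Suc m)
      show ?case
      proof (cases "u x < 2 * (2 ^ m * sg)")
        case True
        then show ?thesis using Suc less_SucI by blast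
      next
        case False
        then show ?thesis using Suc.prems by (intro exI[of _ m]) (auto simp: tau_def)
      qed
    qed simp
    then obtain j where j: "j < m" "2 * tau j \<le> u x" "u x \<le> 4 * tau j" using True by auto
    have "ennreal (u x powr q) \<le> ennreal ((4 * tau j) powr q) * indicator {x \<in> Q. 2 * tau j \<le> u x} x"
      using j u0 q1 True by (auto intro!: ennreal_leI powr_mono2)
    also have "\<dots> \<le> (\<Sum>j<m. ennreal ((4 * tau j) powr q) * indicator {x \<in> Q. 2 * tau j \<le> u x} x)"
      by (rule member_le_sum) (use j in auto)
    finally show ?thesis using True by simp
  qed simp
  have "(\<integral>\<^sup>+x\<in>{x \<in> Q. 2 * sg \<le> u x \<and> u x < 2 * (2 ^ m * sg)}. ennreal (u x powr q) \<partial>M)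
      \<le> (\<integral>\<^sup>+x. (\<Sum>j<m. ennreal ((4 * tau j) powr q) * indicator {x \<in> Q. 2 * tau j \<le> u x} x) \<partial>M)"
    by (intro nn_integral_mono pointwise)
  also have "\<dots> = (\<Sum>j<m. \<integral>\<^sup>+x. ennreal ((4 * tau j) powr q) * indicator {x \<in> Q. 2 * tau j \<le> u x} x \<partial>M)"
    by (rule nn_integral_sum) measurable
  also have "\<dots> = (\<Sum>j<m. ennreal ((4 * tau j) powr q * measure M {x \<in> Q. 2 * tau j \<le> u x}))"
    by (intro sum.cong refl, subst nn_integral_cmult_indicator) (auto simp: emeasure_M ennreal_mult)
  also have "\<dots> \<le> (\<Sum>j<m. ennreal (2 * mQ * (8 * poincare_const) powr q * (E j * (N powr p) powr (q / p - 1))))"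
  proof (intro sum_mono ennreal_leI)
    fix j assume "j \<in> {..<m}"
    then have j: "j < m" by simp
    have "(4 * tau j) powr q * measure M {x \<in> Q. 2 * tau j \<le> u x}
        \<le> (4 * tau j) powr q * (2 * mQ * (2 * poincare_const * E j powr (1 / p) / tau j) powr q)"
      by (intro mult_left_mono level[OF j]) auto
    also have "\<dots> = 2 * mQ * ((4 * tau j) * (2 * poincare_const * E j powr (1 / p) / tau j)) powr q"
      using tau[of j] poincare_const_nonneg by (subst powr_mult) (auto intro!: divide_nonneg_pos)
    also have "(4 * tau j) * (2 * poincare_const * E j powr (1 / p) / tau j) = 8 * poincare_const * E j powr (1 / p)"
      using tau[of j] by simp
    also have "2 * mQ * (8 * poincare_const * E j powr (1 / p)) powr q
        = 2 * mQ * (8 * poincare_const) powr q * (E j powr (q / p))"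
      using poincare_const_nonneg by (simp add: powr_mult powr_powr)
    also have "E j powr (q / p) = E j * E j powr (q / p - 1)"
      using E0[of j] by (cases "E j = 0") (auto simp: powr_diff)
    also have "2 * mQ * (8 * poincare_const) powr q * (E j * E j powr (q / p - 1))
        \<le> 2 * mQ * (8 * poincare_const) powr q * (E j * (N powr p) powr (q / p - 1))"
    proof (intro mult_left_mono powr_mono2)
      have "E j \<le> (\<Sum>j<m. E j)" using j E0 by (intro member_le_sum) auto
      then show "E j \<le> N powr p" using E_sum by simp
    qed (use E0 pq p1 in auto)
    finally show "(4 * tau j) powr q * measure M {x \<in> Q. 2 * tau j \<le> u x}
        \<le> 2 * mQ * (8 * poincare_const) powr q * (E j * (N powr p) powr (q / p - 1))" .
  qed
  also have "\<dots> = ennreal (2 * mQ * (8 * poincare_const) powr q * ((\<Sum>j<m. E j) * (N powr p) powr (q / p - 1)))"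
    using E0 by (subst sum_ennreal) (auto simp: sum_distrib_left sum_distrib_right)
  also have "\<dots> \<le> ennreal (2 * mQ * (8 * poincare_const) powr q * (N powr p * (N powr p) powr (q / p - 1)))"
    by (intro ennreal_leI mult_left_mono mult_right_mono E_sum) auto
  also have "N powr p * (N powr p) powr (q / p - 1) = N powr q"
    using N p1 by (cases "N = 0") (auto simp: powr_powr algebra_simps simp flip: powr_add)
  also have "2 * mQ * (8 * poincare_const) powr q * N powr q = 2 * mQ * (8 * poincare_const * N) powr q"
    using N poincare_const_nonneg by (simp add: powr_mult)
  finally show ?thesis .
qed

lemma nonneg_strong:
  assumes u [measurable]: "u \<in> borel_measurable borel" and u0: "\<And>x. 0 \<le> u x"
    and half: "mQ / 2 \<le> measure M {x \<in> Q. u x = 0}"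
    and N: "0 \<le> N" "energy u \<le> ennreal (N powr p * mQ)"
  shows "(\<integral>\<^sup>+x\<in>Q. ennreal (u x powr q) \<partial>M) \<le> ennreal (2 * mQ * (8 * poincare_const * N) powr q)"
proof -
  have q1: "1 \<le> q" using p1 pq by simp
  \<comment> \<open>Lowest level 2^(-J) and 2J layers: these sets exhaust the points of Q where
    \<open>u\<close> is positive.\<close>
  define A where "A J = {x \<in> Q. 2 * (1 / 2) ^ J \<le> u x \<and> u x < 2 * (2 ^ (2 * J) * (1 / 2) ^ J)}" for J :: nat
  have A_eq: "A J = {x \<in> Q. 2 * (1 / 2) ^ J \<le> u x \<and> u x < 2 * 2 ^ J}" for J
  proof -
    have "2 ^ (2 * J) * (1 / 2) ^ J = (4 * (1 / 2) :: real) ^ J"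
      unfolding power_mult_distrib by (simp add: power_mult)
    then show ?thesis unfolding A_def by simp
  qed
  have [measurable]: "A J \<in> sets borel" for J unfolding A_def by measurable
  have A_mono: "A i \<subseteq> A j" if "i \<le> j" for i j
  proof -
    have le: "(1 / 2) ^ j \<le> (1 / 2 :: real) ^ i" "2 ^ i \<le> (2 :: real) ^ j"
      using that by (auto intro: power_decreasing power_increasing)
    show ?thesis
    proof
      fix x assume "x \<in> A i"
      then have "x \<in> Q" "2 * (1 / 2) ^ i \<le> u x" "u x < 2 * 2 ^ i" by (simp_all add: A_eq)
      with le show "x \<in> A j" unfolding A_eq by (intro CollectI conjI) linarith+
    qed
  qed
  have "ennreal (u x powr q) * indicator Q x = (SUP J. ennreal (u x powr q) * indicator (A J) x)" for x
  proof (cases "x \<in> Q \<and> 0 < u x")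
    case True
    obtain J1 :: nat where J1: "(1 / 2) ^ J1 < u x / 2"
      using real_arch_pow_inv[of "u x / 2" "1 / 2"] True by auto
    obtain J2 :: nat where J2: "u x / 2 < 2 ^ J2" using real_arch_pow[of 2 "u x / 2"] by auto
    define J where "J = max J1 J2"
    have "(1 / 2) ^ J \<le> (1 / 2 :: real) ^ J1" "2 ^ J2 \<le> (2 :: real) ^ J"
      by (auto simp: J_def intro: power_decreasing power_increasing)
    with J1 J2 True have J: "x \<in> A J" unfolding A_eq by (intro CollectI conjI) linarith+
    show ?thesis
    proof (rule antisym)
      show "ennreal (u x powr q) * indicator Q x \<le> (SUP J. ennreal (u x powr q) * indicator (A J) x)"
        using J True by (intro SUP_upper2[of J]) auto
      show "(SUP J. ennreal (u x powr q) * indicator (A J) x) \<le> ennreal (u x powr q) * indicator Q x"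
        using True by (intro SUP_least) (auto simp: indicator_def)
    qed
  next
    case False
    then have "x \<notin> Q \<or> u x = 0" using u0[of x] by (auto simp: less_le)
    then show ?thesis using q1 by (auto simp: A_def)
  qed
  then have "(\<integral>\<^sup>+x\<in>Q. ennreal (u x powr q) \<partial>M) = (\<integral>\<^sup>+x. (SUP J. ennreal (u x powr q) * indicator (A J) x) \<partial>M)"
    by simp
  also have "\<dots> = (SUP J. \<integral>\<^sup>+x\<in>A J. ennreal (u x powr q) \<partial>M)"
  proof (rule nn_integral_monotone_convergence_SUP)
    show "incseq (\<lambda>J x. ennreal (u x powr q) * indicator (A J) x)"
      using A_mono[OF le_SucI[OF order_refl]] by (intro incseq_SucI le_funI mult_left_mono) (auto split: split_indicator)
  qed measurable
  also have "\<dots> \<le> ennreal (2 * mQ * (8 * poincare_const * N) powr q)"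
    unfolding A_def by (intro SUP_least truncated_strong u u0 half N) simp_all
  finally show ?thesis .
qed

lemma poincare_sobolev:
  assumes f [measurable]: "f \<in> borel_measurable borel"
    and N: "0 \<le> N" "energy f \<le> ennreal (N powr p * mQ)"
  shows "\<exists>c. (\<integral>\<^sup>+x\<in>Q. ennreal (\<bar>f x - c\<bar> powr q) \<partial>M) \<le> ennreal (mQ * (32 * poincare_const * N) powr q)"
proof -
  have q1: "1 \<le> q" using p1 pq by simp
  obtain c where c: "mQ / 2 \<le> measure M {x \<in> Q. f x \<le> c}" "mQ / 2 \<le> measure M {x \<in> Q. c \<le> f x}"
    using median[OF f] by auto
  define u where "u x = max (f x - c) 0" for x
  define v where "v x = max (c - f x) 0" for x
  have [measurable]: "u \<in> borel_measurable borel" "v \<in> borel_measurable borel"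
    unfolding u_def v_def by measurable
  have "{x \<in> Q. u x = 0} = {x \<in> Q. f x \<le> c}" "{x \<in> Q. v x = 0} = {x \<in> Q. c \<le> f x}"
    by (auto simp: u_def v_def)
  then have half: "mQ / 2 \<le> measure M {x \<in> Q. u x = 0}" "mQ / 2 \<le> measure M {x \<in> Q. v x = 0}"
    using c by simp_all
  have "energy u \<le> energy f" "energy v \<le> energy f"
    by (auto intro!: energy_mono simp: u_def v_def)
  then have en: "energy u \<le> ennreal (N powr p * mQ)" "energy v \<le> ennreal (N powr p * mQ)"
    using N(2) by auto
  define R where "R = 2 * mQ * (8 * poincare_const * N) powr q"
  have R: "(\<integral>\<^sup>+x\<in>Q. ennreal (u x powr q) \<partial>M) \<le> ennreal R" "(\<integral>\<^sup>+x\<in>Q. ennreal (v x powr q) \<partial>M) \<le> ennreal R"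
    unfolding R_def by (intro nonneg_strong half en N(1); simp add: u_def v_def)+
  have "(\<integral>\<^sup>+x\<in>Q. ennreal (\<bar>f x - c\<bar> powr q) \<partial>M)
      = (\<integral>\<^sup>+x. ennreal (u x powr q) * indicator Q x + ennreal (v x powr q) * indicator Q x \<partial>M)"
    using q1 by (intro nn_integral_cong) (auto simp: u_def v_def max_def abs_if split: split_indicator)
  also have "\<dots> = (\<integral>\<^sup>+x\<in>Q. ennreal (u x powr q) \<partial>M) + (\<integral>\<^sup>+x\<in>Q. ennreal (v x powr q) \<partial>M)"
    by (rule nn_integral_add) measurable
  also have "\<dots> \<le> ennreal R + ennreal R" by (intro add_mono R)
  also have "\<dots> = ennreal (mQ * (4 * (8 * poincare_const * N) powr q))"
    by (simp add: R_def flip: ennreal_plus)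
  \<comment> \<open>The two parts contribute 2 each; 4 \<le> 4^q goes under the power, whence 32 = 4
    * 8.\<close>
  also have "\<dots> \<le> ennreal (mQ * (4 powr q * (8 * poincare_const * N) powr q))"
    using q1 powr_mono[of 1 q 4] by (intro ennreal_leI mult_left_mono mult_right_mono) auto
  also have "4 powr q * (8 * poincare_const * N) powr q = (32 * poincare_const * N) powr q"
    using N poincare_const_nonneg by (subst powr_mult[symmetric]) (auto simp: mult.assoc)
  finally show ?thesis by blast
qed

end

section \<open>Muckenhoupt weights as averaging measures\<close>

text \<open>Neither the boundary of a cube nor the completion affects the integral.\<close>

lemma cube_integral_eq:
  assumes "0 < s"
  shows "(\<integral>\<^sup>+x\<in>cube b s. h x \<partial>lebesgue) = (\<integral>\<^sup>+x\<in>hcube b s. h x \<partial>lborel)"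
  unfolding nn_integral_completion using AE_hcube_cube[OF assms, of b]
  by (intro nn_integral_cong_AE) (auto elim!: eventually_mono simp: indicator_def)

lemma cube_measure_eq:
  "0 < s \<Longrightarrow> emeasure lebesgue (cube b s :: (real ^ 'n) set) = ennreal (s ^ CARD('n))"
  using emeasure_cube[of s b] by (simp add: cube_def)

lemma cube_in_cubes: "0 < s \<Longrightarrow> cube b s \<in> cubes"
  by (auto simp: cubes_def)

text \<open>The inclusion of A_r in A_p with the same constant: apply the property at
  \<open>r\<close> to g^(p/r), then Jensen with exponent p/r.\<close>

lemma averaging_mono:
  fixes M :: "(real ^ 'n) measure"
  assumes avg: "averaging M Q r R" and r: "1 \<le> r" "r \<le> p" and R: "0 \<le> R"
  shows "averaging M Q p R"
  unfolding averaging_def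
proof (intro allI impI conjI)
  fix b :: "real ^ 'n" and s
  assume s: "0 < s" "hcube b s \<subseteq> Q"
  show m: "0 < measure M (hcube b s)" by (rule averagingD(1)[OF avg s])
  fix g :: "real ^ 'n \<Rightarrow> real" and S
  assume g [measurable]: "g \<in> borel_measurable borel" and g0: "\<forall>x. 0 \<le> g x" and S: "0 \<le> S"
    "(\<integral>\<^sup>+x\<in>hcube b s. ennreal (g x powr p) \<partial>M) \<le> ennreal S"
  define V where "V = s ^ CARD('n)"
  define m where "m = measure M (hcube b s)"
  define S1 where "S1 = V * (R * S / m) powr (1 / r)"
  have V: "0 < V" using s by (simp add: V_def)
  have "(\<integral>\<^sup>+x\<in>hcube b s. ennreal (g x powr (p / r)) \<partial>lborel) \<le> ennreal S1"
    unfolding S1_def V_def m_def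
    by (rule averagingD(2)[OF avg s]) (use S r in \<open>auto simp: powr_powr\<close>)
  then have "(\<integral>\<^sup>+x\<in>hcube b s. ennreal (g x) \<partial>lborel) \<le> ennreal (V powr (1 - 1 / (p / r)) * S1 powr (1 / (p / r)))"
    using r s g0 V by (intro nn_integral_powr_Jensen) (auto simp: emeasure_hcube V_def S1_def)
  also have "V powr (1 - 1 / (p / r)) * S1 powr (1 / (p / r)) = V * (R * S / m) powr (1 / p)"
  proof -
    have "S1 powr (1 / (p / r)) = V powr (1 / (p / r)) * (R * S / m) powr (1 / p)"
      using V r R S m by (simp add: S1_def m_def powr_mult powr_powr)
    moreover have "V powr (1 - 1 / (p / r)) * V powr (1 / (p / r)) = V"
      using V by (simp flip: powr_add)
    ultimately show ?thesis by (metis mult.assoc)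
  qed
  finally show "(\<integral>\<^sup>+x\<in>hcube b s. ennreal (g x) \<partial>lborel)
    \<le> ennreal (s ^ CARD('n) * (R * S / measure M (hcube b s)) powr (1 / p))"
    by (simp add: V_def m_def)
qed

text \<open>The averaging property tested on the indicator of the subcube.\<close>

lemma averaging_subset_measure:
  fixes M :: "(real ^ 'n) measure"
  assumes sets_M [measurable_cong, simp]: "sets M = sets borel" and fin: "finite_measure M"
    and avg: "averaging M (hcube a l) r R" and r: "1 \<le> r" and R: "0 \<le> R"
    and l: "0 < l" and s: "0 < s" "hcube b s \<subseteq> hcube a l"
  shows "(s / l) powr (real CARD('n) * r) \<le> R * (measure M (hcube b s) / measure M (hcube a l))"
proof -
  interpret finite_measure M by (rule fin)
  define mP where "mP = measure M (hcube b s)"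
  define mQ where "mQ = measure M (hcube a l)"
  have mQ: "0 < mQ" unfolding mQ_def by (rule averagingD(1)[OF avg l]) simp
  have mP: "0 \<le> mP" by (simp add: mP_def)
  have "(\<integral>\<^sup>+x\<in>hcube a l. ennreal (indicator (hcube b s) x) \<partial>lborel)
      \<le> ennreal (l ^ CARD('n) * (R * mP / mQ) powr (1 / r))"
    unfolding mQ_def
  proof (rule averagingD(2)[OF avg l])
    have "(\<integral>\<^sup>+x\<in>hcube a l. ennreal (indicator (hcube b s) x powr r) \<partial>M) = (\<integral>\<^sup>+x. indicator (hcube b s) x \<partial>M)"
      using s r by (intro nn_integral_cong) (auto simp: indicator_def)
    also have "\<dots> = ennreal mP" by (simp add: emeasure_eq_measure mP_def)
    finally show "(\<integral>\<^sup>+x\<in>hcube a l. ennreal (indicator (hcube b s) x powr r) \<partial>M) \<le> ennreal mP" by simp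
  qed (use mP in auto)
  also have "(\<integral>\<^sup>+x\<in>hcube a l. ennreal (indicator (hcube b s) x) \<partial>lborel) = (\<integral>\<^sup>+x. indicator (hcube b s) x \<partial>lborel)"
    using s by (intro nn_integral_cong) (auto simp: indicator_def)
  also have "\<dots> = ennreal (s ^ CARD('n))" using s by (simp add: emeasure_hcube)
  finally have "s ^ CARD('n) \<le> l ^ CARD('n) * (R * mP / mQ) powr (1 / r)"
    using l by (subst (asm) ennreal_le_iff) auto
  then have "(s / l) ^ CARD('n) \<le> (R * mP / mQ) powr (1 / r)"
    using l by (simp add: power_divide field_simps)
  then have "((s / l) ^ CARD('n)) powr r \<le> ((R * mP / mQ) powr (1 / r)) powr r"
    using r s l by (intro powr_mono2) auto
  also have "\<dots> = R * mP / mQ" using R mP mQ r by (simp add: powr_powr)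
  also have "((s / l) ^ CARD('n)) powr r = (s / l) powr (real CARD('n) * r)"
    using s l by (simp add: powr_powr flip: powr_realpow)
  finally show ?thesis by (simp add: mP_def mQ_def)
qed

text \<open>Take the cube itself as the subcube.\<close>

lemma averaging_const_ge_1:
  fixes M :: "(real ^ 'n) measure"
  assumes "sets M = sets borel" "finite_measure M"
    and avg: "averaging M (hcube a l) r R" and r: "1 \<le> r" and R: "0 \<le> R" and l: "0 < l"
  shows "1 \<le> R"
  using averaging_subset_measure[OF assms l order_refl] averagingD(1)[OF avg l order_refl] l by simp

lemma hcube_subset_side_le:
  fixes a b :: "real ^ 'n"
  assumes l: "0 < l" and s: "0 < s" "hcube b s \<subseteq> hcube a l"
  shows "s \<le> l"
proof -
  have "emeasure lborel (hcube b s) \<le> emeasure lborel (hcube a l)"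
    by (intro emeasure_mono s) simp
  then have "s ^ CARD('n) \<le> l ^ CARD('n)"
    using l s by (simp add: emeasure_hcube)
  then show ?thesis using l s by (meson less_imp_le power_mono_iff zero_less_card_finite)
qed

text \<open>This explains the denominator r + log in the definition of q. The summand r gives n r
  \<open>eta\<close> \<le> d, so the volume bound raised to the power \<open>eta\<close> controls
  (s/l)^d; the summand \<open>ln R\<close> gives \<open>eta * ln R \<le> 1\<close>, so R^eta is at
  most e.\<close>

lemma averaging_decay:
  fixes M :: "(real ^ 'n) measure"
  assumes M: "sets M = sets borel" "finite_measure M"
    and avg: "averaging M (hcube a l) r R" and r: "1 \<le> r" and R: "1 \<le> R"
    and l: "0 < l" and s: "0 < s" "hcube b s \<subseteq> hcube a l" and d: "0 < d" "d < 1"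
    and eta: "eta = d / real CARD('n) * (1 / (r + ln R))"
  shows "(s / l) powr d \<le> exp 1 * (measure M (hcube b s) / measure M (hcube a l)) powr eta"
proof -
  define om where "om = measure M (hcube b s) / measure M (hcube a l)"
  have om: "0 < om"
    using averagingD(1)[OF avg s] averagingD(1)[OF avg l order_refl] by (simp add: om_def)
  have n: "1 \<le> real CARD('n)" by (simp add: Suc_le_eq)
  have lnR: "0 \<le> ln R" using R by simp
  have eta0: "0 < eta" unfolding eta using d n r lnR by (intro mult_pos_pos divide_pos_pos) linarith+
  have sl: "s / l \<le> 1" using hcube_subset_side_le[OF l s] l by simp
  have "real CARD('n) * r * eta = d * (r / (r + ln R))" using n by (simp add: eta)
  also have "\<dots> \<le> d * 1" using d r lnR by (intro mult_left_mono) (auto simp: divide_simps)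
  finally have "(s / l) powr d \<le> (s / l) powr (real CARD('n) * r * eta)"
    using sl s l by (intro powr_mono') auto
  also have "\<dots> = ((s / l) powr (real CARD('n) * r)) powr eta" by (simp add: powr_powr)
  also have "\<dots> \<le> (R * om) powr eta"
    using averaging_subset_measure[OF M avg r _ l s] R eta0 unfolding om_def by (intro powr_mono2) auto
  also have "\<dots> = R powr eta * om powr eta" using R om by (simp add: powr_mult)
  also have "\<dots> \<le> exp 1 * om powr eta"
  proof (rule mult_right_mono)
    have "eta * ln R \<le> d / real CARD('n) * 1"
      unfolding eta using d n r lnR by (subst mult.assoc, intro mult_left_mono) (auto simp: divide_simps)
    also have "\<dots> \<le> 1" using d n by (simp only: mult_1_right, subst divide_le_eq_1_pos) linarith+
    finally show "R powr eta \<le> exp 1" using R by (simp add: powr_def)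
  qed simp
  finally show ?thesis by (simp add: om_def)
qed

text \<open>A weight is only Lebesgue measurable and locally integrable; \<open>w'\<close> is an
  integrable Borel function agreeing with it almost everywhere on the cube, so that
  \<open>mu\<close> is a finite Borel measure.\<close>

locale borel_weight =
  fixes w w' :: "real ^ 'n \<Rightarrow> real" and a :: "real ^ 'n" and l :: real
  assumes l: "0 < l" and w'_borel [measurable]: "w' \<in> borel_measurable borel"
    and w'_nonneg: "\<And>x. 0 \<le> w' x" and w'_fin: "(\<integral>\<^sup>+x. ennreal (w' x) \<partial>lborel) < \<infinity>"
    and w'_eq: "AE x in lborel. x \<in> cube a l \<longrightarrow> w' x = w x \<and> 0 < w x"
begin

definition mu :: "(real ^ 'n) measure" where "mu = density lborel (\<lambda>x. ennreal (w' x))"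

lemma sets_mu [measurable_cong, simp]: "sets mu = sets borel"
  by (simp add: mu_def)

lemma finite_mu: "finite_measure mu"
proof (rule finite_measureI)
  have "emeasure mu (space mu) = (\<integral>\<^sup>+x. ennreal (w' x) \<partial>lborel)"
    by (simp add: mu_def emeasure_density)
  then show "emeasure mu (space mu) \<noteq> \<infinity>" using w'_fin by simp
qed

lemma emeasure_mu: "emeasure mu A = ennreal (measure mu A)"
  by (rule finite_measure.emeasure_eq_measure[OF finite_mu])

lemma AE_hcube:
  assumes "hcube b s \<subseteq> hcube a l"
  shows "AE x in lborel. x \<in> hcube b s \<longrightarrow> w' x = w x \<and> 0 < w x"
  using w'_eq by eventually_elim (use assms hcube_subset_cube in blast)

lemma integral_mu:
  assumes h [measurable]: "h \<in> borel_measurable borel" and s: "0 < s" "hcube b s \<subseteq> hcube a l"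
  shows "(\<integral>\<^sup>+x\<in>hcube b s. h x \<partial>mu) = (\<integral>\<^sup>+x\<in>cube b s. h x * ennreal (w x) \<partial>lebesgue)"
proof -
  have "(\<integral>\<^sup>+x\<in>hcube b s. h x \<partial>mu) = (\<integral>\<^sup>+x. ennreal (w' x) * (h x * indicator (hcube b s) x) \<partial>lborel)"
    unfolding mu_def by (rule nn_integral_density) measurable
  also have "\<dots> = (\<integral>\<^sup>+x\<in>hcube b s. h x * ennreal (w x) \<partial>lborel)"
    using AE_hcube[OF s(2)] by (intro nn_integral_cong_AE) (auto elim!: eventually_mono simp: indicator_def mult.commute)
  also have "\<dots> = (\<integral>\<^sup>+x\<in>cube b s. h x * ennreal (w x) \<partial>lebesgue)"
    by (rule cube_integral_eq[OF s(1), symmetric])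
  finally show ?thesis .
qed

lemma measure_mu:
  assumes s: "0 < s" "hcube b s \<subseteq> hcube a l"
  shows "ennreal (measure mu (hcube b s)) = (\<integral>\<^sup>+x\<in>cube b s. ennreal (w x) \<partial>lebesgue)"
  using integral_mu[OF _ s, of "\<lambda>_. 1"] by (simp add: emeasure_mu)

lemma measure_mu_pos:
  assumes s: "0 < s" "hcube b s \<subseteq> hcube a l"
  shows "0 < measure mu (hcube b s)"
proof (rule ccontr)
  assume "\<not> 0 < measure mu (hcube b s)"
  then have "emeasure mu (hcube b s) = 0"
    using measure_nonneg[of mu "hcube b s"] by (simp add: emeasure_mu)
  then have "(\<integral>\<^sup>+x. ennreal (w' x) * indicator (hcube b s) x \<partial>lborel) = 0"
    by (simp add: mu_def emeasure_density)
  then have "AE x in lborel. ennreal (w' x) * indicator (hcube b s) x = 0"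
    by (subst (asm) nn_integral_0_iff_AE) auto
  then have "AE x in lborel. x \<notin> hcube b s"
    using AE_hcube[OF s(2)] by eventually_elim (auto simp: indicator_def ennreal_eq_0_iff split: if_splits)
  then have "emeasure lborel (hcube b s) = 0" by (subst (asm) AE_iff_measurable[OF _ refl]) auto
  moreover have "0 < s ^ CARD('n)" using s by simp
  ultimately show False using s by (simp add: emeasure_hcube ennreal_eq_0_iff)
qed

text \<open>Hoelder for the factors g w^(1/p) and w^(-1/p): the dual power of the second is
  w^(1-p').\<close>

lemma Ap_averaging_gt_1:
  assumes p: "1 < p" and W: "Ap_const p w = ennreal W" "0 \<le> W"
  shows "averaging mu (hcube a l) p W"
  unfolding averaging_def
proof (intro allI impI conjI)
  fix b :: "real ^ 'n" and s
  assume s: "0 < s" "hcube b s \<subseteq> hcube a l"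
  show m: "0 < measure mu (hcube b s)" by (rule measure_mu_pos[OF s])
  fix g :: "real ^ 'n \<Rightarrow> real" and S
  assume g [measurable]: "g \<in> borel_measurable borel" and g0: "\<forall>x. 0 \<le> g x" and S: "0 \<le> S"
    "(\<integral>\<^sup>+x\<in>hcube b s. ennreal (g x powr p) \<partial>mu) \<le> ennreal S"
  let ?P = "hcube b s"
  define m where "m = measure mu ?P"
  define V where "V = s ^ CARD('n)"
  have V: "0 < V" using s by (simp add: V_def)
  have m: "0 < m" using m by (simp add: m_def)
  define Y where "Y = (\<integral>\<^sup>+x\<in>?P. ennreal (w' x powr (1 - p / (p - 1))) \<partial>lborel)"
  have Y: "(\<integral>\<^sup>+x\<in>cube b s. ennreal (w x powr (1 - p / (p - 1))) \<partial>lebesgue) = Y"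
    unfolding cube_integral_eq[OF s(1)] Y_def using AE_hcube[OF s(2)]
    by (intro nn_integral_cong_AE) (auto elim!: eventually_mono simp: indicator_def)
  have "ennreal m / ennreal V * ennreal_powr (Y / ennreal V) (p - 1) \<le> Ap_const p w"
  proof -
    have "ennreal m / ennreal V * ennreal_powr (Y / ennreal V) (p - 1)
      = ((\<integral>\<^sup>+x\<in>cube b s. ennreal (w x) \<partial>lebesgue) / emeasure lebesgue (cube b s)) *
        ennreal_powr
          ((\<integral>\<^sup>+x\<in>cube b s. ennreal (w x powr (1 - p / (p - 1))) \<partial>lebesgue) / emeasure lebesgue (cube b s)) (p - 1)"
      unfolding Y measure_mu[OF s, symmetric] cube_measure_eq[OF s(1)] m_def V_def ..
    also have "\<dots> \<le> Ap_const p w"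
      unfolding Ap_const_def using p by (auto intro!: SUP_upper cube_in_cubes[OF s(1)])
    finally show ?thesis .
  qed
  then have bound: "ennreal (m / V) * ennreal_powr (Y / ennreal V) (p - 1) \<le> ennreal W"
    using m V W by (simp add: divide_ennreal)
  \<comment> \<open>The mass of the subcube is positive, so an infinite dual integral would make the
    A_p product infinite.\<close>
  have "Y \<noteq> \<infinity>"
  proof
    assume "Y = \<infinity>"
    then have "Y / ennreal V = \<infinity>" by (simp add: ennreal_top_divide)
    then show False using bound m V by (simp add: ennreal_powr_def ennreal_mult_top top_unique)
  qed
  then obtain sg where sg: "Y = ennreal sg" "0 \<le> sg" by (cases Y) auto
  have "ennreal (m / V * (sg / V) powr (p - 1)) \<le> ennreal W"
    using bound sg m V by (subst ennreal_mult) (auto simp: divide_ennreal ennreal_powr_def)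
  then have "m / V * (sg / V) powr (p - 1) \<le> W" using W by (subst (asm) ennreal_le_iff) auto
  then have "(sg / V) powr (p - 1) \<le> W * V / m" using m V by (simp add: field_simps)
  then have sg_bound: "sg powr (p - 1) \<le> W * V powr p / m"
  proof -
    have "sg powr (p - 1) = (sg / V) powr (p - 1) * V powr (p - 1)" using sg V by (simp add: powr_divide)
    also have "\<dots> \<le> W * V / m * V powr (p - 1)" using \<open>(sg / V) powr (p - 1) \<le> W * V / m\<close> by (rule mult_right_mono) simp
    also have "\<dots> = W * (V powr 1 * V powr (p - 1)) / m" using V by simp
    also have "V powr 1 * V powr (p - 1) = V powr p" by (simp only: powr_add[symmetric]) simp
    finally show ?thesis .
  qed
  define u where "u x = g x * w' x powr (1 / p) * indicator ?P x" for x
  define v where "v x = w' x powr (- 1 / p) * indicator ?P x" for x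
  have [measurable]: "u \<in> borel_measurable lborel" "v \<in> borel_measurable lborel"
    unfolding u_def v_def by measurable
  have "(\<integral>\<^sup>+x\<in>?P. ennreal (g x) \<partial>lborel) = (\<integral>\<^sup>+x. ennreal (u x * v x) \<partial>lborel)"
  proof (intro nn_integral_cong_AE)
    show "AE x in lborel. ennreal (g x) * indicator ?P x = ennreal (u x * v x)"
      using AE_hcube[OF s(2)]
    proof eventually_elim
      case (elim x)
      show ?case
      proof (cases "x \<in> ?P")
        case True
        then have "w' x powr (1 / p) * w' x powr (- 1 / p) = 1"
          using elim by (simp flip: powr_add)
        then show ?thesis using True by (simp add: u_def v_def mult.assoc)
      qed (simp add: u_def v_def)
    qed
  qed
  also have "\<dots> \<le> ennreal (S powr (1 / p) * sg powr (1 - 1 / p))"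
  proof (rule nn_integral_Hoelder[OF p])
    have "(\<integral>\<^sup>+x. ennreal (u x powr p) \<partial>lborel) = (\<integral>\<^sup>+x. ennreal (w' x) * (ennreal (g x powr p) * indicator ?P x) \<partial>lborel)"
      using p g0 w'_nonneg
      by (intro nn_integral_cong) (auto simp: u_def powr_mult powr_powr ennreal_mult[symmetric] mult.commute indicator_def)
    also have "\<dots> = (\<integral>\<^sup>+x\<in>?P. ennreal (g x powr p) \<partial>mu)"
      unfolding mu_def by (rule nn_integral_density[symmetric]) measurable
    finally show "(\<integral>\<^sup>+x. ennreal (u x powr p) \<partial>lborel) \<le> ennreal S" using S by simp
    have "- 1 / p * (p / (p - 1)) = 1 - p / (p - 1)" using p by (simp add: field_simps)
    then have "(\<integral>\<^sup>+x. ennreal (v x powr (p / (p - 1))) \<partial>lborel) = Y"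
      unfolding Y_def v_def using p
      by (intro nn_integral_cong) (auto simp: powr_powr indicator_def)
    then show "(\<integral>\<^sup>+x. ennreal (v x powr (p / (p - 1))) \<partial>lborel) \<le> ennreal sg" using sg by simp
  qed (use S sg g0 in \<open>auto simp: u_def v_def\<close>)
  also have "\<dots> \<le> ennreal (V * (W * S / m) powr (1 / p))"
  proof (rule ennreal_leI)
    have "sg powr (1 - 1 / p) = (sg powr (p - 1)) powr (1 / p)" using p by (simp add: powr_powr field_simps)
    also have "\<dots> \<le> (W * V powr p / m) powr (1 / p)" using sg_bound p by (intro powr_mono2) auto
    also have "\<dots> = V * (W / m) powr (1 / p)" using W V m p by (simp add: powr_mult powr_divide powr_powr)
    finally have "S powr (1 / p) * sg powr (1 - 1 / p) \<le> S powr (1 / p) * (V * (W / m) powr (1 / p))"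
      by (rule mult_left_mono) simp
    also have "\<dots> = V * (W * S / m) powr (1 / p)" using W S m by (simp add: powr_mult powr_divide)
    finally show "S powr (1 / p) * sg powr (1 - 1 / p) \<le> V * (W * S / m) powr (1 / p)" .
  qed
  finally show "(\<integral>\<^sup>+x\<in>?P. ennreal (g x) \<partial>lborel) \<le> ennreal (s ^ CARD('n) * (W * S / measure mu ?P) powr (1 / p))"
    by (simp add: V_def m_def)
qed

text \<open>On the subcube the mean of \<open>w\<close> is at most its maximal function, hence at
  most C w almost everywhere; multiply by \<open>g\<close> and integrate.\<close>

lemma A1_averaging:
  assumes ex: "AE x in lebesgue. HL_maximal w x \<le> ennreal (C0 * w x)"
    and W: "A1_const w = ennreal W" "0 \<le> W"
  shows "averaging mu (hcube a l) 1 W"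
  unfolding averaging_def
proof (intro allI impI conjI)
  fix b :: "real ^ 'n" and s
  assume s: "0 < s" "hcube b s \<subseteq> hcube a l"
  show m: "0 < measure mu (hcube b s)" by (rule measure_mu_pos[OF s])
  fix g :: "real ^ 'n \<Rightarrow> real" and S
  assume g [measurable]: "g \<in> borel_measurable borel" and g0: "\<forall>x. 0 \<le> g x" and S: "0 \<le> S"
    "(\<integral>\<^sup>+x\<in>hcube b s. ennreal (g x powr 1) \<partial>mu) \<le> ennreal S"
  let ?P = "hcube b s"
  define m where "m = measure mu ?P"
  define V where "V = s ^ CARD('n)"
  have V: "0 < V" using s by (simp add: V_def)
  have m: "0 < m" using m by (simp add: m_def)
  define I where "I = (\<integral>\<^sup>+x\<in>?P. ennreal (g x) \<partial>lborel)"
  have key: "ennreal (m / V) * I \<le> ennreal C * ennreal S"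
    if C: "AE x in lebesgue. HL_maximal w x \<le> ennreal (C * w x)" for C
  proof -
    have "AE x in lborel. HL_maximal w x \<le> ennreal (C * w x)" using C by (simp add: AE_completion_iff)
    then have "AE x in lborel. x \<in> ?P \<longrightarrow> ennreal (m / V) \<le> ennreal C * ennreal (w' x)"
      using AE_hcube[OF s(2)]
    proof eventually_elim
      case (elim x)
      show ?case
      proof
        assume x: "x \<in> ?P"
        have "(\<integral>\<^sup>+y\<in>cube b s. ennreal \<bar>w y\<bar> \<partial>lebesgue) = (\<integral>\<^sup>+y\<in>cube b s. ennreal (w y) \<partial>lebesgue)"
          unfolding cube_integral_eq[OF s(1)] using AE_hcube[OF s(2)]
          by (intro nn_integral_cong_AE) (auto elim!: eventually_mono simp: indicator_def)
        then have "ennreal (m / V) = (\<integral>\<^sup>+y\<in>cube b s. ennreal \<bar>w y\<bar> \<partial>lebesgue) / emeasure lebesgue (cube b s)"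
          using m V measure_mu[OF s] by (simp add: cube_measure_eq[OF s(1)] m_def V_def divide_ennreal[symmetric])
        also have "\<dots> \<le> HL_maximal w x"
          unfolding HL_maximal_def
          by (rule SUP_upper) (use x hcube_subset_cube cube_in_cubes[OF s(1)] in auto)
        also have "\<dots> \<le> ennreal (C * w x)" using elim by simp
        also have "\<dots> = ennreal C * ennreal (w' x)" using elim x by (simp add: ennreal_mult'')
        finally show "ennreal (m / V) \<le> ennreal C * ennreal (w' x)" .
      qed
    qed
    then have "(\<integral>\<^sup>+x. ennreal (m / V) * (ennreal (g x) * indicator ?P x) \<partial>lborel)
        \<le> (\<integral>\<^sup>+x. ennreal C * (ennreal (w' x) * (ennreal (g x powr 1) * indicator ?P x)) \<partial>lborel)"
      using g0 by (intro nn_integral_mono_AE)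
        (auto elim!: eventually_mono simp: indicator_def mult.assoc[symmetric] intro!: mult_right_mono)
    also have "\<dots> = ennreal C * (\<integral>\<^sup>+x. ennreal (w' x) * (ennreal (g x powr 1) * indicator ?P x) \<partial>lborel)"
      by (rule nn_integral_cmult) measurable
    also have "(\<integral>\<^sup>+x. ennreal (w' x) * (ennreal (g x powr 1) * indicator ?P x) \<partial>lborel) = (\<integral>\<^sup>+x\<in>?P. ennreal (g x powr 1) \<partial>mu)"
      unfolding mu_def by (rule nn_integral_density[symmetric]) measurable
    also have "ennreal C * \<dots> \<le> ennreal C * ennreal S" by (intro mult_left_mono S) simp
    also have "(\<integral>\<^sup>+x. ennreal (m / V) * (ennreal (g x) * indicator ?P x) \<partial>lborel) = ennreal (m / V) * I"
      unfolding I_def by (rule nn_integral_cmult) measurable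
    finally show ?thesis .
  qed
  have "I \<le> ennreal (V * (W * S / m))"
  proof -
    \<comment> \<open>To pass to the infimum over C, the bound is first divided by \<open>S\<close>.
      For \<open>S = 0\<close> a single admissible constant already gives 0; this is the role of
      \<open>ex\<close>.\<close>
    have "ennreal (m / V) * I \<le> ennreal W * ennreal S"
    proof (cases "S = 0")
      case True
      then show ?thesis using key[OF ex] by simp
    next
      case False
      then have S0: "0 < S" using S by simp
      have "ennreal (m / V) * I / ennreal S \<le> A1_const w"
        unfolding A1_const_def
      proof (rule Inf_greatest, safe)
        fix C assume "AE x in lebesgue. HL_maximal w x \<le> ennreal (C * w x)"
        from key[OF this] show "ennreal (m / V) * I / ennreal S \<le> ennreal C"
          using S0 by (intro divide_le_posI_ennreal) (auto simp: mult.commute)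
      qed
      then have "ennreal (m / V) * I / ennreal S * ennreal S \<le> ennreal W * ennreal S"
        unfolding W(1) by (rule mult_right_mono) simp
      also have "ennreal (m / V) * I / ennreal S * ennreal S = ennreal (m / V) * I"
        using S0 by (simp add: ennreal_divide_times ennreal_divide_self)
      finally show ?thesis .
    qed
    then have "ennreal (V / m) * (ennreal (m / V) * I) \<le> ennreal (V / m) * (ennreal W * ennreal S)"
      by (rule mult_left_mono) simp
    also have "ennreal (V / m) * (ennreal (m / V) * I) = I"
      using m V by (simp add: mult.assoc[symmetric] ennreal_mult[symmetric])
    also have "ennreal (V / m) * (ennreal W * ennreal S) = ennreal (V * (W * S / m))"
      using m V W S by (simp add: ennreal_mult[symmetric])
    finally show ?thesis .
  qed
  then show "(\<integral>\<^sup>+x\<in>?P. ennreal (g x) \<partial>lborel) \<le> ennreal (s ^ CARD('n) * (W * S / measure mu ?P) powr (1 / 1))"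
    using W S m by (simp add: I_def V_def m_def)
qed

text \<open>\<open>p = 1\<close> forces \<open>r = 1\<close>, and membership then provides the
  admissible constant.\<close>

lemma Ap_averaging:
  assumes Ap: "Ap_weight r w" and r: "1 \<le> r" "r \<le> p" and W: "Ap_const p w = ennreal W" "0 \<le> W"
  shows "averaging mu (hcube a l) p W"
proof (cases "p = 1")
  case True
  then obtain C where "AE x in lebesgue. HL_maximal w x \<le> ennreal (C * w x)"
    using Ap r by (auto simp: Ap_weight_def)
  then show ?thesis using W True A1_averaging by (auto simp: Ap_const_def)
next
  case False
  then show ?thesis using Ap_averaging_gt_1 W r by simp
qed

text \<open>The cube itself competes in the maximal function, which is therefore at least the mean
  of \<open>w\<close> on it.\<close>

lemma Ainf_ge_1: "1 \<le> Ainf_const w"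
proof -
  let ?Q = "cube a l"
  define m where "m = measure mu (hcube a l)"
  have m: "0 < m" using measure_mu_pos[OF l] by (simp add: m_def)
  define V where "V = l ^ CARD('n)"
  have V: "0 < V" using l by (simp add: V_def)
  have vol: "emeasure lebesgue ?Q = ennreal V" by (simp add: cube_measure_eq[OF l] V_def)
  have wm: "wmeas w ?Q = ennreal m" using measure_mu[OF l] by (simp add: wmeas_def m_def)
  have "(\<integral>\<^sup>+y\<in>?Q. ennreal \<bar>indicator ?Q y * w y\<bar> \<partial>lebesgue) = (\<integral>\<^sup>+y\<in>?Q. ennreal (w y) \<partial>lebesgue)"
    unfolding nn_integral_completion using w'_eq
    by (intro nn_integral_cong_AE) (auto elim!: eventually_mono simp: indicator_def)
  also have "\<dots> = ennreal m" using wm by (simp add: wmeas_def)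
  finally have avg: "ennreal (m / V) = (\<integral>\<^sup>+y\<in>?Q. ennreal \<bar>indicator ?Q y * w y\<bar> \<partial>lebesgue) / emeasure lebesgue ?Q"
    using m V by (simp add: vol divide_ennreal)
  have HL: "ennreal (m / V) \<le> HL_maximal (\<lambda>y. indicator ?Q y * w y) x" if "x \<in> ?Q" for x
    unfolding avg HL_maximal_def by (rule SUP_upper) (use that cube_in_cubes[OF l] in auto)
  have "ennreal m = ennreal (m / V) * emeasure lebesgue ?Q"
    using m V by (simp add: vol ennreal_mult[symmetric])
  also have "\<dots> = (\<integral>\<^sup>+x. ennreal (m / V) * indicator ?Q x \<partial>lebesgue)"
    by (subst nn_integral_cmult_indicator) (auto simp: cube_def)
  also have "\<dots> \<le> (\<integral>\<^sup>+x\<in>?Q. HL_maximal (\<lambda>y. indicator ?Q y * w y) x \<partial>lebesgue)"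
    using HL by (intro nn_integral_mono) (auto split: split_indicator)
  finally have "ennreal m / ennreal m \<le> (\<integral>\<^sup>+x\<in>?Q. HL_maximal (\<lambda>y. indicator ?Q y * w y) x \<partial>lebesgue) / wmeas w ?Q"
    unfolding wm by (rule divide_right_mono_ennreal)
  also have "\<dots> \<le> Ainf_const w"
    unfolding Ainf_const_def by (rule SUP_upper) (rule cube_in_cubes[OF l])
  finally show ?thesis using m by (simp add: ennreal_divide_self)
qed

end

section \<open>The weighted inequality\<close>

lemma ennreal_powr_ennreal: "0 \<le> x \<Longrightarrow> ennreal_powr (ennreal x) s = ennreal (x powr s)"
  by (simp add: ennreal_powr_def)

lemma ennreal_powr_mono: "0 \<le> s \<Longrightarrow> x \<le> y \<Longrightarrow> ennreal_powr x s \<le> ennreal_powr y s"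
  by (cases x; cases y) (auto simp: ennreal_powr_def top_unique intro!: ennreal_leI powr_mono2)

context borel_weight
begin

lemma poincare_sobolev_Ar:
  fixes f' :: "real ^ 'n \<Rightarrow> real"
  assumes d: "0 < d" "d < 1" and r: "1 \<le> r" "r \<le> p" and p: "p < real CARD('n) / d"
    and avg_r: "averaging mu (hcube a l) r R" and R: "1 \<le> R"
    and q: "1 / p - 1 / q = d / real CARD('n) * (1 / (r + ln R))"
    and avg_p: "averaging mu (hcube a l) p W" and W: "0 < W"
    and f' [measurable]: "f' \<in> borel_measurable borel"
    and N: "0 \<le> N" "double_integral mu (hcube a l) (frac_kernel d p f')
      \<le> ennreal (N powr p * measure mu (hcube a l))"
  shows "0 < q" "p * r / (real CARD('n) * r - d * p) > 0"
    and "\<exists>c. (\<integral>\<^sup>+x\<in>hcube a l. ennreal (\<bar>f' x - c\<bar> powr q) \<partial>mu)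
      \<le> ennreal (measure mu (hcube a l) * (18432 * (2 * (2 * sqrt (real CARD('n))) * real CARD('n) * real CARD('n)) ^ CARD('n) *
          (real CARD('n) * p * r / (real CARD('n) * r - d * p)) * W powr (1 / p) *
          ((1 - d) powr (1 / p) / d powr (1 - 1 / p) * l powr d) * N) powr q)"
proof -
  define n where "n = real CARD('n)"
  have n: "1 \<le> n" by (simp add: n_def Suc_le_eq)
  have p1: "1 \<le> p" using r by simp
  have dp: "d * p < n" using p d by (simp add: n_def field_simps)
  define eta where "eta = 1 / p - 1 / q"
  define t where "t = r + ln R"
  have t: "r \<le> t" "1 \<le> t" using r R by (simp_all add: t_def add_increasing2)
  have eta_eq: "eta = d / (n * t)" using q by (simp add: eta_def n_def t_def)
  have eta0: "0 < eta" unfolding eta_eq using d n t by (intro divide_pos_pos mult_pos_pos) linarith+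
  have eta_r: "eta \<le> d / (n * r)" unfolding eta_eq
    using d n t r by (intro divide_left_mono mult_left_mono mult_pos_pos) linarith+
  have nr: "1 \<le> n * r" using mult_mono[of 1 n 1 r] n r by simp
  have eta_d: "eta \<le> d"
  proof -
    have "d / (n * r) \<le> d / 1" using d nr by (intro divide_left_mono) auto
    then show ?thesis using eta_r by simp
  qed
  have "d * p < n * r" using dp mult_left_mono[OF r(1), of n] n by linarith
  then have pos: "0 < n * r - d * p" by simp
  \<comment> \<open>Dropping the logarithm gives \<open>eta \<le> d / (n * r)\<close>. Inverted,
    this bounds q by npr/(nr-dp), the factor in the theorem.\<close>
  have inv_q: "(n * r - d * p) / (n * p * r) \<le> 1 / q"
  proof -
    have "(n * r - d * p) / (n * p * r) = 1 / p - d / (n * r)"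
      using n p1 r by (simp add: field_simps)
    also have "\<dots> \<le> 1 / p - eta" using eta_r by simp
    finally show ?thesis by (simp add: eta_def)
  qed
  have "0 < (n * r - d * p) / (n * p * r)" using pos n p1 r by (intro divide_pos_pos mult_pos_pos) linarith+
  then have "0 < 1 / q" using inv_q by linarith
  then show q0: "0 < q" by simp
  show "p * r / (real CARD('n) * r - d * p) > 0"
    using pos p1 r by (intro divide_pos_pos mult_pos_pos) (simp_all add: n_def)
  have pq: "p < q"
  proof -
    have "1 / q < 1 / p" using eta0 by (simp add: eta_def)
    then show ?thesis using q0 p1 by (simp add: field_simps)
  qed
  have q_le: "q \<le> n * p * r / (n * r - d * p)"
    using inv_q q0 pos n p1 r by (simp add: field_simps)
  interpret dyadic_cube mu a l p W q d
  proof (intro dyadic_cube.intro cube_measure.intro dyadic_cube_axioms.intro)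
    show "(s / l) powr d \<le> exp 1 * (measure mu (hcube b s) / measure mu (hcube a l)) powr (1 / p - 1 / q)"
      if "0 < s" "hcube b s \<subseteq> hcube a l" for b s
      using averaging_decay[OF sets_mu finite_mu avg_r r(1) R l that d refl] unfolding q[symmetric] .
  qed (fact sets_mu finite_mu avg_p p1 W l pq d(1) d(2) eta_d[unfolded eta_def]
      less_imp_le[OF dp[unfolded n_def]])+
  have "energy f' \<le> ennreal (N powr p * mQ)" using N(2) by (simp add: energy_def)
  from poincare_sobolev[OF f' N(1) this]
  obtain c where c: "(\<integral>\<^sup>+x\<in>Q. ennreal (\<bar>f' x - c\<bar> powr q) \<partial>mu) \<le> ennreal (mQ * (32 * poincare_const * N) powr q)"
    by auto
  \<comment> \<open>18432 = 32 * 576, and \<open>loss\<close> is 1 / d^(1-1/p); the remaining q is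
    replaced by its bound.\<close>
  have "32 * poincare_const * N \<le> 18432 * (2 * (2 * sqrt n) * n * n) ^ CARD('n) * (n * p * r / (n * r - d * p)) * W powr (1 / p) *
      ((1 - d) powr (1 / p) / d powr (1 - 1 / p) * l powr d) * N"
  proof -
    define G where "G = (2 * (2 * sqrt n) * n * n) ^ CARD('n)"
    define L where "L = W powr (1 / p) * ((1 - d) powr (1 / p) / d powr (1 - 1 / p) * l powr d) * N"
    have "loss = 1 / d powr (1 - 1 / p)" using d by (simp add: loss_def powr_divide)
    then have "32 * poincare_const * N = (18432 * G * L) * q"
      by (simp add: poincare_const_def G_def L_def n_def mult_ac)
    also have "\<dots> \<le> (18432 * G * L) * (n * p * r / (n * r - d * p))"
      using N(1) n by (intro mult_left_mono q_le) (auto simp: G_def L_def)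
    finally show ?thesis by (simp add: G_def L_def mult_ac)
  qed
  then have "ennreal (mQ * (32 * poincare_const * N) powr q)
    \<le> ennreal (mQ * (18432 * (2 * (2 * sqrt n) * n * n) ^ CARD('n) * (n * p * r / (n * r - d * p)) * W powr (1 / p) *
      ((1 - d) powr (1 / p) / d powr (1 - 1 / p) * l powr d) * N) powr q)"
    using poincare_const_nonneg N(1) q0 by (intro ennreal_leI mult_left_mono powr_mono2) auto
  with c show "\<exists>c. (\<integral>\<^sup>+x\<in>hcube a l. ennreal (\<bar>f' x - c\<bar> powr q) \<partial>mu)
      \<le> ennreal (measure mu (hcube a l) * (18432 * (2 * (2 * sqrt (real CARD('n))) * real CARD('n) * real CARD('n)) ^ CARD('n) *
          (real CARD('n) * p * r / (real CARD('n) * r - d * p)) * W powr (1 / p) *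
          ((1 - d) powr (1 / p) / d powr (1 - 1 / p) * l powr d) * N) powr q)"
    unfolding n_def by (blast intro: order_trans)
qed

lemma poincare_sobolev_weight:
  fixes f :: "real ^ 'n \<Rightarrow> real"
  assumes d: "0 < d" "d < 1" and r: "1 \<le> r" "r \<le> p" and p: "p < real CARD('n) / d"
    and Ap: "Ap_weight r w"
    and q: "1 / p - 1 / q = d / real CARD('n) * (1 / (r + ln (enn2real (Ap_const r w))))"
    and f' [measurable]: "f' \<in> borel_measurable borel" and f'_eq: "AE x in lborel. x \<in> cube a l \<longrightarrow> f' x = f x"
  shows "(INF c::real. ennreal_powr
           ((\<integral>\<^sup>+x\<in>cube a l. ennreal (\<bar>f x - c\<bar> powr q * w x) \<partial>lebesgue) / wmeas w (cube a l))
           (1 / q))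
        \<le> ennreal (18432 * (2 * (2 * sqrt (real CARD('n))) * real CARD('n) * real CARD('n)) ^ CARD('n) * (real CARD('n) * p * r / (real CARD('n) * r - d * p)))
          * ennreal_powr (Ap_const p w) (1 / p) * Ainf_const w
          * ennreal ((1 - d) powr (1 / p) / d powr (1 - 1 / p) * l powr d)
          * ennreal_powr
              ((\<integral>\<^sup>+x\<in>cube a l.
                  (\<integral>\<^sup>+y\<in>cube a l.
                     frac_kernel d p f x y
                     \<partial>lebesgue) * ennreal (w x) \<partial>lebesgue) / wmeas w (cube a l))
              (1 / p)"
    (is "?lhs \<le> ennreal ?K * ?A * ?I * ennreal ?D * ennreal_powr (?E / _) _")
proof -
  let ?n = "real CARD('n)"
  have p1: "1 \<le> p" using r by simp
  define m where "m = measure mu (hcube a l)"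
  have m: "0 < m" using measure_mu_pos[OF l order_refl] by (simp add: m_def)
  have wm: "wmeas w (cube a l) = ennreal m" using measure_mu[OF l order_refl] by (simp add: wmeas_def m_def)
  have Ar_fin: "Ap_const r w < \<infinity>"
  proof (cases "r = 1")
    case True
    then obtain C where "AE x in lebesgue. HL_maximal w x \<le> ennreal (C * w x)" using Ap by (auto simp: Ap_weight_def)
    then have "A1_const w \<le> ennreal C" unfolding A1_const_def by (intro Inf_lower) auto
    also have "\<dots> < \<infinity>" by simp
    finally show ?thesis using True by (simp add: Ap_const_def)
  qed (use Ap in \<open>simp add: Ap_weight_def\<close>)
  define R where "R = enn2real (Ap_const r w)"
  have R: "Ap_const r w = ennreal R" "0 \<le> R" using Ar_fin by (simp_all add: R_def)
  have avg_r: "averaging mu (hcube a l) r R" by (rule Ap_averaging[OF Ap r(1) order_refl R])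
  have R1: "1 \<le> R" by (rule averaging_const_ge_1[OF sets_mu finite_mu avg_r r(1) R(2) l])
  have energy: "double_integral mu (hcube a l) (frac_kernel d p f') = ?E"
  proof -
    have "double_integral mu (hcube a l) (frac_kernel d p f')
      = (\<integral>\<^sup>+x\<in>cube a l. (\<integral>\<^sup>+y\<in>hcube a l.
        frac_kernel d p f' x y \<partial>lborel) * ennreal (w x) \<partial>lebesgue)"
      by (rule integral_mu[OF _ l order_refl]) measurable
    also have "\<dots> = ?E"
      unfolding nn_integral_completion
    proof (rule nn_integral_cong_AE)
      show "AE x in lborel. (\<integral>\<^sup>+y\<in>hcube a l.
            frac_kernel d p f' x y \<partial>lborel) * ennreal (w x) * indicator (cube a l) x
          = (\<integral>\<^sup>+y\<in>cube a l.
            frac_kernel d p f x y \<partial>lborel) * ennreal (w x) * indicator (cube a l) x"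
        using f'_eq
      proof eventually_elim
        case (elim x)
        have "(\<integral>\<^sup>+y\<in>hcube a l. frac_kernel d p f' x y \<partial>lborel)
          = (\<integral>\<^sup>+y\<in>cube a l. frac_kernel d p f x y \<partial>lborel)"
          if x: "x \<in> cube a l"
          using f'_eq AE_hcube_cube[OF l, of a] elim x
          by (intro nn_integral_cong_AE) (auto elim!: eventually_elim2 simp: indicator_def)
        then show ?case by (auto simp: indicator_def)
      qed
    qed
    finally show ?thesis .
  qed
  have osc: "(\<integral>\<^sup>+x\<in>cube a l. ennreal (\<bar>f x - c\<bar> powr q * w x) \<partial>lebesgue)
      = (\<integral>\<^sup>+x\<in>hcube a l. ennreal (\<bar>f' x - c\<bar> powr q) \<partial>mu)" for c
  proof -
    have "(\<integral>\<^sup>+x\<in>hcube a l. ennreal (\<bar>f' x - c\<bar> powr q) \<partial>mu)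
        = (\<integral>\<^sup>+x\<in>cube a l. ennreal (\<bar>f' x - c\<bar> powr q) * ennreal (w x) \<partial>lebesgue)"
      by (rule integral_mu[OF _ l order_refl]) measurable
    also have "\<dots> = (\<integral>\<^sup>+x\<in>cube a l. ennreal (\<bar>f x - c\<bar> powr q * w x) \<partial>lebesgue)"
      unfolding nn_integral_completion using f'_eq w'_eq
      by (intro nn_integral_cong_AE) (auto elim!: eventually_elim2 simp: indicator_def ennreal_mult)
    finally show ?thesis by simp
  qed
  \<comment> \<open>\<open>W\<close> is left open: the A_p constant is inserted when it is finite,
    the A_r constant \<open>R\<close> otherwise.\<close>
  have main: "?lhs \<le> ennreal (?K * W powr (1 / p) * ?D * N)"
    and K_pos: "0 < ?K"
    if avg_p: "averaging mu (hcube a l) p W" and W: "0 < W" and N: "0 \<le> N" "?E = ennreal (N powr p * m)" for W N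
  proof -
    note ps = poincare_sobolev_Ar[OF d r p avg_r R1 _ avg_p W f' N(1)]
    have en: "double_integral mu (hcube a l) (frac_kernel d p f')
      \<le> ennreal (N powr p * measure mu (hcube a l))"
      unfolding energy N(2) m_def ..
    have q': "1 / p - 1 / q = d / ?n * (1 / (r + ln R))" using q by (simp add: R_def)
    have q0: "0 < q" and K0: "p * r / (?n * r - d * p) > 0" using ps(1,2)[OF q' en] by auto
    show K_pos: "0 < ?K"
    proof (intro mult_pos_pos)
      show "0 < ?n * p * r / (?n * r - d * p)"
        using mult_pos_pos[OF _ K0, of "?n"] by (simp add: mult.assoc)
    qed auto
    define Z where "Z = ?K * W powr (1 / p) * ?D * N"
    have Z: "0 \<le> Z"
      unfolding Z_def
      by (rule mult_nonneg_nonneg[OF mult_nonneg_nonneg[OF mult_nonneg_nonneg[OF less_imp_le[OF K_pos]]]])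
        (use N in auto)
    obtain c where c: "(\<integral>\<^sup>+x\<in>hcube a l. ennreal (\<bar>f' x - c\<bar> powr q) \<partial>mu) \<le> ennreal (m * Z powr q)"
      using ps(3)[OF q' en] by (auto simp: m_def Z_def)
    have "?lhs \<le> ennreal_powr ((\<integral>\<^sup>+x\<in>cube a l. ennreal (\<bar>f x - c\<bar> powr q * w x) \<partial>lebesgue) / wmeas w (cube a l)) (1 / q)"
      by (rule INF_lower) simp
    also have "\<dots> \<le> ennreal_powr (ennreal (m * Z powr q) / ennreal m) (1 / q)"
      unfolding osc wm using q0 c by (intro ennreal_powr_mono divide_right_mono_ennreal) auto
    also have "\<dots> = ennreal Z"
      using m Z q0 by (simp add: divide_ennreal ennreal_powr_ennreal powr_powr)
    finally show "?lhs \<le> ennreal (?K * W powr (1 / p) * ?D * N)" by (simp add: Z_def)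
  qed
  have D: "0 < ?D" using d l by simp
  have avg_pR: "averaging mu (hcube a l) p R" by (rule averaging_mono[OF avg_r r R(2)])
  \<comment> \<open>Lower bounds by 1 keep the constants of the weight away from 0, so that an
    infinite factor makes the whole product infinite.\<close>
  have Ap_ge_1: "1 \<le> Ap_const p w"
  proof (cases "Ap_const p w")
    case (real W)
    have "averaging mu (hcube a l) p W" by (rule Ap_averaging[OF Ap r real(2,1)])
    from averaging_const_ge_1[OF sets_mu finite_mu this p1 real(1) l] show ?thesis using real by simp
  qed simp
  have A_pos: "1 \<le> ?A"
    using ennreal_powr_mono[OF _ Ap_ge_1, of "1 / p"] p1 ennreal_powr_ennreal[of 1 "1 / p"] by simp
  show ?thesis
  proof (cases "?E / ennreal m")
    case (real x)
    then have E: "?E = ennreal ((x powr (1 / p)) powr p * m)"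
    proof -
      have "?E = ?E / ennreal m * ennreal m" using m by (simp add: ennreal_divide_times ennreal_divide_self)
      also have "\<dots> = ennreal (x * m)" using real m by (simp add: ennreal_mult)
      finally show ?thesis using real p1 by (simp add: powr_powr)
    qed
    have last: "ennreal_powr (?E / wmeas w (cube a l)) (1 / p) = ennreal (x powr (1 / p))"
      using real by (simp add: wm ennreal_powr_ennreal)
    note K_pos = K_pos[OF avg_pR _ _ E]
    have K: "0 < ?K" using K_pos R1 by simp
    show ?thesis
    proof (cases "Ap_const p w")
      case W: (real W)
      have W1: "1 \<le> W" using Ap_ge_1 W by simp
      have avg_pW: "averaging mu (hcube a l) p W" by (rule Ap_averaging[OF Ap r W(2,1)])
      have "?lhs \<le> ennreal (?K * W powr (1 / p) * ?D * x powr (1 / p))"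
        using main[OF avg_pW _ _ E] W1 by simp
      \<comment> \<open>The factor 1 holds the place of the A_infinity constant.\<close>
      also have "\<dots> = ennreal ?K * ennreal (W powr (1 / p)) * 1 * ennreal ?D * ennreal (x powr (1 / p))"
        using K D by (simp only: mult_1_right ennreal_mult[symmetric] mult_nonneg_nonneg less_imp_le powr_ge_zero)
      also have "\<dots> \<le> ennreal ?K * ?A * ?I * ennreal ?D * ennreal (x powr (1 / p))"
        using Ainf_ge_1 W(1) unfolding W(2) by (intro mult_mono) (auto simp: ennreal_powr_ennreal)
      finally show ?thesis unfolding last .
    next
      case top
      show ?thesis
      proof (cases "x = 0")
        case True
        \<comment> \<open>In \<open>ennreal\<close> 0 times infinity is 0, so vanishing energy with
          an infinite constant is a genuine claim; the estimate with \<open>R\<close> proves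
          it.\<close>
        have "?lhs \<le> 0" using main[OF avg_pR _ _ E] R1 True by simp
        then show ?thesis by simp
      next
        case False
        then have "0 < x powr (1 / p)" by simp
        moreover have "?A = top" using top by (simp add: ennreal_powr_def)
        moreover have "?I \<noteq> 0" using Ainf_ge_1 by auto
        ultimately have "ennreal ?K * ?A * ?I * ennreal ?D * ennreal (x powr (1 / p)) = top"
          using K D by (simp add: ennreal_mult_eq_top_iff ennreal_eq_0_iff not_le)
        then show ?thesis unfolding last by simp
      qed
    qed
  next
    case top
    have last: "ennreal_powr (?E / wmeas w (cube a l)) (1 / p) = top"
      using top by (simp add: wm ennreal_powr_def)
    have "0 < ?K"
    proof -
      have "d * p < ?n" using p d by (simp add: field_simps)
      also have "?n * 1 \<le> ?n * r" using r by (intro mult_left_mono) auto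
      finally have "0 < ?n * r - d * p" by simp
      then show ?thesis using r by (intro mult_pos_pos divide_pos_pos) auto
    qed
    moreover have "?A \<noteq> 0" "?I \<noteq> 0" using A_pos Ainf_ge_1 by auto
    ultimately have "ennreal ?K * ?A * ?I * ennreal ?D * top = top"
      using D by (simp add: ennreal_mult_eq_top_iff ennreal_eq_0_iff not_le)
    then show ?thesis unfolding last by simp
  qed
qed

end

text \<open>Lebesgue measurability is measurability for the completion, where a Borel version
  exists; cutting off at the cube makes it integrable.\<close>

lemma borel_representative:
  fixes f :: "real ^ 'n \<Rightarrow> real"
  assumes "locally_integrable f"
  obtains g where "g \<in> borel_measurable borel" "AE x in lborel. indicator (cube a l) x * f x = g x"
    "(\<integral>\<^sup>+x. ennreal \<bar>g x\<bar> \<partial>lborel) < \<infinity>"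
proof -
  have "f absolutely_integrable_on cube a l"
    using assms by (auto simp: locally_integrable_def cube_def)
  then have int: "integrable lebesgue (\<lambda>x. indicator (cube a l) x * f x)"
    by (simp add: set_integrable_def)
  then have "(\<lambda>x. indicator (cube a l) x * f x) \<in> borel_measurable (completion lborel)" by auto
  from completion_ex_borel_measurable_real[OF this]
  obtain g where g: "g \<in> borel_measurable lborel" "AE x in lborel. indicator (cube a l) x * f x = g x" by auto
  have "(\<integral>\<^sup>+x. ennreal \<bar>g x\<bar> \<partial>lborel) = (\<integral>\<^sup>+x. ennreal (norm (indicator (cube a l) x * f x)) \<partial>lebesgue)"
    unfolding nn_integral_completion using g(2) by (intro nn_integral_cong_AE) (auto elim!: eventually_mono)
  also have "\<dots> < \<infinity>" using int by (simp add: integrable_iff_bounded)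
  finally show ?thesis using that g by simp
qed

theorem theorem5p9:
  shows "\<exists>C::real. 0 < C \<and>
    (\<forall>(\<delta>::real) (r::real) (p::real) (q::real) (f :: real ^ 'n \<Rightarrow> real) (w :: real ^ 'n \<Rightarrow> real).
      0 < \<delta> \<longrightarrow> \<delta> < 1 \<longrightarrow> 1 \<le> r \<longrightarrow> r \<le> p \<longrightarrow> p < real CARD('n) / \<delta> \<longrightarrow>
      locally_integrable f \<longrightarrow> Ap_weight r w \<longrightarrow>
      1 / p - 1 / q = \<delta> / real CARD('n) * (1 / (r + ln (enn2real (Ap_const r w)))) \<longrightarrow>
      (\<forall>(a :: real ^ 'n) (l::real). 0 < l \<longrightarrow>
        (INF c::real. ennreal_powr
           ((\<integral>\<^sup>+x\<in>cube a l. ennreal (\<bar>f x - c\<bar> powr q * w x) \<partial>lebesgue) / wmeas w (cube a l))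
           (1 / q))
        \<le> ennreal (C * (real CARD('n) * p * r / (real CARD('n) * r - \<delta> * p)))
          * ennreal_powr (Ap_const p w) (1 / p) * Ainf_const w
          * ennreal ((1 - \<delta>) powr (1 / p) / \<delta> powr (1 - 1 / p) * l powr \<delta>)
          * ennreal_powr
              ((\<integral>\<^sup>+x\<in>cube a l.
                  (\<integral>\<^sup>+y\<in>cube a l.
                     ennreal (\<bar>f x - f y\<bar> powr p / norm (x - y) powr (real CARD('n) + \<delta> * p))
                     \<partial>lebesgue) * ennreal (w x) \<partial>lebesgue) / wmeas w (cube a l))
              (1 / p)))"
proof (intro exI[of _ "18432 * (2 * (2 * sqrt (real CARD('n))) * real CARD('n) * real CARD('n)) ^ CARD('n)"] conjI allI impI, goal_cases)
  case 1
  show ?case by simp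
next
  case (2 d r p q f w a l)
  then have w: "Ap_weight r w" and l: "0 < l" by simp_all
  have w_weight: "locally_integrable w" "AE x in lborel. 0 < w x"
    using w by (auto simp: Ap_weight_def weight_def AE_completion_iff)
  obtain f' where f': "f' \<in> borel_measurable borel" "AE x in lborel. indicator (cube a l) x * f x = f' x"
    using borel_representative[OF 2(6)] by metis
  obtain g where g: "g \<in> borel_measurable borel" "AE x in lborel. indicator (cube a l) x * w x = g x"
    "(\<integral>\<^sup>+x. ennreal \<bar>g x\<bar> \<partial>lborel) < \<infinity>"
    using borel_representative[OF w_weight(1)] by metis
  have "borel_weight w (\<lambda>x. \<bar>g x\<bar>) a l"
  proof
    show "AE x in lborel. x \<in> cube a l \<longrightarrow> \<bar>g x\<bar> = w x \<and> 0 < w x"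
      using g(2) w_weight(2) by eventually_elim auto
  qed (use g l in auto)
  moreover have "AE x in lborel. x \<in> cube a l \<longrightarrow> f' x = f x"
    using f'(2) by eventually_elim auto
  ultimately show ?case
    by (intro borel_weight.poincare_sobolev_weight[OF _ 2(1-5) w 2(8) f'(1)])
qed

end
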